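(* Let $n\ge1$ and let $\Omega\subset\mathbb{R}^n$ be a nonempty open set that is invariant under translations by $2\pi\mathbb{Z}^n$. Then there exists a constant $C>0$, independent of $\lambda$, such that for all $\lambda\in\mathbb{R}$ and all $u\in H^2(\mathbb{R}^n)$, $f\in L^2(\mathbb{R}^n)$ with $$(\Delta-\lambda)u=f\quad\text{on }\mathbb{R}^n,$$ one has $$\|u\|_{L^2(\mathbb{R}^n)}\le C\big(\|f\|_{L^2(\mathbb{R}^n)}+\|u\|_{L^2(\Omega)}\big).$$
   Context: $\Delta=-\sum_{j=1}^n\partial_{x_j}^2$ denotes the nonnegative Laplace operator on $\mathbb{R}^n$. *)

theory Defs
  imports "HOL-Analysis.Analysis"
begin

text \<open>
  Classical partial derivative. It is only used for functions that are differentiable at every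
  point; elsewhere \<^const>\<open>frechet_derivative\<close> is an unspecified linear map.
\<close>
definition partial_deriv ::
    "'n::finite \<Rightarrow> (real^'n \<Rightarrow> complex) \<Rightarrow> real^'n \<Rightarrow> complex" where
  "partial_deriv i \<phi> x = frechet_derivative \<phi> (at x) (axis i 1)"

primrec Ck_fun :: "nat \<Rightarrow> (real^'n::finite \<Rightarrow> complex) \<Rightarrow> bool" where
  "Ck_fun 0 \<phi> \<longleftrightarrow> continuous_on UNIV \<phi>"
| "Ck_fun (Suc k) \<phi> \<longleftrightarrow>
     (\<forall>x. \<phi> differentiable (at x)) \<and> (\<forall>i. Ck_fun k (partial_deriv i \<phi>))"

definition test_function :: "(real^'n::finite \<Rightarrow> complex) \<Rightarrow> bool" where
  "test_function \<phi> \<longleftrightarrow> (\<forall>k. Ck_fun k \<phi>) \<and> compact (closure {x. \<phi> x \<noteq> 0})"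

definition square_integrable :: "'a measure \<Rightarrow> ('a \<Rightarrow> complex) \<Rightarrow> bool" where
  "square_integrable M u \<longleftrightarrow>
     u \<in> borel_measurable M \<and> integrable M (\<lambda>x. (cmod (u x))\<^sup>2)"

definition norm_L2 :: "'a measure \<Rightarrow> ('a \<Rightarrow> complex) \<Rightarrow> real" where
  "norm_L2 M u = sqrt (LINT x|M. (cmod (u x))\<^sup>2)"

definition locally_integrable :: "(real^'n::finite \<Rightarrow> complex) \<Rightarrow> bool" where
  "locally_integrable u \<longleftrightarrow> (\<forall>K. compact K \<longrightarrow> set_integrable lebesgue K u)"

text \<open>
  The pairing with test functions is bilinear, without complex conjugation, as for distributions.
\<close>
definition has_weak_partial ::
    "'n::finite \<Rightarrow> (real^'n \<Rightarrow> complex) \<Rightarrow> (real^'n \<Rightarrow> complex) \<Rightarrow> bool" where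
  "has_weak_partial i u v \<longleftrightarrow>
     locally_integrable u \<and> locally_integrable v \<and>
     (\<forall>\<phi>. test_function \<phi> \<longrightarrow>
        (LINT x|lebesgue. u x * partial_deriv i \<phi> x) = - (LINT x|lebesgue. v x * \<phi> x))"

text \<open>A representative of the weak derivative, which is unique up to null sets if it exists.\<close>
definition weak_partial ::
    "'n::finite \<Rightarrow> (real^'n \<Rightarrow> complex) \<Rightarrow> real^'n \<Rightarrow> complex" where
  "weak_partial i u = (SOME v. has_weak_partial i u v)"

text \<open>
  The Sobolev space \<open>H\<^sup>k\<close> on the whole space: all weak derivatives of order at most \<open>k\<close> exist
  and are square integrable.
\<close>
primrec sobolev_H :: "nat \<Rightarrow> (real^'n::finite \<Rightarrow> complex) \<Rightarrow> bool" where
  "sobolev_H 0 u \<longleftrightarrow> square_integrable lebesgue u"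
| "sobolev_H (Suc k) u \<longleftrightarrow>
     square_integrable lebesgue u \<and> (\<forall>i. \<exists>v. has_weak_partial i u v \<and> sobolev_H k v)"

text \<open>The sign is chosen such that the Laplace operator is nonnegative.\<close>
definition laplace_op :: "(real^'n::finite \<Rightarrow> complex) \<Rightarrow> real^'n \<Rightarrow> complex" where
  "laplace_op u x = - (\<Sum>j\<in>UNIV. weak_partial j (weak_partial j u) x)"

end

theory Submission
  imports Defs
begin

text \<open>
  For a function that is periodic with respect to a large box, the equation
  \<open>(\<Delta> - \<lambda>) u = f\<close> says that the Fourier coefficients satisfy
  \<open>(\<bar>\<xi>\<bar>\<^sup>2 - \<lambda>) u\<^sub>\<xi> = f\<^sub>\<xi>\<close>. The part of \<open>u\<close> with
  \<open>\<bar>\<bar>\<xi>\<bar>\<^sup>2 - \<lambda>\<bar> > 1\<close> is therefore bounded by \<open>f\<close>, and it remains to estimate a function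
  \<open>v\<close> with spectrum in the shell \<open>\<bar>\<bar>\<xi>\<bar>\<^sup>2 - \<lambda>\<bar> \<le> 1\<close> by its restriction to \<open>\<Omega>\<close>, with a constant
  that does not depend on \<open>\<lambda>\<close>. This is \<open>shell_observability\<close>.

  Let \<open>\<rho> \<ge> 0\<close> be a smooth bump supported in \<open>\<Omega>\<close>. Integrate \<open>\<rho> \<bar>v\<bar>\<^sup>2\<close> and sum over the translates
  of \<open>\<rho>\<close> by \<open>2\<pi>\<close> times integer vectors. Only frequencies \<open>\<xi>, \<eta>\<close> whose difference is an integer vector
  interact, and they do so with the strength \<open>\<rho>\<close>-hat of \<open>\<xi> - \<eta>\<close>, which is summable over the integer
  vectors. Group the frequencies into clusters. A cluster of diameter at most \<open>d\<close> has a lower bound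
  \<open>\<kappa>(d)\<close>, because exponentials are linearly independent on every ball
  (\<open>exponential_sum_lower_bound\<close>). Two clusters at distance more than \<open>R\<close> interact little if \<open>R\<close> is
  large. As \<open>\<kappa>(d)\<close> decreases in \<open>d\<close>, the distance \<open>R\<close> has to be chosen after \<open>d\<close>, and the point is that
  such clusters exist with finitely many scales \<open>d\<close>, for all \<open>\<lambda>\<close> at once (\<open>shell_partition\<close>). The reason
  is geometric. If \<open>\<xi>\<close> and \<open>\<xi> + m\<close> lie in the shell, then \<open>2 m \<bullet> \<xi> + \<bar>m\<bar>\<^sup>2\<close> is at most 2 in modulus.
  So if \<open>\<xi> + m\<close> is in the shell for all \<open>m\<close> in a set \<open>M\<close> of integer vectors of norm at most \<open>r\<close>, then
  the component of \<open>\<xi>\<close> in the span of \<open>M\<close> is bounded in terms of \<open>r\<close> only, and so is the diameter of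
  the section of the shell by \<open>\<xi> + span M\<close>. Start at \<open>\<xi>\<close> with \<open>M\<close> empty and add a vector to \<open>M\<close> as
  long as the section is not isolated. Each step raises the dimension of the span, hence there are at
  most \<open>n\<close> steps.

  To pass from the whole space to a period box, multiply \<open>u\<close> by a cutoff \<open>\<chi>(x / N)\<close> with \<open>N\<close> odd and
  regard the product as a function on the box of side \<open>2\<pi>N\<close>. Its frequencies run through the integer
  vectors divided by \<open>N\<close>. The clusters live inside cosets of the integer vectors, hence all constants
  are independent of \<open>N\<close>. The commutator of the Laplace operator with the cutoff is of order
  \<open>1 / N\<close> because the first derivatives of \<open>u\<close> are square integrable (\<open>localized_equation\<close>). The
  identity of Parseval on the box (\<open>parseval_approx\<close>) turns the estimate for the coefficients into one
  for the function (\<open>periodic_estimate\<close>), and \<open>N \<rightarrow> \<infinity>\<close> gives the theorem.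

  Constants are irrelevant throughout, so all norms are used in squared form, and
  \<open>\<bar>a + b\<bar>\<^sup>2 \<le> 2 \<bar>a\<bar>\<^sup>2 + 2 \<bar>b\<bar>\<^sup>2\<close> replaces the triangle inequality.
\<close>

section \<open>Lattice points in a spherical shell\<close>

definition int_vecs :: "(real^'n::finite) set" where
  "int_vecs = {k. \<forall>i. k $ i \<in> \<int>}"

lemma zero_int_vecs [simp]: "0 \<in> int_vecs"
  by (simp add: int_vecs_def)

lemma int_vecs_add: "k \<in> int_vecs \<Longrightarrow> l \<in> int_vecs \<Longrightarrow> k + l \<in> int_vecs"
  by (simp add: int_vecs_def)

lemma int_vecs_diff: "k \<in> int_vecs \<Longrightarrow> l \<in> int_vecs \<Longrightarrow> k - l \<in> int_vecs"
  by (simp add: int_vecs_def)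

lemma int_vecs_minus: "k \<in> int_vecs \<Longrightarrow> - k \<in> int_vecs"
  by (simp add: int_vecs_def)

lemma int_vecs_minus_iff: "- k \<in> int_vecs \<longleftrightarrow> k \<in> int_vecs"
  using int_vecs_minus by fastforce

lemma finite_int_vecs_cball: "finite (int_vecs \<inter> cball (0::real^'n::finite) r)"
proof -
  let ?V = "\<lambda>g :: 'n \<Rightarrow> int. \<chi> i. real_of_int (g i)"
  let ?G = "PiE (UNIV::'n set) (\<lambda>_. {-\<lceil>r\<rceil>..\<lceil>r\<rceil>})"
  have "int_vecs \<inter> cball 0 r \<subseteq> ?V ` ?G"
  proof
    fix k :: "real^'n" assume k: "k \<in> int_vecs \<inter> cball 0 r"
    then have "\<forall>i. \<exists>z. k $ i = real_of_int z"
      by (auto simp: int_vecs_def Ints_def)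
    then obtain g where g: "\<And>i. k $ i = real_of_int (g i)" by metis
    have "\<bar>real_of_int (g i)\<bar> \<le> r" for i
      using k component_le_norm_cart[of k i] g[of i] by simp
    then have "\<bar>g i\<bar> \<le> \<lceil>r\<rceil>" for i
      by (metis ceiling_mono ceiling_of_int of_int_abs)
    then have "g \<in> ?G" by (simp add: PiE_UNIV_domain abs_le_iff minus_le_iff)
    moreover have "k = ?V g" by (simp add: vec_eq_iff g)
    ultimately show "k \<in> ?V ` ?G" by blast
  qed
  moreover have "finite (?V ` ?G)" by (intro finite_imageI finite_PiE) auto
  ultimately show ?thesis by (rule finite_subset)
qed

text \<open>
  A linear functional is controlled on a span by its values on the generators. The factor \<open>K\<close> depends
  only on \<open>M\<close>, not on \<open>\<xi>\<close>, and this uniformity is what makes the clusters of the shell independent of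
  its radius.
\<close>
lemma inner_bound_on_span:
  fixes M :: "'a::euclidean_space set"
  assumes "finite M"
  shows "\<exists>K\<ge>0. \<forall>\<xi> t. 0 \<le> t \<longrightarrow> (\<forall>m\<in>M. \<bar>m \<bullet> \<xi>\<bar> \<le> t) \<longrightarrow>
           (\<forall>v\<in>span M. \<bar>v \<bullet> \<xi>\<bar> \<le> K * t * norm v)"
  using assms
proof (induction M)
  case empty
  then show ?case by auto
next
  case (insert m M)
  then obtain K where K: "K \<ge> 0"
    and IH: "\<And>\<xi> t v. 0 \<le> t \<Longrightarrow> (\<And>m. m \<in> M \<Longrightarrow> \<bar>m \<bullet> \<xi>\<bar> \<le> t) \<Longrightarrow> v \<in> span M \<Longrightarrow> \<bar>v \<bullet> \<xi>\<bar> \<le> K * t * norm v"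
    by blast
  show ?case
  proof (cases "m \<in> span M")
    case True
    then have "span (insert m M) = span M" by (simp add: span_redundant)
    then show ?thesis using K by (intro exI[of _ K]) (auto intro!: IH)
  next
    case False
    \<comment> \<open>The new direction is \<open>q\<close>; the coefficient of \<open>m\<close> in \<open>v\<close> is read off from \<open>q \<bullet> v\<close>.\<close>
    obtain p q where p: "p \<in> span M" and q: "\<And>w. w \<in> span M \<Longrightarrow> orthogonal q w" and m: "m = p + q"
      using orthogonal_subspace_decomp_exists[of M m] by metis
    have q0: "norm q > 0" using False p m by auto
    define K' where "K' = 1 / norm q + K * (1 + norm m / norm q)"
    have "\<bar>v \<bullet> \<xi>\<bar> \<le> K' * t * norm v"
      if t: "0 \<le> t" and bd: "\<forall>m\<in>insert m M. \<bar>m \<bullet> \<xi>\<bar> \<le> t" and v: "v \<in> span (insert m M)" for \<xi> t v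
    proof -
      obtain a where a: "v - a *\<^sub>R m \<in> span M" using v by (auto simp: span_insert)
      define w where "w = v - a *\<^sub>R m"
      have w: "w \<in> span M" using a w_def by simp
      have aq: "\<bar>a\<bar> * norm q \<le> norm v"
      proof -
        have "q \<bullet> v = a * (q \<bullet> q)"
          using q[OF w] q[OF p] by (simp add: w_def m orthogonal_def inner_simps)
        then have "\<bar>a\<bar> * (norm q)\<^sup>2 \<le> norm q * norm v"
          using Cauchy_Schwarz_ineq2[of q v] by (simp add: abs_mult power2_norm_eq_inner)
        then have "norm q * (\<bar>a\<bar> * norm q) \<le> norm q * norm v"
          by (simp add: power2_eq_square ac_simps)
        then show ?thesis using q0 by (rule mult_left_le_imp_le)
      qed
      then have a_le: "\<bar>a\<bar> \<le> norm v / norm q" using q0 by (simp add: field_simps)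
      have "norm w \<le> norm v + \<bar>a\<bar> * norm m"
        unfolding w_def using norm_triangle_ineq4[of v "a *\<^sub>R m"] by simp
      also have "\<dots> \<le> norm v + norm v / norm q * norm m"
        using mult_right_mono[OF a_le norm_ge_zero[of m]] by simp
      finally have w_le: "norm w \<le> norm v * (1 + norm m / norm q)" by (simp add: algebra_simps)
      have "\<bar>v \<bullet> \<xi>\<bar> \<le> \<bar>a\<bar> * \<bar>m \<bullet> \<xi>\<bar> + \<bar>w \<bullet> \<xi>\<bar>"
      proof -
        have "v \<bullet> \<xi> = a * (m \<bullet> \<xi>) + w \<bullet> \<xi>" by (simp add: w_def inner_simps)
        then show ?thesis by (metis abs_mult abs_triangle_ineq)
      qed
      also have "\<dots> \<le> norm v / norm q * t + K * t * (norm v * (1 + norm m / norm q))"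
      proof (rule add_mono)
        show "\<bar>a\<bar> * \<bar>m \<bullet> \<xi>\<bar> \<le> norm v / norm q * t"
          using a_le bd by (intro mult_mono) auto
        have "\<bar>w \<bullet> \<xi>\<bar> \<le> K * t * norm w" using IH[OF t _ w] bd by auto
        also have "\<dots> \<le> K * t * (norm v * (1 + norm m / norm q))"
          using w_le K t by (intro mult_left_mono) auto
        finally show "\<bar>w \<bullet> \<xi>\<bar> \<le> \<dots>" .
      qed
      also have "\<dots> = K' * t * norm v" by (simp add: K'_def algebra_simps)
      finally show ?thesis .
    qed
    moreover have "K' \<ge> 0" using K q0 by (simp add: K'_def)
    ultimately show ?thesis by blast
  qed
qed

text \<open>
  The half-width 1 could be any fixed positive number.
\<close>
definition in_shell :: "real \<Rightarrow> 'a::euclidean_space \<Rightarrow> bool" where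
  "in_shell lam \<xi> \<longleftrightarrow> \<bar>\<xi> \<bullet> \<xi> - lam\<bar> \<le> 1"

lemma in_shell_diff:
  assumes "in_shell lam \<xi>" "in_shell lam (\<xi> + v)"
  shows "\<bar>v \<bullet> v + 2 * (v \<bullet> \<xi>)\<bar> \<le> 2"
proof -
  have "(\<xi> + v) \<bullet> (\<xi> + v) = \<xi> \<bullet> \<xi> + (v \<bullet> v + 2 * (v \<bullet> \<xi>))"
    by (simp add: inner_simps inner_commute)
  with assms show ?thesis unfolding in_shell_def by argo
qed

text \<open>
  The points \<open>\<xi> + m\<close> of the shell fix \<open>m \<bullet> \<xi>\<close> up to a bounded error, hence they bound the component
  of \<open>\<xi>\<close> in \<open>span M\<close>. A further point \<open>\<xi> + v\<close> with \<open>v\<close> in the span satisfies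
  \<open>\<bar>v\<bar>\<^sup>2 \<le> 2 + 2 \<bar>v \<bullet> \<xi>\<bar>\<close>, a quadratic inequality for the norm of \<open>v\<close>. There are only finitely many
  sets \<open>M\<close> of integer vectors in a ball, so one bound serves for all of them.
\<close>
lemma shell_slice_bounded:
  "\<exists>G\<ge>r. \<forall>lam \<xi> M v. M \<subseteq> int_vecs \<inter> cball (0::real^'n::finite) r \<longrightarrow> in_shell lam \<xi> \<longrightarrow>
     (\<forall>m\<in>M. in_shell lam (\<xi> + m)) \<longrightarrow> v \<in> span M \<longrightarrow> in_shell lam (\<xi> + v) \<longrightarrow> norm v \<le> G"
proof -
  let ?Z = "int_vecs \<inter> cball (0::real^'n) r"
  have "\<forall>M\<in>Pow ?Z. \<exists>K\<ge>0. \<forall>\<xi> t. 0 \<le> t \<longrightarrow> (\<forall>m\<in>M. \<bar>m \<bullet> \<xi>\<bar> \<le> t) \<longrightarrow>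
           (\<forall>v\<in>span M. \<bar>v \<bullet> \<xi>\<bar> \<le> K * t * norm v)"
    using inner_bound_on_span finite_subset[OF _ finite_int_vecs_cball] by (metis PowD)
  then obtain K where K0: "\<And>M. M \<subseteq> ?Z \<Longrightarrow> K M \<ge> 0"
    and K: "\<And>M \<xi> t v. M \<subseteq> ?Z \<Longrightarrow> 0 \<le> t \<Longrightarrow> (\<forall>m\<in>M. \<bar>m \<bullet> \<xi>\<bar> \<le> t) \<Longrightarrow> v \<in> span M \<Longrightarrow>
              \<bar>v \<bullet> \<xi>\<bar> \<le> K M * t * norm v"
    by (metis PowI)
  define K1 where "K1 = (\<Sum>M\<in>Pow ?Z. K M)"
  have finZ: "finite (Pow ?Z)" using finite_int_vecs_cball by (simp only: finite_Pow_iff)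
  have K1: "K M \<le> K1" if "M \<subseteq> ?Z" for M
    unfolding K1_def using that K0 finZ by (intro member_le_sum) auto
  have K1_nonneg: "K1 \<ge> 0" unfolding K1_def using K0 by (intro sum_nonneg) auto
  define G where "G = max r (2 + K1 * (2 + r\<^sup>2))"
  have "norm v \<le> G" if M: "M \<subseteq> ?Z" and xi: "in_shell lam \<xi>" and xm: "\<forall>m\<in>M. in_shell lam (\<xi> + m)"
      and v: "v \<in> span M" and xv: "in_shell lam (\<xi> + v)" for lam \<xi> M v
  proof -
    define t where "t = (2 + r\<^sup>2) / 2"
    have t0: "t \<ge> 0" by (simp add: t_def)
    have "\<bar>m \<bullet> \<xi>\<bar> \<le> t" if m: "m \<in> M" for m
    proof -
      have "norm m \<le> r" using m M by auto
      then have "m \<bullet> m \<le> r\<^sup>2" by (metis norm_ge_zero power2_norm_eq_inner power_mono)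
      moreover have "m \<bullet> m \<ge> 0" by simp
      moreover have "\<bar>m \<bullet> m + 2 * (m \<bullet> \<xi>)\<bar> \<le> 2"
        by (rule in_shell_diff[OF xi]) (use xm m in blast)
      ultimately have "m \<bullet> \<xi> \<le> t" "- (m \<bullet> \<xi>) \<le> t" unfolding t_def by argo+
      then show ?thesis by (rule abs_leI)
    qed
    then have "\<bar>v \<bullet> \<xi>\<bar> \<le> K M * t * norm v" by (intro K[OF M t0 _ v] ballI)
    also have "\<dots> \<le> K1 * t * norm v" using K1[OF M] t0 by (intro mult_right_mono) auto
    finally have 1: "\<bar>v \<bullet> \<xi>\<bar> \<le> K1 * t * norm v" .
    have "(norm v)\<^sup>2 \<le> 2 + 2 * (K1 * t * norm v)"
      using in_shell_diff[OF xi xv] 1 unfolding power2_norm_eq_inner by linarith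
    then have 2: "norm v * norm v \<le> 2 + K1 * (2 + r\<^sup>2) * norm v"
      by (simp add: t_def power2_eq_square)
    have nn: "K1 * (2 + r\<^sup>2) \<ge> 0" using K1_nonneg by simp
    have "norm v \<le> 2 + K1 * (2 + r\<^sup>2)"
    proof (rule ccontr)
      assume "\<not> ?thesis"
      then have gt: "norm v > 2 + K1 * (2 + r\<^sup>2)" by simp
      then have "norm v * norm v > (2 + K1 * (2 + r\<^sup>2)) * norm v"
        using nn by (intro mult_strict_right_mono) auto
      moreover have "2 * norm v > 2" using gt nn by linarith
      ultimately show False using 2 by (simp add: distrib_right)
    qed
    then show ?thesis by (simp add: G_def)
  qed
  moreover have "G \<ge> r" by (simp add: G_def)
  ultimately show ?thesis by blast
qed

text \<open>
  The cluster of \<open>\<xi>\<close> is a section of \<open>\<Lambda>\<close> by \<open>\<xi> + span M\<close>, restricted to integer differences. If some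
  point of \<open>\<Lambda>\<close> outside the section is within the prescribed distance, its difference to \<open>\<xi>\<close> is a
  new vector for \<open>M\<close>, outside the span and of controlled length. As the dimension cannot exceed that of
  the space, an isolated section is found after at most \<open>CARD('n)\<close> steps. The number \<open>D i\<close> bounds
  the section after \<open>i\<close> steps.
\<close>
lemma isolated_cluster_exists:
  fixes R :: "real \<Rightarrow> real"
  assumes R: "\<And>d. R d \<ge> d"
  shows "\<exists>D. mono D \<and> (\<forall>i. D i \<ge> (0::real)) \<and> (\<forall>lam \<Lambda>. \<forall>\<xi>\<in>\<Lambda>. (\<forall>\<eta>\<in>\<Lambda>. in_shell lam (\<eta>::real^'n::finite)) \<longrightarrow>
     (\<exists>i\<le>CARD('n). \<exists>C\<subseteq>\<Lambda>. \<xi> \<in> C \<and> (\<forall>\<eta>\<in>C. \<eta> - \<xi> \<in> int_vecs \<and> norm (\<eta> - \<xi>) \<le> D i) \<and>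
       (\<forall>\<eta>\<in>C. \<forall>\<zeta>\<in>\<Lambda> - C. \<zeta> - \<eta> \<in> int_vecs \<longrightarrow> norm (\<zeta> - \<eta>) > R (2 * D i))))"
proof -
  obtain G where G_ge: "\<And>r::real. G r \<ge> r"
    and G: "\<And>r lam \<xi> M v. M \<subseteq> int_vecs \<inter> cball (0::real^'n) r \<Longrightarrow> in_shell lam \<xi> \<Longrightarrow>
     (\<And>m. m\<in>M \<Longrightarrow> in_shell lam (\<xi> + m)) \<Longrightarrow> v \<in> span M \<Longrightarrow> in_shell lam (\<xi> + v) \<Longrightarrow> norm v \<le> G r"
    using shell_slice_bounded[where 'n='n] by metis
  \<comment> \<open>\<open>r i\<close> bounds the vectors of \<open>M\<close> after \<open>i\<close> steps; the argument \<open>2 * G \<rho>\<close> of \<open>R\<close> is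
    the diameter of the section.\<close>
  define r where "r = rec_nat (0::real) (\<lambda>_ \<rho>. G \<rho> + R (2 * G \<rho>))"
  define D where "D i = G (r i)" for i
  have r0: "r 0 = 0" and rS: "\<And>i. r (Suc i) = D i + R (2 * D i)"
    by (simp_all add: r_def D_def)
  have D_step: "D i \<ge> 0 \<and> r i \<ge> 0 \<and> D i \<le> r (Suc i) \<and> r (Suc i) \<le> D (Suc i)" for i
  proof (induction i)
    case 0
    have "D 0 \<ge> 0" using G_ge[of 0] by (simp add: D_def r0)
    then show ?case using R[of "2 * D 0"] G_ge[of "r (Suc 0)"] by (simp add: rS D_def[of "Suc 0"] r0)
  next
    case (Suc i)
    then have "D (Suc i) \<ge> 0" by linarith
    then show ?case using R[of "2 * D (Suc i)"] G_ge[of "r (Suc (Suc i))"] Suc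
      by (simp add: rS D_def[of "Suc (Suc i)"])
  qed
  have mono: "mono D" by (rule incseq_SucI) (meson D_step order_trans)
  have "\<exists>i\<le>CARD('n). \<exists>C\<subseteq>\<Lambda>. \<xi> \<in> C \<and> (\<forall>\<eta>\<in>C. \<eta> - \<xi> \<in> int_vecs \<and> norm (\<eta> - \<xi>) \<le> D i) \<and>
       (\<forall>\<eta>\<in>C. \<forall>\<zeta>\<in>\<Lambda> - C. \<zeta> - \<eta> \<in> int_vecs \<longrightarrow> norm (\<zeta> - \<eta>) > R (2 * D i))" (is "\<exists>i\<le>_. ?good i")
    if xi: "\<xi> \<in> \<Lambda>" and shell: "\<forall>\<eta>\<in>\<Lambda>. in_shell lam \<eta>" for lam \<Lambda> and \<xi> :: "real^'n"
  proof (rule ccontr)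
    assume neg: "\<not> (\<exists>i\<le>CARD('n). ?good i)"
    have "\<exists>M\<subseteq>int_vecs \<inter> cball 0 (r i). (\<forall>m\<in>M. \<xi> + m \<in> \<Lambda>) \<and> dim (span M) \<ge> i" if "i \<le> Suc (CARD('n))" for i
      using that
    proof (induction i)
      case 0
      show ?case by (rule exI[of _ "{}"]) auto
    next
      case (Suc i)
      then obtain M where M: "M \<subseteq> int_vecs \<inter> cball 0 (r i)" "\<And>m. m\<in>M \<Longrightarrow> \<xi> + m \<in> \<Lambda>" "dim (span M) \<ge> i"
        by auto
      define C where "C = {\<eta>\<in>\<Lambda>. \<eta> - \<xi> \<in> int_vecs \<inter> span M}"
      have bd: "norm (\<eta> - \<xi>) \<le> D i" if "\<eta> \<in> C" for \<eta>
        unfolding D_def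
        by (rule G[OF M(1), of lam \<xi>]) (use that xi shell M in \<open>auto simp: C_def\<close>)
      have "\<not> ?good i" using neg Suc.prems by auto
      moreover have "C \<subseteq> \<Lambda>" "\<xi> \<in> C" using xi by (auto simp: C_def span_zero)
      moreover have "\<forall>\<eta>\<in>C. \<eta> - \<xi> \<in> int_vecs \<and> norm (\<eta> - \<xi>) \<le> D i" using bd by (auto simp: C_def)
      ultimately have "\<not> (\<forall>\<eta>\<in>C. \<forall>\<zeta>\<in>\<Lambda> - C. \<zeta> - \<eta> \<in> int_vecs \<longrightarrow> norm (\<zeta> - \<eta>) > R (2 * D i))"
        by blast
      then obtain \<eta> \<zeta> where e: "\<eta> \<in> C" and z: "\<zeta> \<in> \<Lambda> - C" "\<zeta> - \<eta> \<in> int_vecs" "norm (\<zeta> - \<eta>) \<le> R (2 * D i)"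
        by (auto simp: not_less)
      define m where "m = \<zeta> - \<xi>"
      have m_eq: "m = (\<zeta> - \<eta>) + (\<eta> - \<xi>)" by (simp add: m_def)
      then have m_int: "m \<in> int_vecs" using z e by (simp only: int_vecs_add C_def mem_Collect_eq Int_iff)
      then have m_span: "m \<notin> span M" using z by (auto simp: C_def m_def)
      have "norm m \<le> norm (\<zeta> - \<eta>) + norm (\<eta> - \<xi>)" using m_eq norm_triangle_ineq by metis
      then have m_le: "norm m \<le> r (Suc i)" using z bd[OF e] by (simp add: rS)
      have "insert m M \<subseteq> int_vecs \<inter> cball 0 (r (Suc i))"
        using M(1) m_int m_le D_step[of i] G_ge[of "r i"] by (force simp: D_def)
      moreover have "\<forall>k\<in>insert m M. \<xi> + k \<in> \<Lambda>" using M z by (auto simp: m_def)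
      moreover have "dim (span (insert m M)) \<ge> Suc i"
        using M(3) m_span by (simp add: dim_insert)
      ultimately show ?case by blast
    qed
    from this[of "Suc (CARD('n))"] obtain M :: "(real^'n) set" where "dim (span M) \<ge> Suc (CARD('n))" by auto
    moreover have "dim (span M) \<le> CARD('n)" using dim_subset_UNIV[of "span M"] by simp
    ultimately show False by simp
  qed
  then show ?thesis using mono D_step by (intro exI[of _ D] conjI allI ballI impI) auto
qed

text \<open>
  Clusters of two points that meet are nested: the one with the smaller index has diameter at most the
  isolation distance of the other. Hence the maximal clusters are disjoint.
\<close>
lemma shell_partition:
  fixes R :: "real \<Rightarrow> real"
  assumes R: "\<And>d. R d \<ge> d"
  shows "\<exists>\<D>. finite \<D> \<and> \<D> \<noteq> {} \<and> (\<forall>lam \<Lambda>. finite \<Lambda> \<longrightarrow> (\<forall>\<eta>\<in>\<Lambda>. in_shell lam (\<eta>::real^'n::finite)) \<longrightarrow>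
     (\<exists>P. \<Union>P = \<Lambda> \<and> disjoint P \<and> (\<forall>C\<in>P. \<exists>d\<in>\<D>. (\<forall>\<xi>\<in>C. \<forall>\<eta>\<in>C. \<eta> - \<xi> \<in> int_vecs \<inter> cball 0 d) \<and>
       (\<forall>\<xi>\<in>C. \<forall>\<zeta>\<in>\<Lambda> - C. \<zeta> - \<xi> \<in> int_vecs \<longrightarrow> norm (\<zeta> - \<xi>) > R d))))"
proof -
  obtain D where D: "mono D" "\<And>i. D i \<ge> (0::real)"
    and cl: "\<And>lam \<Lambda> \<xi>. \<xi>\<in>\<Lambda> \<Longrightarrow> (\<forall>\<eta>\<in>\<Lambda>. in_shell lam (\<eta>::real^'n)) \<Longrightarrow>
     (\<exists>i\<le>CARD('n). \<exists>C\<subseteq>\<Lambda>. \<xi> \<in> C \<and> (\<forall>\<eta>\<in>C. \<eta> - \<xi> \<in> int_vecs \<and> norm (\<eta> - \<xi>) \<le> D i) \<and>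
       (\<forall>\<eta>\<in>C. \<forall>\<zeta>\<in>\<Lambda> - C. \<zeta> - \<eta> \<in> int_vecs \<longrightarrow> norm (\<zeta> - \<eta>) > R (2 * D i)))"
    using isolated_cluster_exists[OF R, where 'n='n] by metis
  define \<D> where "\<D> = (\<lambda>i. 2 * D i) ` {..CARD('n)}"
  have "\<exists>P. \<Union>P = \<Lambda> \<and> disjoint P \<and> (\<forall>C\<in>P. \<exists>d\<in>\<D>. (\<forall>\<xi>\<in>C. \<forall>\<eta>\<in>C. \<eta> - \<xi> \<in> int_vecs \<inter> cball 0 d) \<and>
       (\<forall>\<xi>\<in>C. \<forall>\<zeta>\<in>\<Lambda> - C. \<zeta> - \<xi> \<in> int_vecs \<longrightarrow> norm (\<zeta> - \<xi>) > R d))"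
    if fin: "finite \<Lambda>" and shell: "\<forall>\<eta>\<in>\<Lambda>. in_shell lam (\<eta>::real^'n)" for lam \<Lambda>
  proof -
    define Q where "Q \<xi> i C \<longleftrightarrow> i \<le> CARD('n) \<and> C \<subseteq> \<Lambda> \<and> \<xi> \<in> C \<and>
        (\<forall>\<eta>\<in>C. \<eta> - \<xi> \<in> int_vecs \<and> norm (\<eta> - \<xi>) \<le> D i) \<and>
        (\<forall>\<eta>\<in>C. \<forall>\<zeta>\<in>\<Lambda> - C. \<zeta> - \<eta> \<in> int_vecs \<longrightarrow> norm (\<zeta> - \<eta>) > R (2 * D i))" for \<xi> i C
    have "\<exists>i C. Q \<xi> i C" if "\<xi> \<in> \<Lambda>" for \<xi>
      using cl[OF that shell] unfolding Q_def by blast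
    then obtain I C where Q: "\<And>\<xi>. \<xi> \<in> \<Lambda> \<Longrightarrow> Q \<xi> (I \<xi>) (C \<xi>)" by metis
    from Q have I: "\<And>\<xi>. \<xi>\<in>\<Lambda> \<Longrightarrow> I \<xi> \<le> CARD('n)" and C_sub: "\<And>\<xi>. \<xi>\<in>\<Lambda> \<Longrightarrow> C \<xi> \<subseteq> \<Lambda>"
      and C_self: "\<And>\<xi>. \<xi>\<in>\<Lambda> \<Longrightarrow> \<xi> \<in> C \<xi>"
      and C_bd: "\<And>\<xi> \<eta>. \<xi>\<in>\<Lambda> \<Longrightarrow> \<eta> \<in> C \<xi> \<Longrightarrow> \<eta> - \<xi> \<in> int_vecs \<and> norm (\<eta> - \<xi>) \<le> D (I \<xi>)"
      and C_iso: "\<And>\<xi> \<eta> \<zeta>. \<xi>\<in>\<Lambda> \<Longrightarrow> \<eta> \<in> C \<xi> \<Longrightarrow> \<zeta> \<in> \<Lambda> - C \<xi> \<Longrightarrow> \<zeta> - \<eta> \<in> int_vecs \<Longrightarrow>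
              norm (\<zeta> - \<eta>) > R (2 * D (I \<xi>))"
      unfolding Q_def by blast+
    have C_diff: "\<eta> - \<xi> \<in> int_vecs \<and> norm (\<eta> - \<xi>) \<le> 2 * D (I \<alpha>)"
      if "\<alpha> \<in> \<Lambda>" "\<xi> \<in> C \<alpha>" "\<eta> \<in> C \<alpha>" for \<alpha> \<xi> \<eta>
    proof -
      have eq: "\<eta> - \<xi> = (\<eta> - \<alpha>) - (\<xi> - \<alpha>)" by simp
      have "norm (\<eta> - \<xi>) \<le> norm (\<eta> - \<alpha>) + norm (\<xi> - \<alpha>)"
        by (subst eq) (rule norm_triangle_ineq4)
      moreover have "\<eta> - \<xi> \<in> int_vecs" by (subst eq) (use C_bd that int_vecs_diff in blast)
      ultimately show ?thesis using C_bd[OF that(1,2)] C_bd[OF that(1,3)] by simp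
    qed
    have nested: "C \<beta> \<subseteq> C \<alpha>" if ab: "\<alpha> \<in> \<Lambda>" "\<beta> \<in> \<Lambda>" "I \<beta> \<le> I \<alpha>" and x: "\<xi> \<in> C \<alpha>" "\<xi> \<in> C \<beta>" for \<alpha> \<beta> \<xi>
    proof
      fix \<eta> assume e: "\<eta> \<in> C \<beta>"
      have "norm (\<eta> - \<xi>) \<le> 2 * D (I \<beta>)" "\<eta> - \<xi> \<in> int_vecs" using C_diff ab x e by blast+
      moreover have "D (I \<beta>) \<le> D (I \<alpha>)" using D(1) ab(3) by (rule monoD)
      ultimately have "\<not> norm (\<eta> - \<xi>) > R (2 * D (I \<alpha>))" using R[of "2 * D (I \<alpha>)"] by linarith
      then show "\<eta> \<in> C \<alpha>" using C_iso[OF ab(1) x(1)] \<open>\<eta> - \<xi> \<in> int_vecs\<close> e C_sub[OF ab(2)] by blast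
    qed
    define P where "P = {A \<in> C ` \<Lambda>. \<forall>B\<in>C ` \<Lambda>. A \<subseteq> B \<longrightarrow> A = B}"
    have "disjoint P"
    proof (rule disjointI)
      fix A B assume A: "A \<in> P" and B: "B \<in> P" and ne: "A \<noteq> B"
      obtain \<alpha> \<beta> where ab: "\<alpha> \<in> \<Lambda>" "A = C \<alpha>" "\<beta> \<in> \<Lambda>" "B = C \<beta>" using A B by (auto simp: P_def)
      show "A \<inter> B = {}"
      proof (rule ccontr)
        assume "A \<inter> B \<noteq> {}"
        then have "A \<subseteq> B \<or> B \<subseteq> A" using nested ab by (metis Int_emptyI nle_le)
        then show False using A B ne by (auto simp: P_def)
      qed
    qed
    moreover have "\<Union>P = \<Lambda>"
    proof
      show "\<Union>P \<subseteq> \<Lambda>" using C_sub by (auto simp: P_def)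
      show "\<Lambda> \<subseteq> \<Union>P"
      proof
        fix \<xi> assume xi: "\<xi> \<in> \<Lambda>"
        have "finite (C ` \<Lambda>)" using fin by simp
        then obtain A where "A \<in> C ` \<Lambda>" "C \<xi> \<subseteq> A" "\<forall>B\<in>C ` \<Lambda>. A \<subseteq> B \<longrightarrow> A = B"
          using finite_has_maximal2[of "C ` \<Lambda>" "C \<xi>"] xi by auto
        then show "\<xi> \<in> \<Union>P" using C_self[OF xi] by (auto simp: P_def)
      qed
    qed
    moreover have "\<exists>d\<in>\<D>. (\<forall>\<xi>\<in>A. \<forall>\<eta>\<in>A. \<eta> - \<xi> \<in> int_vecs \<inter> cball 0 d) \<and>
       (\<forall>\<xi>\<in>A. \<forall>\<zeta>\<in>\<Lambda> - A. \<zeta> - \<xi> \<in> int_vecs \<longrightarrow> norm (\<zeta> - \<xi>) > R d)" if A: "A \<in> P" for A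
    proof -
      obtain \<alpha> where a: "\<alpha> \<in> \<Lambda>" "A = C \<alpha>" using A by (auto simp: P_def)
      show ?thesis
        by (rule bexI[of _ "2 * D (I \<alpha>)"]) (use C_diff C_iso I a in \<open>auto simp: \<D>_def\<close>)
    qed
    ultimately show ?thesis by blast
  qed
  then show ?thesis by (intro exI[of _ \<D>] conjI allI impI) (auto simp: \<D>_def)
qed

section \<open>Exponential sums with finitely many frequencies\<close>

text \<open>
  The exponential with frequency \<open>\<xi>\<close>.
\<close>
definition wave :: "'a::euclidean_space \<Rightarrow> 'a \<Rightarrow> complex" where
  "wave \<xi> x = cis (\<xi> \<bullet> x)"

lemma norm_wave [simp]: "cmod (wave \<xi> x) = 1"
  by (simp add: wave_def)

lemma wave_zero [simp]: "wave 0 x = 1"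
  by (simp add: wave_def)

lemma wave_add_freq: "wave (\<xi> + \<eta>) x = wave \<xi> x * wave \<eta> x"
  by (simp add: wave_def cis_mult inner_add_left)

lemma wave_add: "wave \<xi> (x + y) = wave \<xi> x * wave \<xi> y"
  by (simp add: wave_def cis_mult inner_add_right)

lemma cnj_wave: "cnj (wave \<xi> x) = wave (- \<xi>) x"
  by (simp add: wave_def cis_cnj)

lemma wave_diff_freq: "wave (\<xi> - \<eta>) x = wave \<xi> x * cnj (wave \<eta> x)"
  using wave_add_freq[of \<xi> "- \<eta>" x] by (simp add: cnj_wave)

lemma continuous_on_wave [continuous_intros]:
  "continuous_on S f \<Longrightarrow> continuous_on S (\<lambda>x. wave \<xi> (f x))"
  unfolding wave_def by (intro continuous_intros)

lemma set_integrable_continuous_bounded: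
  fixes f :: "'a::euclidean_space \<Rightarrow> 'b::euclidean_space"
  assumes "continuous_on UNIV f" "bounded S" "S \<in> sets lebesgue"
  shows "set_integrable lebesgue S f"
proof -
  obtain R where "\<And>x. x \<in> S \<Longrightarrow> norm x \<le> R" using assms(2) unfolding bounded_iff by metis
  then have "S \<subseteq> cball 0 R" by auto
  have "set_integrable lborel (cball 0 R) f"
    unfolding set_integrable_def
    by (rule borel_integrable_compact[OF compact_cball continuous_on_subset[OF assms(1) subset_UNIV]])
  then have "set_integrable lebesgue (cball 0 R) f"
    unfolding set_integrable_def
    by (simp add: integrable_completion[OF borel_measurable_integrable])
  then show ?thesis using assms(3) \<open>S \<subseteq> cball 0 R\<close> by (rule set_integrable_subset)
qed

lemma set_integral_mono_nonneg:
  fixes f :: "'a \<Rightarrow> real"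
  assumes "set_integrable M B f" "A \<subseteq> B" "A \<in> sets M" "\<And>x. f x \<ge> 0"
  shows "(LINT x:A|M. f x) \<le> (LINT x:B|M. f x)"
  unfolding set_lebesgue_integral_def
proof (rule integral_mono)
  show "integrable M (\<lambda>x. indicator A x *\<^sub>R f x)" "integrable M (\<lambda>x. indicator B x *\<^sub>R f x)"
    using set_integrable_subset[OF assms(1,3,2)] assms(1) unfolding set_integrable_def by simp_all
  show "indicator A x *\<^sub>R f x \<le> indicator B x *\<^sub>R f x" for x
    using assms(2,4) by (auto simp: indicator_def)
qed

lemma lebesgue_integral_translate:
  fixes f :: "'a::euclidean_space \<Rightarrow> 'b::{banach,second_countable_topology}"
  assumes [measurable]: "f \<in> borel_measurable borel"
  shows "(LINT x|lebesgue. f (x + h)) = (LINT x|lebesgue. f x)"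
proof -
  have "(LINT x|lebesgue. f x) = (LINT x|distr lborel borel ((+) h). f x)"
    by (simp add: integral_completion lborel_distr_plus)
  also have "\<dots> = (LINT x|lborel. f (h + x))"
    by (rule integral_distr) auto
  also have "\<dots> = (LINT x|lebesgue. f (x + h))"
    by (subst integral_completion) (auto simp: add.commute)
  finally show ?thesis by simp
qed

lemma norm_sum_squared_le:
  fixes f :: "'i \<Rightarrow> complex"
  shows "(cmod (\<Sum>i\<in>I. f i))\<^sup>2 \<le> real (card I) * (\<Sum>i\<in>I. (cmod (f i))\<^sup>2)"
proof -
  have "(cmod (\<Sum>i\<in>I. f i))\<^sup>2 \<le> (\<Sum>i\<in>I. cmod (f i))\<^sup>2"
    by (intro power_mono norm_sum) auto
  also have "\<dots> \<le> (\<Sum>i\<in>I. (cmod (f i))\<^sup>2) * card I"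
    by (rule sum_squared_le_sum_of_squares)
  finally show ?thesis by (simp add: mult.commute)
qed

lemma norm_add_squared_le: "(cmod (a + b))\<^sup>2 \<le> 2 * (cmod a)\<^sup>2 + 2 * (cmod b)\<^sup>2"
proof -
  have "(cmod (a + b))\<^sup>2 \<le> (cmod a + cmod b)\<^sup>2"
    by (intro power_mono norm_triangle_ineq) auto
  also have "\<dots> \<le> 2 * (cmod a)\<^sup>2 + 2 * (cmod b)\<^sup>2"
    using sum_squares_bound[of "cmod a" "cmod b"] by (simp add: power2_sum)
  finally show ?thesis .
qed

lemma norm_diff_squared_le: "(cmod (a - b))\<^sup>2 \<le> 2 * (cmod a)\<^sup>2 + 2 * (cmod b)\<^sup>2"
  using norm_add_squared_le[of a "- b"] by simp

text \<open>
  The vectors \<open>h\<close> that are orthogonal to one of the differences \<open>k - k0\<close> form a null set. For the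
  others, if they are short, the phase differences are nonzero and less than a full turn.
\<close>
lemma separating_shift_exists:
  fixes K :: "'a::euclidean_space set"
  assumes "finite K" "k0 \<notin> K" "\<epsilon> > 0"
  shows "\<exists>h. norm h < \<epsilon> \<and> (\<forall>k\<in>K. wave k h \<noteq> wave k0 h)"
proof -
  obtain B where B: "B > 0" "\<And>k. k \<in> K \<Longrightarrow> norm (k - k0) \<le> B"
  proof -
    have "bounded ((\<lambda>k. k - k0) ` K)" using assms(1) by (simp add: finite_imp_bounded)
    then show thesis using that unfolding bounded_pos by auto
  qed
  define \<delta> where "\<delta> = min \<epsilon> (1 / B)"
  have \<delta>: "\<delta> > 0" using B assms by (simp add: \<delta>_def)
  define N where "N = (\<Union>k\<in>K. {h. (k - k0) \<bullet> h = 0})"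
  have "negligible N"
    unfolding N_def
    by (rule negligible_Union) (use assms in \<open>auto intro!: negligible_hyperplane\<close>)
  then have "\<not> ball 0 \<delta> \<subseteq> N"
    using \<delta> open_not_negligible[of "ball (0::'a) \<delta>"] negligible_subset by auto
  then obtain h where "h \<in> ball 0 \<delta>" "h \<notin> N" by blast
  then have h: "norm h < \<delta>" "h \<notin> N" by simp_all
  have "wave k h \<noteq> wave k0 h" if k: "k \<in> K" for k
  proof
    assume "wave k h = wave k0 h"
    then have "wave (k - k0) h = 1"
      by (simp add: wave_diff_freq complex_norm_square[symmetric])
    then obtain n where n: "(k - k0) \<bullet> h = 2 * pi * of_int n"
      unfolding wave_def cis_conv_exp exp_eq_1 by (auto simp: mult_ac)
    have "\<bar>(k - k0) \<bullet> h\<bar> \<le> norm (k - k0) * norm h" by (rule Cauchy_Schwarz_ineq2)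
    also have "\<dots> \<le> B * (1 / B)"
      using B k h(1) by (intro mult_mono) (auto simp: \<delta>_def)
    also have "\<dots> = 1" using B by simp
    finally have "\<bar>2 * pi * of_int n\<bar> \<le> 1" using n by simp
    moreover have "n \<noteq> 0" using n h(2) k by (auto simp: N_def)
    then have "\<bar>2 * pi * of_int n\<bar> \<ge> 2 * pi * 1"
      unfolding abs_mult by (intro mult_mono) auto
    ultimately show False using pi_gt3 by linarith
  qed
  then show ?thesis using h by (auto simp: \<delta>_def)
qed

text \<open>
  Induction on the set of frequencies. The difference \<open>v (x + h) - wave k0 h * v x\<close> has no component
  of frequency \<open>k0\<close> and multiplies the other coefficients by nonzero factors. It is bounded on a ball
  of half the radius by \<open>v\<close> on the full ball, so the other coefficients are bounded by the induction
  hypothesis, and the coefficient of \<open>k0\<close> follows by subtraction.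
\<close>
lemma exponential_sum_lower_bound:
  fixes K :: "'a::euclidean_space set"
  assumes "finite K" "r > 0"
  shows "\<exists>\<kappa>>0. \<forall>c. \<kappa> * (\<Sum>k\<in>K. (cmod (c k))\<^sup>2) \<le>
           (LINT x:ball x0 r|lebesgue. (cmod (\<Sum>k\<in>K. c k * wave k x))\<^sup>2)"
  using assms
proof (induction K arbitrary: r)
  case empty
  then show ?case by (intro exI[of _ 1]) (auto simp: set_lebesgue_integral_def)
next
  case (insert k0 K)
  obtain h where h: "norm h < r / 2" and sep: "\<And>k. k \<in> K \<Longrightarrow> wave k h \<noteq> wave k0 h"
    using separating_shift_exists[OF insert.hyps, of "r / 2"] insert.prems by auto
  obtain \<kappa> where \<kappa>: "\<kappa> > 0"
    and IH: "\<And>c. \<kappa> * (\<Sum>k\<in>K. (cmod (c k))\<^sup>2) \<le>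
           (LINT x:ball x0 (r/2)|lebesgue. (cmod (\<Sum>k\<in>K. c k * wave k x))\<^sup>2)"
    using insert.IH[of "r / 2"] insert.prems by auto
  define \<delta> where "\<delta> = Min (insert 1 ((\<lambda>k. (cmod (wave k h - wave k0 h))\<^sup>2) ` K))"
  have \<delta>: "\<delta> > 0" "\<And>k. k \<in> K \<Longrightarrow> \<delta> \<le> (cmod (wave k h - wave k0 h))\<^sup>2"
    using insert.hyps sep by (auto simp: \<delta>_def)
  define A where "A = 4 / (\<kappa> * \<delta>)"
  have A: "A > 0" using \<kappa> \<delta> by (simp add: A_def)
  define V where "V = measure lebesgue (ball x0 r)"
  have V: "V > 0" using insert.prems by (simp add: V_def content_ball_pos)
  define C where "C = A + 2 / V + 2 * real (card K) * A"
  have C: "C > 0" using A V by (simp add: C_def add_pos_nonneg)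
  have "(\<Sum>k\<in>insert k0 K. (cmod (c k))\<^sup>2) \<le>
        C * (LINT x:ball x0 r|lebesgue. (cmod (\<Sum>k\<in>insert k0 K. c k * wave k x))\<^sup>2)" for c
  proof -
    define v where "v x = (\<Sum>k\<in>insert k0 K. c k * wave k x)" for x
    define S where "S = (\<Sum>k\<in>K. (cmod (c k))\<^sup>2)"
    define J where "J = (LINT x:ball x0 r|lebesgue. (cmod (v x))\<^sup>2)"
    have cv: "continuous_on UNIV v" unfolding v_def by (intro continuous_intros)
    have int: "set_integrable lebesgue (ball y s) (\<lambda>x. (cmod (f x))\<^sup>2)"
      if "continuous_on UNIV f" for f :: "'a \<Rightarrow> complex" and y s
      by (rule set_integrable_continuous_bounded) (intro continuous_intros that, auto)
    have cvh: "continuous_on UNIV (\<lambda>x. v (x + h))"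
      unfolding v_def by (intro continuous_intros)
    have v_K: "v x = c k0 * wave k0 x + (\<Sum>k\<in>K. c k * wave k x)" for x
      using insert.hyps by (simp add: v_def)
    have w: "v (x + h) - wave k0 h * v x = (\<Sum>k\<in>K. (c k * (wave k h - wave k0 h)) * wave k x)" for x
      unfolding v_K wave_add
      by (simp add: algebra_simps sum_distrib_left sum_subtractf)
    have "(\<kappa> * \<delta>) * S = \<kappa> * (\<Sum>k\<in>K. (cmod (c k))\<^sup>2 * \<delta>)"
      by (simp add: S_def sum_distrib_left mult_ac)
    also have "\<dots> \<le> \<kappa> * (\<Sum>k\<in>K. (cmod (c k * (wave k h - wave k0 h)))\<^sup>2)"
    proof (intro mult_left_mono sum_mono)
      fix k assume "k \<in> K"
      then show "(cmod (c k))\<^sup>2 * \<delta> \<le> (cmod (c k * (wave k h - wave k0 h)))\<^sup>2"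
        unfolding norm_mult power_mult_distrib by (intro mult_left_mono \<delta>(2)) auto
    qed (use \<kappa> in simp)
    also have "\<dots> \<le> (LINT x:ball x0 (r/2)|lebesgue. (cmod (v (x + h) - wave k0 h * v x))\<^sup>2)"
      unfolding w by (rule IH)
    also have "\<dots> \<le> (LINT x:ball x0 (r/2)|lebesgue. 2 * (cmod (v (x + h)))\<^sup>2 + 2 * (cmod (v x))\<^sup>2)"
    proof (rule set_integral_mono)
      show "set_integrable lebesgue (ball x0 (r/2)) (\<lambda>x. (cmod (v (x + h) - wave k0 h * v x))\<^sup>2)"
        by (intro int continuous_intros cvh cv)
      show "set_integrable lebesgue (ball x0 (r/2)) (\<lambda>x. 2 * (cmod (v (x + h)))\<^sup>2 + 2 * (cmod (v x))\<^sup>2)"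
        by (intro set_integral_add set_integrable_mult_right int cvh cv)
      show "(cmod (v (x + h) - wave k0 h * v x))\<^sup>2 \<le> 2 * (cmod (v (x + h)))\<^sup>2 + 2 * (cmod (v x))\<^sup>2" for x
        using norm_diff_squared_le[of "v (x + h)" "wave k0 h * v x"] by (simp add: norm_mult)
    qed
    also have "\<dots> = 2 * (LINT x:ball x0 (r/2)|lebesgue. (cmod (v (x + h)))\<^sup>2)
                   + 2 * (LINT x:ball x0 (r/2)|lebesgue. (cmod (v x))\<^sup>2)"
      by (subst set_integral_add) (auto intro!: int cv cvh set_integrable_mult_right)
    also have "(LINT x:ball x0 (r/2)|lebesgue. (cmod (v (x + h)))\<^sup>2)
             = (LINT x:ball (x0 + h) (r/2)|lebesgue. (cmod (v x))\<^sup>2)"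
    proof -
      have "v \<in> borel_measurable borel" using cv by (rule borel_measurable_continuous_onI)
      then have "(\<lambda>x. indicator (ball (x0 + h) (r/2)) x *\<^sub>R (cmod (v x))\<^sup>2) \<in> borel_measurable borel"
        by (intro borel_measurable_scaleR borel_measurable_indicator borel_measurable_power
             borel_measurable_norm) auto
      from lebesgue_integral_translate[OF this, of h] show ?thesis
        unfolding set_lebesgue_integral_def by (simp add: indicator_def dist_norm)
    qed
    also have "\<dots> \<le> J"
      unfolding J_def
    proof (rule set_integral_mono_nonneg)
      show "set_integrable lebesgue (ball x0 r) (\<lambda>x. (cmod (v x))\<^sup>2)" by (rule int[OF cv])
      show "ball (x0 + h) (r/2) \<subseteq> ball x0 r"
        using h by (simp add: ball_subset_ball_iff dist_norm)
    qed auto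
    also have "(LINT x:ball x0 (r/2)|lebesgue. (cmod (v x))\<^sup>2) \<le> J"
      unfolding J_def
    proof (rule set_integral_mono_nonneg)
      show "set_integrable lebesgue (ball x0 r) (\<lambda>x. (cmod (v x))\<^sup>2)" by (rule int[OF cv])
      show "ball x0 (r/2) \<subseteq> ball x0 r"
        using insert.prems by (simp add: ball_subset_ball_iff)
    qed auto
    finally have "(\<kappa> * \<delta>) * S \<le> 4 * J" by simp
    then have S: "S \<le> A * J" using \<kappa> \<delta> by (simp add: A_def field_simps)
    have "V * (cmod (c k0))\<^sup>2 = (LINT x:ball x0 r|lebesgue. (cmod (c k0))\<^sup>2)"
      by (simp add: V_def set_lebesgue_integral_def)
    also have "\<dots> \<le> (LINT x:ball x0 r|lebesgue. 2 * (cmod (v x))\<^sup>2 + 2 * real (card K) * S)"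
    proof (rule set_integral_mono)
      show "set_integrable lebesgue (ball x0 r) (\<lambda>x. (cmod (c k0))\<^sup>2)"
        by (intro set_integrable_continuous_bounded) (auto intro!: continuous_intros)
      show "set_integrable lebesgue (ball x0 r) (\<lambda>x. 2 * (cmod (v x))\<^sup>2 + 2 * real (card K) * S)"
        by (intro set_integrable_continuous_bounded) (auto intro!: continuous_intros cv)
      fix x assume "x \<in> ball x0 r"
      have "(cmod (c k0))\<^sup>2 = (cmod (v x - (\<Sum>k\<in>K. c k * wave k x)))\<^sup>2"
        by (simp add: v_K norm_mult)
      also have "\<dots> \<le> 2 * (cmod (v x))\<^sup>2 + 2 * (cmod (\<Sum>k\<in>K. c k * wave k x))\<^sup>2"
        by (rule norm_diff_squared_le)
      also have "(cmod (\<Sum>k\<in>K. c k * wave k x))\<^sup>2 \<le> real (card K) * S"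
        using norm_sum_squared_le[of "\<lambda>k. c k * wave k x" K] by (simp add: S_def norm_mult)
      finally show "(cmod (c k0))\<^sup>2 \<le> 2 * (cmod (v x))\<^sup>2 + 2 * real (card K) * S" by simp
    qed
    also have "\<dots> = 2 * J + V * (2 * real (card K) * S)"
    proof (subst set_integral_add)
      show "set_integrable lebesgue (ball x0 r) (\<lambda>x. 2 * (cmod (v x))\<^sup>2)"
        by (intro set_integrable_mult_right int cv)
      show "set_integrable lebesgue (ball x0 r) (\<lambda>x. 2 * real (card K) * S)"
        by (intro set_integrable_continuous_bounded) auto
      have "(LINT x:ball x0 r|lebesgue. 2 * real (card K) * S) = V * (2 * real (card K) * S)"
        by (simp add: V_def set_lebesgue_integral_def)
      then show "(LINT x:ball x0 r|lebesgue. 2 * (cmod (v x))\<^sup>2) + (LINT x:ball x0 r|lebesgue. 2 * real (card K) * S)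
          = 2 * J + V * (2 * real (card K) * S)" by (simp add: J_def)
    qed
    finally have "(cmod (c k0))\<^sup>2 \<le> 2 / V * J + 2 * real (card K) * S"
      using V by (simp add: field_simps)
    also have "\<dots> \<le> 2 / V * J + 2 * real (card K) * (A * J)"
      using S by (intro add_left_mono mult_left_mono) auto
    finally have "(cmod (c k0))\<^sup>2 \<le> 2 / V * J + 2 * real (card K) * A * J" by simp
    moreover have "(\<Sum>k\<in>insert k0 K. (cmod (c k))\<^sup>2) = (cmod (c k0))\<^sup>2 + S"
      using insert.hyps by (simp add: S_def)
    ultimately show ?thesis using S unfolding C_def J_def[symmetric] v_def[symmetric]
      by (simp add: algebra_simps)
  qed
  then show ?case
    using C by (intro exI[of _ "1 / C"]) (auto simp: field_simps)
qed

section \<open>Block diagonally dominant quadratic forms\<close>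

text \<open>
  The diagonal blocks dominate the rest: the sum over pairs in different blocks is at most
  \<open>\<Sum> \<bar>c \<xi>\<bar> \<bar>c \<eta>\<bar> \<bar>a (\<xi> - \<eta>)\<bar>\<close>, and \<open>\<bar>c \<xi>\<bar> \<bar>c \<eta>\<bar> \<le> (\<bar>c \<xi>\<bar>\<^sup>2 + \<bar>c \<eta>\<bar>\<^sup>2) / 2\<close> together with the symmetry
  of \<open>\<bar>a\<bar>\<close> bounds it by the row sums. The bound \<open>k\<close> may differ from block to block, which allows
  clusters of different scales.
\<close>
lemma quadratic_form_diagonally_dominant:
  fixes a :: "'a::ab_group_add \<Rightarrow> complex" and c :: "'a \<Rightarrow> complex"
  assumes fin: "finite \<Lambda>" and P: "\<Union>P = \<Lambda>" "disjoint P"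
    and sym: "\<And>z. cmod (a (- z)) = cmod (a z)"
    and diag: "\<And>C. C \<in> P \<Longrightarrow>
      2 * k C * (\<Sum>\<xi>\<in>C. (cmod (c \<xi>))\<^sup>2) \<le> Re (\<Sum>\<xi>\<in>C. \<Sum>\<eta>\<in>C. c \<xi> * cnj (c \<eta>) * a (\<xi> - \<eta>))"
    and off: "\<And>C \<xi>. C \<in> P \<Longrightarrow> \<xi> \<in> C \<Longrightarrow> (\<Sum>\<eta>\<in>\<Lambda> - C. cmod (a (\<xi> - \<eta>))) \<le> k C"
    and \<kappa>: "\<And>C. C \<in> P \<Longrightarrow> \<kappa> \<le> k C"
  shows "\<kappa> * (\<Sum>\<xi>\<in>\<Lambda>. (cmod (c \<xi>))\<^sup>2) \<le> Re (\<Sum>\<xi>\<in>\<Lambda>. \<Sum>\<eta>\<in>\<Lambda>. c \<xi> * cnj (c \<eta>) * a (\<xi> - \<eta>))"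
proof -
  define cl where "cl \<xi> = (THE C. C \<in> P \<and> \<xi> \<in> C)" for \<xi>
  have cl: "cl \<xi> = C" if "C \<in> P" "\<xi> \<in> C" for C \<xi>
    unfolding cl_def
    by (rule the_equality) (use that P(2) in \<open>auto simp: disjoint_def\<close>)
  have finC: "finite C" "C \<subseteq> \<Lambda>" if "C \<in> P" for C
  proof -
    show "C \<subseteq> \<Lambda>" using that P(1) by auto
    then show "finite C" using fin finite_subset by auto
  qed
  have split: "(\<Sum>\<xi>\<in>\<Lambda>. g \<xi>) = (\<Sum>C\<in>P. \<Sum>\<xi>\<in>C. g \<xi>)" for g :: "'a \<Rightarrow> 'b::comm_monoid_add"
  proof -
    have "sum g (\<Union>P) = (sum \<circ> sum) g P"
      by (rule sum.Union_disjoint) (use finC P(2) in \<open>auto simp: disjoint_def\<close>)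
    then show ?thesis using P(1) by simp
  qed
  have cl_mem: "cl \<xi> \<in> P" "\<xi> \<in> cl \<xi>" if xi: "\<xi> \<in> \<Lambda>" for \<xi>
  proof -
    obtain C where "C \<in> P" "\<xi> \<in> C" using xi P(1) by auto
    then show "cl \<xi> \<in> P" "\<xi> \<in> cl \<xi>" using cl by auto
  qed
  have cl_sym: "\<eta> \<notin> cl \<xi> \<longleftrightarrow> \<xi> \<notin> cl \<eta>" if "\<xi> \<in> \<Lambda>" "\<eta> \<in> \<Lambda>" for \<xi> \<eta>
    using cl cl_mem that by metis
  define q where "q \<xi> \<eta> = c \<xi> * cnj (c \<eta>) * a (\<xi> - \<eta>)" for \<xi> \<eta>
  define n2 where "n2 \<xi> = (cmod (c \<xi>))\<^sup>2" for \<xi>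
  \<comment> \<open>The matrix of the moduli with the diagonal blocks removed.\<close>
  define F where "F \<xi> \<eta> = (if \<eta> \<in> cl \<xi> then 0 else cmod (a (\<xi> - \<eta>)))" for \<xi> \<eta>
  have F_sum: "(\<Sum>\<eta>\<in>\<Lambda>. F \<xi> \<eta>) = (\<Sum>\<eta>\<in>\<Lambda> - cl \<xi>. cmod (a (\<xi> - \<eta>)))" for \<xi>
    using fin by (intro sum.mono_neutral_cong_right) (auto simp: F_def)
  have F_sym: "F \<xi> \<eta> = F \<eta> \<xi>" if "\<xi> \<in> \<Lambda>" "\<eta> \<in> \<Lambda>" for \<xi> \<eta>
    using cl_sym[OF that] sym[of "\<xi> - \<eta>"] by (simp add: F_def)
  have "- (\<Sum>\<xi>\<in>\<Lambda>. k (cl \<xi>) * n2 \<xi>) \<le> Re (\<Sum>\<xi>\<in>\<Lambda>. \<Sum>\<eta>\<in>\<Lambda> - cl \<xi>. q \<xi> \<eta>)"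
  proof -
    have "cmod (\<Sum>\<xi>\<in>\<Lambda>. \<Sum>\<eta>\<in>\<Lambda> - cl \<xi>. q \<xi> \<eta>) \<le> (\<Sum>\<xi>\<in>\<Lambda>. \<Sum>\<eta>\<in>\<Lambda> - cl \<xi>. cmod (q \<xi> \<eta>))"
      by (intro order_trans[OF norm_sum] sum_mono norm_sum)
    also have "\<dots> = (\<Sum>\<xi>\<in>\<Lambda>. \<Sum>\<eta>\<in>\<Lambda>. cmod (c \<xi>) * cmod (c \<eta>) * F \<xi> \<eta>)"
      using fin
      by (intro sum.cong refl sum.mono_neutral_cong_left) (auto simp: F_def q_def norm_mult)
    also have "\<dots> \<le> (\<Sum>\<xi>\<in>\<Lambda>. \<Sum>\<eta>\<in>\<Lambda>. (n2 \<xi> + n2 \<eta>) / 2 * F \<xi> \<eta>)"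
    proof (intro sum_mono mult_right_mono)
      show "cmod (c \<xi>) * cmod (c \<eta>) \<le> (n2 \<xi> + n2 \<eta>) / 2" for \<xi> \<eta>
        using sum_squares_bound[of "cmod (c \<xi>)" "cmod (c \<eta>)"] by (simp add: n2_def)
    qed (simp add: F_def)
    also have "\<dots> = ((\<Sum>\<xi>\<in>\<Lambda>. \<Sum>\<eta>\<in>\<Lambda>. n2 \<xi> * F \<xi> \<eta>) + (\<Sum>\<xi>\<in>\<Lambda>. \<Sum>\<eta>\<in>\<Lambda>. n2 \<eta> * F \<xi> \<eta>)) / 2"
      by (simp add: sum_divide_distrib sum.distrib[symmetric] distrib_right add_divide_distrib)
    also have "(\<Sum>\<xi>\<in>\<Lambda>. \<Sum>\<eta>\<in>\<Lambda>. n2 \<eta> * F \<xi> \<eta>) = (\<Sum>\<xi>\<in>\<Lambda>. \<Sum>\<eta>\<in>\<Lambda>. n2 \<xi> * F \<xi> \<eta>)"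
      by (subst sum.swap) (intro sum.cong refl, simp add: F_sym)
    also have "((\<Sum>\<xi>\<in>\<Lambda>. \<Sum>\<eta>\<in>\<Lambda>. n2 \<xi> * F \<xi> \<eta>) + (\<Sum>\<xi>\<in>\<Lambda>. \<Sum>\<eta>\<in>\<Lambda>. n2 \<xi> * F \<xi> \<eta>)) / 2
        = (\<Sum>\<xi>\<in>\<Lambda>. n2 \<xi> * (\<Sum>\<eta>\<in>\<Lambda> - cl \<xi>. cmod (a (\<xi> - \<eta>))))"
      by (simp add: sum_distrib_left[symmetric] F_sum)
    also have "\<dots> \<le> (\<Sum>\<xi>\<in>\<Lambda>. n2 \<xi> * k (cl \<xi>))"
      using off cl_mem by (intro sum_mono mult_left_mono) (auto simp: n2_def)
    finally show ?thesis
      using abs_Re_le_cmod[of "\<Sum>\<xi>\<in>\<Lambda>. \<Sum>\<eta>\<in>\<Lambda> - cl \<xi>. q \<xi> \<eta>"] by (simp add: mult.commute)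
  qed
  moreover have "2 * (\<Sum>\<xi>\<in>\<Lambda>. k (cl \<xi>) * n2 \<xi>) \<le> Re (\<Sum>\<xi>\<in>\<Lambda>. \<Sum>\<eta>\<in>cl \<xi>. q \<xi> \<eta>)"
  proof -
    have "2 * (\<Sum>\<xi>\<in>\<Lambda>. k (cl \<xi>) * n2 \<xi>) = (\<Sum>C\<in>P. 2 * k C * (\<Sum>\<xi>\<in>C. n2 \<xi>))"
      unfolding split by (simp add: sum_distrib_left cl mult.assoc cong: sum.cong)
    also have "\<dots> \<le> (\<Sum>C\<in>P. Re (\<Sum>\<xi>\<in>C. \<Sum>\<eta>\<in>C. q \<xi> \<eta>))"
      unfolding n2_def q_def by (intro sum_mono diag)
    also have "\<dots> = Re (\<Sum>\<xi>\<in>\<Lambda>. \<Sum>\<eta>\<in>cl \<xi>. q \<xi> \<eta>)"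
      unfolding split Re_sum by (intro sum.cong refl) (simp add: cl)
    finally show ?thesis .
  qed
  moreover have "(\<Sum>\<xi>\<in>\<Lambda>. \<Sum>\<eta>\<in>\<Lambda>. q \<xi> \<eta>) = (\<Sum>\<xi>\<in>\<Lambda>. \<Sum>\<eta>\<in>\<Lambda> - cl \<xi>. q \<xi> \<eta>) + (\<Sum>\<xi>\<in>\<Lambda>. \<Sum>\<eta>\<in>cl \<xi>. q \<xi> \<eta>)"
    unfolding sum.distrib[symmetric] using fin cl_mem finC
    by (intro sum.cong refl sum.subset_diff) auto
  moreover have "\<kappa> * (\<Sum>\<xi>\<in>\<Lambda>. n2 \<xi>) \<le> (\<Sum>\<xi>\<in>\<Lambda>. k (cl \<xi>) * n2 \<xi>)"
    unfolding sum_distrib_left using \<kappa> cl_mem by (intro sum_mono mult_right_mono) (auto simp: n2_def)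
  ultimately show ?thesis unfolding q_def n2_def by simp
qed

section \<open>Smooth functions of one variable and a bump function\<close>

text \<open>
  Differentiability of functions of one variable, in a form that is closed under products by a simple
  induction; test functions are obtained from it as products over the coordinates.
\<close>
primrec smooth_order :: "nat \<Rightarrow> (real \<Rightarrow> 'a::real_normed_field) \<Rightarrow> bool" where
  "smooth_order 0 f \<longleftrightarrow> continuous_on UNIV f"
| "smooth_order (Suc k) f \<longleftrightarrow>
     (\<exists>f'. (\<forall>t. (f has_vector_derivative f' t) (at t)) \<and> smooth_order k f')"

definition smooth :: "(real \<Rightarrow> 'a::real_normed_field) \<Rightarrow> bool" where
  "smooth f \<longleftrightarrow> (\<forall>k. smooth_order k f)"

lemma smooth_order_SucI:
  "(\<And>t. (f has_vector_derivative f' t) (at t)) \<Longrightarrow> smooth_order k f' \<Longrightarrow> smooth_order (Suc k) f"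
  by auto

lemma smooth_order_Suc_imp: "smooth_order (Suc k) f \<Longrightarrow> smooth_order k f"
proof (induction k arbitrary: f)
  case 0
  then obtain f' where "\<forall>t. (f has_vector_derivative f' t) (at t)" by auto
  then show ?case
    by (auto simp: continuous_on_eq_continuous_at intro: has_vector_derivative_continuous)
next
  case (Suc k)
  from Suc.prems obtain f' where "\<forall>t. (f has_vector_derivative f' t) (at t)" "smooth_order (Suc k) f'"
    unfolding smooth_order.simps(2)[of "Suc k"] by blast
  then show ?case using Suc.IH by auto
qed

lemma smooth_order_mult: "smooth_order k f \<Longrightarrow> smooth_order k g \<Longrightarrow> smooth_order k (\<lambda>t. f t * g t)"
  and smooth_order_add: "smooth_order k f \<Longrightarrow> smooth_order k g \<Longrightarrow> smooth_order k (\<lambda>t. f t + g t)"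
proof -
  show add: "smooth_order k f \<Longrightarrow> smooth_order k g \<Longrightarrow> smooth_order k (\<lambda>t. f t + g t)" for k and f g :: "real \<Rightarrow> 'a"
  proof (induction k arbitrary: f g)
    case (Suc k)
    then obtain f' g' where "\<forall>t. (f has_vector_derivative f' t) (at t)" "smooth_order k f'"
      "\<forall>t. (g has_vector_derivative g' t) (at t)" "smooth_order k g'" by auto
    then show ?case using Suc.IH
      by (auto intro!: exI[of _ "\<lambda>t. f' t + g' t"] has_vector_derivative_add)
  qed (auto intro: continuous_intros)
  show "smooth_order k f \<Longrightarrow> smooth_order k g \<Longrightarrow> smooth_order k (\<lambda>t. f t * g t)"
  proof (induction k arbitrary: f g)
    case (Suc k)
    then obtain f' g' where "\<forall>t. (f has_vector_derivative f' t) (at t)" "smooth_order k f'"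
      "\<forall>t. (g has_vector_derivative g' t) (at t)" "smooth_order k g'" by auto
    moreover have "smooth_order k f" "smooth_order k g" using Suc.prems smooth_order_Suc_imp by auto
    ultimately show ?case using Suc.IH
      by (auto intro!: exI[of _ "\<lambda>t. f t * g' t + f' t * g t"] has_vector_derivative_mult add)
  qed (auto intro: continuous_intros)
qed

lemma smooth_mult: "smooth f \<Longrightarrow> smooth g \<Longrightarrow> smooth (\<lambda>t. f t * g t)"
  by (simp add: smooth_def smooth_order_mult)

lemma smooth_const: "smooth (\<lambda>_. c)"
  unfolding smooth_def
proof
  fix k show "smooth_order k (\<lambda>_. c)"
    by (induction k arbitrary: c) (auto intro!: exI[of _ "\<lambda>_. 0"] derivative_intros)
qed

lemma smooth_deriv:
  assumes "smooth f" "\<And>t. (f has_vector_derivative f' t) (at t)"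
  shows "smooth f'"
  unfolding smooth_def
proof
  fix k
  obtain g where "\<forall>t. (f has_vector_derivative g t) (at t)" "smooth_order k g"
    using assms(1) unfolding smooth_def by (metis smooth_order.simps(2))
  moreover have "g = f'"
    using assms(2) calculation(1) vector_derivative_unique_at by (metis ext)
  ultimately show "smooth_order k f'" by simp
qed

lemma smooth_has_deriv:
  assumes "smooth f" shows "\<exists>f'. smooth f' \<and> (\<forall>t. (f has_vector_derivative f' t) (at t))"
proof -
  obtain f' where "\<forall>t. (f has_vector_derivative f' t) (at t)"
    using assms unfolding smooth_def by (metis smooth_order.simps(2))
  then show ?thesis using smooth_deriv[OF assms] by blast
qed

lemma smooth_continuous: "smooth f \<Longrightarrow> continuous_on UNIV f"
  unfolding smooth_def by (metis smooth_order.simps(1))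

lemma smooth_affine_compose:
  fixes f :: "real \<Rightarrow> 'a::real_normed_field"
  assumes "smooth f" shows "smooth (\<lambda>t. f (a * t + b))"
proof -
  have "smooth_order k f \<Longrightarrow> smooth_order k (\<lambda>t. f (a * t + b))" for k and f :: "real \<Rightarrow> 'a"
  proof (induction k arbitrary: f)
    case 0
    then have "continuous_on UNIV f" by simp
    then show ?case
      by (auto intro!: continuous_on_compose2[of UNIV f] continuous_intros)
  next
    case (Suc k)
    then obtain f' where f': "\<And>t. (f has_vector_derivative f' t) (at t)" "smooth_order k f'" by auto
    have "((\<lambda>t. f (a * t + b)) has_vector_derivative of_real a * f' (a * t + b)) (at t)" for t
    proof -
      have "((\<lambda>t. a * t + b) has_vector_derivative a) (at t)"
        by (auto intro!: derivative_eq_intros simp: has_real_derivative_iff_has_vector_derivative[symmetric])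
      from vector_diff_chain_at[OF this f'(1)] show ?thesis
        by (simp add: o_def scaleR_conv_of_real)
    qed
    moreover have "smooth_order k (\<lambda>t. of_real a * f' (a * t + b))"
      using smooth_order_mult[OF _ Suc.IH[OF f'(2)]] smooth_const[of "of_real a"]
      unfolding smooth_def by blast
    ultimately show ?case by (rule smooth_order_SucI)
  qed
  then show ?thesis using assms by (simp add: smooth_def)
qed

lemma smooth_of_real:
  fixes f :: "real \<Rightarrow> real"
  assumes "smooth f" shows "smooth (\<lambda>t. complex_of_real (f t))"
proof -
  have "smooth_order k f \<Longrightarrow> smooth_order k (\<lambda>t. complex_of_real (f t))" for k and f :: "real \<Rightarrow> real"
  proof (induction k arbitrary: f)
    case (Suc k)
    then obtain f' where f': "\<And>t. (f has_vector_derivative f' t) (at t)" "smooth_order k f'" by auto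
    then have "((\<lambda>t. complex_of_real (f t)) has_vector_derivative complex_of_real (f' t)) (at t)" for t
      by (intro has_vector_derivative_of_real) (simp add: has_real_derivative_iff_has_vector_derivative)
    then show ?case using Suc.IH[OF f'(2)] by (rule smooth_order_SucI)
  qed (auto intro: continuous_intros)
  then show ?thesis using assms by (simp add: smooth_def)
qed

lemma has_vector_derivative_cis: "((\<lambda>t. cis (a * t)) has_vector_derivative (\<i> * of_real a) * cis (a * t)) (at t)"
  unfolding has_vector_derivative_def
  by (auto intro!: derivative_eq_intros has_derivative_cis simp: scaleR_conv_of_real fun_eq_iff)

lemma smooth_cis: "smooth (\<lambda>t. cis (a * t))"
  unfolding smooth_def
proof
  fix k
  have "smooth_order k (\<lambda>t. c * cis (a * t))" for c
  proof (induction k arbitrary: c)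
    case (Suc k)
    have "((\<lambda>t. c * cis (a * t)) has_vector_derivative (c * (\<i> * of_real a)) * cis (a * t)) (at t)" for t
      using has_vector_derivative_mult_right[OF has_vector_derivative_cis, of c a t] by (simp add: mult.assoc)
    then show ?case using Suc.IH by (rule smooth_order_SucI)
  qed (auto intro!: continuous_intros)
  from this[of 1] show "smooth_order k (\<lambda>t. cis (a * t))" by simp
qed

text \<open>
  All derivatives of \<open>exp (- 1 / t)\<close> on the positive half-line have the form of a polynomial in
  \<open>1 / t\<close> times \<open>exp (- 1 / t)\<close>, so that this family is closed under differentiation.
\<close>
definition flat_exp :: "real poly \<Rightarrow> real \<Rightarrow> real" where
  "flat_exp p t = (if t > 0 then poly p (inverse t) * exp (- inverse t) else 0)"

lemma poly_over_exp_tendsto_0: "((\<lambda>s. poly p s * exp (- s)) \<longlongrightarrow> (0::real)) at_top"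
proof -
  have "((\<lambda>s. \<Sum>i\<le>degree p. coeff p i * (s ^ i / exp s)) \<longlongrightarrow> (\<Sum>i\<le>degree p. coeff p i * 0)) at_top"
    by (intro tendsto_sum tendsto_mult tendsto_const tendsto_power_div_exp_0)
  then show ?thesis
    by (simp add: poly_altdef exp_minus field_simps sum_divide_distrib)
qed

lemma flat_exp_tendsto_0: "((\<lambda>t. poly p (inverse t) * exp (- inverse t)) \<longlongrightarrow> (0::real)) (at_right 0)"
  using filterlim_compose[OF poly_over_exp_tendsto_0 filterlim_inverse_at_top_right] by simp

text \<open>
  At the origin the difference quotient is itself of the form \<open>flat_exp\<close>, for the polynomial
  \<open>[:0, 1:] * p\<close>, and tends to 0 because the exponential beats every polynomial.
\<close>
lemma flat_exp_derivative:
  "(flat_exp p has_vector_derivative flat_exp ([:0, 0, 1:] * (p - pderiv p)) t) (at t)"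
proof -
  consider "t > 0" | "t < 0" | "t = 0" by linarith
  then show ?thesis
  proof cases
    case 1
    have "((\<lambda>t. poly p (inverse t) * exp (- inverse t)) has_real_derivative
        flat_exp ([:0, 0, 1:] * (p - pderiv p)) t) (at t)"
      using 1 by (auto intro!: derivative_eq_intros simp: flat_exp_def algebra_simps power2_eq_square)
    then have "(flat_exp p has_real_derivative flat_exp ([:0, 0, 1:] * (p - pderiv p)) t) (at t)"
      by (rule DERIV_cong_ev[THEN iffD1, rotated 3])
        (use 1 in \<open>auto simp: flat_exp_def intro!: eventually_mono[OF eventually_nhds_in_open[of "{0<..}"]]\<close>)
    then show ?thesis by (simp add: has_real_derivative_iff_has_vector_derivative)
  next
    case 2
    have "((\<lambda>t. 0) has_real_derivative 0) (at t)" by simp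
    then have "(flat_exp p has_real_derivative 0) (at t)"
      by (rule DERIV_cong_ev[THEN iffD1, rotated 3])
        (use 2 in \<open>auto simp: flat_exp_def intro!: eventually_mono[OF eventually_nhds_in_open[of "{..<0}"]]\<close>)
    then show ?thesis using 2 by (simp add: has_real_derivative_iff_has_vector_derivative flat_exp_def)
  next
    case 3
    have "((\<lambda>h. (flat_exp p (0 + h) - flat_exp p 0) / h) \<longlongrightarrow> 0) (at 0)"
    proof (rule filterlim_split_at)
      show "((\<lambda>h. (flat_exp p (0 + h) - flat_exp p 0) / h) \<longlongrightarrow> 0) (at_left 0)"
        by (rule tendsto_eventually) (auto simp: flat_exp_def eventually_at_filter)
      show "((\<lambda>h. (flat_exp p (0 + h) - flat_exp p 0) / h) \<longlongrightarrow> 0) (at_right 0)"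
        by (rule Lim_transform_eventually[OF flat_exp_tendsto_0[of "[:0, 1:] * p"]])
          (auto simp: flat_exp_def eventually_at_filter field_simps)
    qed
    then have "(flat_exp p has_real_derivative 0) (at 0)" by (simp add: DERIV_def)
    then show ?thesis using 3 by (simp add: has_real_derivative_iff_has_vector_derivative flat_exp_def)
  qed
qed

lemma smooth_flat_exp: "smooth (flat_exp p)"
  unfolding smooth_def
proof
  fix k show "smooth_order k (flat_exp p)"
  proof (induction k arbitrary: p)
    case 0
    show ?case
      using has_vector_derivative_continuous[OF flat_exp_derivative]
      by (simp add: continuous_on_eq_continuous_at)
  next
    case (Suc k)
    show ?case using flat_exp_derivative Suc.IH by (rule smooth_order_SucI)
  qed
qed

definition bump :: "real \<Rightarrow> real" where
  "bump t = flat_exp 1 (1 + t) * flat_exp 1 (1 - t)"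

lemma smooth_bump: "smooth bump"
proof -
  have "smooth (\<lambda>t. flat_exp 1 (1 * t + 1) * flat_exp 1 ((-1) * t + 1))"
    by (intro smooth_mult smooth_affine_compose smooth_flat_exp)
  then show ?thesis by (simp add: bump_def[abs_def] algebra_simps)
qed

lemma bump_nonneg: "bump t \<ge> 0"
  by (simp add: bump_def flat_exp_def)

lemma bump_le_1: "bump t \<le> 1"
proof -
  have "0 \<le> flat_exp 1 s \<and> flat_exp 1 s \<le> 1" for s by (simp add: flat_exp_def)
  then show ?thesis unfolding bump_def by (intro mult_le_one) auto
qed

lemma bump_pos: "\<bar>t\<bar> < 1 \<Longrightarrow> bump t > 0"
  by (simp add: bump_def flat_exp_def abs_less_iff)

lemma bump_zero: "\<bar>t\<bar> \<ge> 1 \<Longrightarrow> bump t = 0"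
  by (auto simp: bump_def flat_exp_def)

lemma deriv_zero_outside:
  assumes "\<And>t. (f has_vector_derivative f' t) (at t)" "\<And>t. \<bar>t\<bar> > L \<Longrightarrow> f t = 0" "\<bar>t\<bar> > (L::real)"
  shows "f' t = 0"
proof -
  have "open {t. \<bar>t\<bar> > L}" by (intro open_Collect_less continuous_intros)
  then have "(f has_vector_derivative 0) (at t)"
    using assms(2,3)
    by (intro has_vector_derivative_transform_within_open[of "\<lambda>_. 0" 0 t "{t. \<bar>t\<bar> > L}" f]) auto
  then show ?thesis using assms(1) vector_derivative_unique_at by blast
qed

lemma bump_derivatives:
  obtains b1 b2 :: "real \<Rightarrow> real" and B where
    "smooth b1" "smooth b2" "\<And>t. (bump has_vector_derivative b1 t) (at t)"
    "\<And>t. (b1 has_vector_derivative b2 t) (at t)" "\<And>t. \<bar>t\<bar> > 1 \<Longrightarrow> b1 t = 0" "\<And>t. \<bar>t\<bar> > 1 \<Longrightarrow> b2 t = 0"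
    "\<And>t. \<bar>b1 t\<bar> \<le> B" "\<And>t. \<bar>b2 t\<bar> \<le> B" "B > 0"
proof -
  obtain b1 where b1: "smooth b1" "\<And>t. (bump has_vector_derivative b1 t) (at t)"
    using smooth_has_deriv[OF smooth_bump] by metis
  obtain b2 where b2: "smooth b2" "\<And>t. (b1 has_vector_derivative b2 t) (at t)"
    using smooth_has_deriv[OF b1(1)] by metis
  have z1: "b1 t = 0" if "\<bar>t\<bar> > 1" for t
    by (rule deriv_zero_outside[OF b1(2) _ that]) (simp add: bump_zero)
  have z2: "b2 t = 0" if "\<bar>t\<bar> > 1" for t
    by (rule deriv_zero_outside[OF b2(2) _ that]) (simp add: z1)
  have bd: "\<exists>B. \<forall>t. \<bar>g t\<bar> \<le> B" if "smooth g" "\<And>t. \<bar>t\<bar> > 1 \<Longrightarrow> g t = 0" for g :: "real \<Rightarrow> real"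
  proof -
    have "compact (g ` {-1..1})"
      using smooth_continuous[OF that(1)] by (intro compact_continuous_image) (auto elim: continuous_on_subset)
    then obtain B where B: "\<forall>x\<in>g ` {-1..1}. norm x \<le> B" using compact_imp_bounded bounded_iff by metis
    have "\<bar>g t\<bar> \<le> max B 0" for t
    proof (cases "\<bar>t\<bar> > 1")
      case False
      then have "t \<in> {-1..1}" by auto
      then have "\<bar>g t\<bar> \<le> B" using B by auto
      then show ?thesis by simp
    qed (simp add: that)
    then show ?thesis by blast
  qed
  obtain B1 B2 where B: "\<And>t. \<bar>b1 t\<bar> \<le> B1" "\<And>t. \<bar>b2 t\<bar> \<le> B2"
    using bd[OF b1(1) z1] bd[OF b2(1) z2] by metis
  show thesis
  proof (rule that[of b1 b2 "max (max B1 B2) 1"])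
    show "\<bar>b1 t\<bar> \<le> max (max B1 B2) 1" "\<bar>b2 t\<bar> \<le> max (max B1 B2) 1" for t
      using B[of t] by linarith+
  qed (use b1 b2 z1 z2 in auto)
qed

section \<open>Products over the coordinates\<close>

definition cart_prod :: "('n::finite \<Rightarrow> real \<Rightarrow> 'a::comm_monoid_mult) \<Rightarrow> real^'n \<Rightarrow> 'a" where
  "cart_prod \<beta> x = (\<Prod>i\<in>UNIV. \<beta> i (x $ i))"

lemma cart_prod_mult: "cart_prod (\<lambda>i t. \<beta> i t * \<gamma> i t) x = cart_prod \<beta> x * cart_prod \<gamma> x"
  by (simp add: cart_prod_def prod.distrib)

lemma continuous_on_cart_prod:
  fixes \<beta> :: "'n::finite \<Rightarrow> real \<Rightarrow> 'a::real_normed_field"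
  assumes "\<And>i. continuous_on UNIV (\<beta> i)"
  shows "continuous_on S (cart_prod \<beta>)"
  unfolding cart_prod_def
  by (intro continuous_intros continuous_on_compose2[OF assms]) auto

text \<open>
  A partial derivative of a product over the coordinates changes a single factor. Hence all such
  products of smooth functions are infinitely differentiable (\<open>Ck_fun_cart_prod\<close>).
\<close>
lemma cart_prod_partial:
  fixes \<beta> :: "'n::finite \<Rightarrow> real \<Rightarrow> complex"
  assumes "\<And>i t. (\<beta> i has_vector_derivative \<beta>' i t) (at t)"
  shows "cart_prod \<beta> differentiable (at x)"
    and "partial_deriv j (cart_prod \<beta>) x = cart_prod (\<beta>(j := \<beta>' j)) x"
proof -
  have 1: "((\<lambda>x. \<beta> i (x $ i)) has_derivative (\<lambda>h. (h $ i) *\<^sub>R \<beta>' i (x $ i))) (at x)" for i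
  proof -
    have "((\<lambda>x. x $ i) has_derivative (\<lambda>h. h $ i)) (at x)"
      by (rule bounded_linear_imp_has_derivative[OF bounded_linear_vec_nth])
    from has_derivative_compose[OF this] assms[of i "x $ i"] show ?thesis
      by (simp add: has_vector_derivative_def)
  qed
  have 2: "(cart_prod \<beta> has_derivative
      (\<lambda>h. \<Sum>i\<in>UNIV. ((h $ i) *\<^sub>R \<beta>' i (x $ i)) * (\<Prod>k\<in>UNIV - {i}. \<beta> k (x $ k)))) (at x)"
    unfolding cart_prod_def[abs_def] by (rule has_derivative_prod) (rule 1)
  then show "cart_prod \<beta> differentiable (at x)" by (rule differentiableI)
  have "partial_deriv j (cart_prod \<beta>) x
      = (\<Sum>i\<in>UNIV. ((axis j 1 $ i) *\<^sub>R \<beta>' i (x $ i)) * (\<Prod>k\<in>UNIV - {i}. \<beta> k (x $ k)))"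
    unfolding partial_deriv_def frechet_derivative_at[OF 2, symmetric] ..
  also have "\<dots> = (\<Sum>i\<in>UNIV. if i = j then \<beta>' i (x $ i) * (\<Prod>k\<in>UNIV - {i}. \<beta> k (x $ k)) else 0)"
    by (intro sum.cong refl) (auto simp: axis_def)
  also have "\<dots> = \<beta>' j (x $ j) * (\<Prod>k\<in>UNIV - {j}. \<beta> k (x $ k))" by simp
  also have "\<dots> = cart_prod (\<beta>(j := \<beta>' j)) x"
    unfolding cart_prod_def by (subst prod.remove[of UNIV j]) auto
  finally show "partial_deriv j (cart_prod \<beta>) x = cart_prod (\<beta>(j := \<beta>' j)) x" .
qed

lemma Ck_fun_cart_prod:
  assumes "\<And>i. smooth (\<beta> i)" shows "Ck_fun k (cart_prod \<beta>)"
  using assms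
proof (induction k arbitrary: \<beta>)
  case 0
  then show ?case by (simp add: continuous_on_cart_prod smooth_continuous)
next
  case (Suc k)
  have "\<forall>i. \<exists>g. smooth g \<and> (\<forall>t. (\<beta> i has_vector_derivative g t) (at t))"
    using smooth_has_deriv Suc.prems by blast
  then obtain \<beta>' where b: "\<And>i. smooth (\<beta>' i)" "\<And>i t. (\<beta> i has_vector_derivative \<beta>' i t) (at t)"
    by metis
  have "partial_deriv j (cart_prod \<beta>) = cart_prod (\<beta>(j := \<beta>' j))" for j
    using cart_prod_partial(2)[of \<beta> \<beta>', OF b(2)] by blast
  moreover have "Ck_fun k (cart_prod (\<beta>(j := \<beta>' j)))" for j
    by (rule Suc.IH) (use Suc.prems b in auto)
  ultimately show ?case using cart_prod_partial(1)[of \<beta> \<beta>', OF b(2)] by simp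
qed

lemma cart_prod_zero_outside:
  assumes "\<And>i t. \<bar>t\<bar> > L \<Longrightarrow> \<beta> i t = (0::'a::{comm_semiring_1,semiring_no_zero_divisors})"
  shows "{x. cart_prod \<beta> x \<noteq> 0} \<subseteq> cbox (\<chi> i. - L) (\<chi> i. L)"
proof
  fix x assume "x \<in> {x. cart_prod \<beta> x \<noteq> 0}"
  then have "\<beta> i (x $ i) \<noteq> 0" for i
    using prod_zero[of UNIV "\<lambda>i. \<beta> i (x $ i)"] by (auto simp: cart_prod_def)
  then have "\<not> \<bar>x $ i\<bar> > L" for i using assms by blast
  then show "x \<in> cbox (\<chi> i. - L) (\<chi> i. L)" by (auto simp: mem_box_cart abs_le_iff not_less minus_le_iff)
qed

lemma test_function_cart_prod:
  assumes "\<And>i. smooth (\<beta> i)" "\<And>i t. \<bar>t\<bar> > L \<Longrightarrow> \<beta> i t = 0"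
  shows "test_function (cart_prod \<beta>)"
  unfolding test_function_def
proof
  show "\<forall>k. Ck_fun k (cart_prod \<beta>)" using Ck_fun_cart_prod[of \<beta>, OF assms(1)] by blast
  have "closure {x. cart_prod \<beta> x \<noteq> 0} \<subseteq> cbox (\<chi> i. - L) (\<chi> i. L)"
    by (intro closure_minimal cart_prod_zero_outside assms(2)) auto
  then show "compact (closure {x. cart_prod \<beta> x \<noteq> 0})"
    by (meson bounded_cbox bounded_subset closed_closure compact_eq_bounded_closed)
qed

text \<open>
  Exponentials are products over the coordinates; together with \<open>integral_cart_prod\<close> this reduces
  every explicit integral below to one variable.
\<close>
lemma wave_cart: "cis (\<xi> \<bullet> x) = cart_prod (\<lambda>i t. cis (\<xi> $ i * t)) x"
proof -
  have "cis (\<Sum>i\<in>I. \<xi> $ i * x $ i) = (\<Prod>i\<in>I. cis (\<xi> $ i * x $ i))" if "finite I" for I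
    using that by induction (auto simp: cis_mult[symmetric])
  then show ?thesis by (simp add: cart_prod_def inner_vec_def)
qed

lemma integral_cart_prod:
  fixes f :: "'n::finite \<Rightarrow> real \<Rightarrow> 'a::{real_normed_field,banach,second_countable_topology}"
  assumes int: "\<And>i. integrable lborel (f i)"
  shows "integrable lborel (cart_prod f)" "(LINT x|lborel. cart_prod f x) = (\<Prod>i\<in>UNIV. (LINT t|lborel. f i t))"
proof -
  let ?B = "Basis :: (real^'n) set"
  let ?M = "Pi\<^sub>M ?B (\<lambda>_. lborel :: real measure)"
  interpret product_sigma_finite "\<lambda>_::real^'n. lborel :: real measure" ..
  define ix where "ix b = (THE i::'n. b = axis i (1::real))" for b
  have ix: "ix (axis i 1) = i" for i unfolding ix_def by (simp add: axis_eq_axis)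
  have bij: "bij_betw (\<lambda>i. axis i 1) (UNIV::'n set) ?B"
    by (auto simp: bij_betw_def inj_on_def axis_eq_axis Basis_vec_def)
  have cp: "cart_prod f (\<Sum>b\<in>?B. y b *\<^sub>R b) = (\<Prod>b\<in>?B. f (ix b) (y b))" for y
  proof -
    have "(\<Sum>b\<in>?B. y b *\<^sub>R b) $ i = y (axis i 1)" for i
    proof -
      have "(\<Sum>b\<in>?B. y b *\<^sub>R b) $ i = (\<Sum>b\<in>?B. y b *\<^sub>R b) \<bullet> axis i 1" by (simp add: inner_axis)
      also have "\<dots> = y (axis i 1)" by (subst inner_sum_left_Basis) (auto simp: Basis_vec_def)
      finally show ?thesis .
    qed
    then have "cart_prod f (\<Sum>b\<in>?B. y b *\<^sub>R b) = (\<Prod>i\<in>UNIV. f (ix (axis i 1)) (y (axis i 1)))"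
      by (simp add: cart_prod_def ix)
    also have "\<dots> = (\<Prod>b\<in>?B. f (ix b) (y b))"
      by (rule prod.reindex_bij_betw[OF bij])
    finally show ?thesis .
  qed
  have lb: "(lborel :: (real^'n) measure) = distr ?M borel (\<lambda>y. \<Sum>b\<in>?B. y b *\<^sub>R b)"
    by (rule lborel_eq)
  have T: "(\<lambda>y. \<Sum>b\<in>?B. y b *\<^sub>R b) \<in> measurable ?M borel" by measurable
  have fm: "f i \<in> borel_measurable borel" for i
    using borel_measurable_integrable[OF int] by simp
  have m: "cart_prod f \<in> borel_measurable borel"
    unfolding cart_prod_def[abs_def]
    by (intro borel_measurable_prod measurable_compose[OF _ fm]
        borel_measurable_continuous_onI continuous_intros)
  have "integrable (distr ?M borel (\<lambda>y. \<Sum>b\<in>?B. y b *\<^sub>R b)) (cart_prod f)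
      \<longleftrightarrow> integrable ?M (\<lambda>y. \<Prod>b\<in>?B. f (ix b) (y b))"
    by (simp only: integrable_distr_eq[OF T m] cp)
  moreover have "integrable ?M (\<lambda>y. \<Prod>b\<in>?B. f (ix b) (y b))"
    by (rule product_integrable_prod) (use int in auto)
  ultimately show "integrable lborel (cart_prod f)" by (simp only: lb)
  have "(LINT x|lborel. cart_prod f x) = integral\<^sup>L ?M (\<lambda>y. \<Prod>b\<in>?B. f (ix b) (y b))"
    unfolding lb by (subst integral_distr[OF T m]) (simp only: cp)
  also have "\<dots> = (\<Prod>b\<in>?B. (LINT t|lborel. f (ix b) t))"
    by (rule product_integral_prod) (use int in auto)
  also have "\<dots> = (\<Prod>i\<in>UNIV. (LINT t|lborel. f (ix (axis i 1)) t))"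
    by (rule prod.reindex_bij_betw[OF bij, symmetric])
  finally show "(LINT x|lborel. cart_prod f x) = (\<Prod>i\<in>UNIV. (LINT t|lborel. f i t))" by (simp add: ix)
qed

section \<open>Fourier coefficients on a period box\<close>

abbreviation energy :: "('a::euclidean_space \<Rightarrow> complex) \<Rightarrow> real" where
  "energy w \<equiv> (LINT x|lebesgue. (cmod (w x))\<^sup>2)"

definition period_box :: "real \<Rightarrow> (real^'n::finite) set" where
  "period_box N = cbox (\<chi> i. - (pi * N)) (\<chi> i. pi * N)"

text \<open>
  The frequencies of functions with period \<open>2\<pi>N\<close> in every coordinate.
\<close>
definition dual_lattice :: "real \<Rightarrow> (real^'n::finite) set" where
  "dual_lattice N = {\<xi>. N *\<^sub>R \<xi> \<in> int_vecs}"

lemma dual_lattice_zero: "0 \<in> dual_lattice N"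
  by (simp add: dual_lattice_def)

lemma dual_lattice_add: "\<xi> \<in> dual_lattice N \<Longrightarrow> \<eta> \<in> dual_lattice N \<Longrightarrow> \<xi> + \<eta> \<in> dual_lattice N"
  by (simp add: dual_lattice_def scaleR_add_right int_vecs_add)

lemma dual_lattice_diff: "\<xi> \<in> dual_lattice N \<Longrightarrow> \<eta> \<in> dual_lattice N \<Longrightarrow> \<xi> - \<eta> \<in> dual_lattice N"
  by (simp add: dual_lattice_def scaleR_diff_right int_vecs_diff)

lemma mem_period_box: "x \<in> period_box N \<longleftrightarrow> (\<forall>i. \<bar>x $ i\<bar> \<le> pi * N)"
  by (auto simp: period_box_def mem_box_cart abs_le_iff minus_le_iff)

lemma outside_period_box:
  assumes "N > 0" "x \<notin> period_box N"
  obtains i where "\<bar>x $ i\<bar> > 2 * N" "\<bar>x $ i\<bar> > N"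
proof -
  obtain i where i: "\<bar>x $ i\<bar> > pi * N" using assms(2) by (auto simp: mem_period_box not_le)
  have "2 * N < pi * N" using assms(1) pi_gt3 by (intro mult_strict_right_mono) auto
  then show thesis using that[of i] i assms(1) by linarith
qed

lemma period_box_measurable [simp]: "period_box N \<in> sets lebesgue" "bounded (period_box N)"
  by (simp_all add: period_box_def)

lemma integral_cis_period:
  assumes "N > 0" "N * z \<in> \<int>"
  shows "integrable lborel (\<lambda>t. indicator {-(pi*N)..pi*N} t *\<^sub>R cis (z * t))"
    and "(LINT t|lborel. indicator {-(pi*N)..pi*N} t *\<^sub>R cis (z * t)) = (if z = 0 then 2 * pi * N else 0)"
proof -
  have "integrable lborel (\<lambda>t. indicator {-(pi*N)..pi*N} t *\<^sub>R cis (z * t)) \<and>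
        (LINT t|lborel. indicator {-(pi*N)..pi*N} t *\<^sub>R cis (z * t)) = (if z = 0 then 2 * pi * N else 0)"
  proof (cases "z = 0")
    case True
    have "(LINT t|lborel. indicator {-(pi*N)..pi*N} t *\<^sub>R (1::complex)) = 2 * pi * N"
      using assms(1) by (simp add: scaleR_conv_of_real)
    moreover have "integrable lborel (\<lambda>t. indicator {-(pi*N)..pi*N} t *\<^sub>R (1::complex))"
      by (intro borel_integrable_compact) auto
    ultimately show ?thesis using True by simp
  next
    case False
    define F where "F t = cis (z * t) / (\<i> * z)" for t
    have dF: "(F has_vector_derivative cis (z * t)) (at t within A)" for t A
      unfolding F_def has_vector_derivative_def using False
      by (auto intro!: derivative_eq_intros simp: scaleR_conv_of_real fun_eq_iff field_simps)
    have "has_bochner_integral lborel (\<lambda>t. indicator {-(pi*N)..pi*N} t *\<^sub>R cis (z * t)) (F (pi*N) - F (-(pi*N)))"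
      by (rule has_bochner_integral_FTC_Icc) (use assms dF in \<open>auto intro!: continuous_intros\<close>)
    moreover have "F (pi*N) = F (-(pi*N))"
    proof -
      obtain k where k: "N * z = of_int k" using assms(2) by (auto elim: Ints_cases)
      have "cis (z * (pi * N)) = cis (z * (-(pi * N))) * cis (2 * pi * of_int k)"
        unfolding cis_mult k[symmetric] by (simp add: algebra_simps)
      also have "cis (2 * pi * of_int k) = 1" by (rule cis_multiple_2pi) simp
      finally show ?thesis by (simp add: F_def)
    qed
    ultimately show ?thesis using False by (simp add: has_bochner_integral_iff)
  qed
  then show "integrable lborel (\<lambda>t. indicator {-(pi*N)..pi*N} t *\<^sub>R cis (z * t))"
    "(LINT t|lborel. indicator {-(pi*N)..pi*N} t *\<^sub>R cis (z * t)) = (if z = 0 then 2 * pi * N else 0)" by auto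
qed

lemma integral_wave_period_box:
  fixes \<xi> :: "real^'n::finite"
  assumes "N > 0" "\<xi> \<in> dual_lattice N"
  shows "(LINT x:period_box N|lebesgue. wave \<xi> x) = (if \<xi> = 0 then (2 * pi * N) ^ CARD('n) else 0)"
proof -
  define \<beta> where "\<beta> i t = indicator {-(pi*N)..pi*N} t *\<^sub>R cis (\<xi> $ i * t)" for i t
  have z: "N * \<xi> $ i \<in> \<int>" for i using assms(2) by (simp add: dual_lattice_def int_vecs_def)
  have eq: "indicator (period_box N) x *\<^sub>R wave \<xi> x = cart_prod \<beta> x" for x
  proof (cases "x \<in> period_box N")
    case True
    then have "\<beta> i (x $ i) = cis (\<xi> $ i * x $ i)" for i
      using True by (simp add: \<beta>_def mem_period_box abs_le_iff minus_le_iff)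
    then show ?thesis using True by (simp add: wave_def wave_cart cart_prod_def)
  next
    case False
    then obtain i where "\<beta> i (x $ i) = 0" by (auto simp: \<beta>_def mem_period_box abs_le_iff minus_le_iff indicator_def)
    then have "cart_prod \<beta> x = 0" unfolding cart_prod_def by (intro prod_zero) auto
    then show ?thesis using False by simp
  qed
  have int: "integrable lborel (\<beta> i)" for i unfolding \<beta>_def by (rule integral_cis_period[OF assms(1) z])
  have "(LINT x:period_box N|lebesgue. wave \<xi> x) = (LINT x|lborel. cart_prod \<beta> x)"
    unfolding set_lebesgue_integral_def eq
    by (rule integral_completion[OF borel_measurable_integrable[OF integral_cart_prod(1)[of \<beta>, OF int]]])
  also have "\<dots> = (\<Prod>i\<in>UNIV. (LINT t|lborel. \<beta> i t))" by (rule integral_cart_prod(2)[of \<beta>, OF int])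
  also have "\<dots> = (\<Prod>i\<in>UNIV. (if \<xi> $ i = 0 then complex_of_real (2 * pi * N) else 0))"
    unfolding \<beta>_def integral_cis_period(2)[OF assms(1) z] by (intro prod.cong refl) simp
  also have "\<dots> = (if \<xi> = 0 then (2 * pi * N) ^ CARD('n) else 0)"
  proof (cases "\<xi> = 0")
    case False
    then obtain i where "\<xi> $ i \<noteq> 0" by (auto simp: vec_eq_iff)
    then have "(\<Prod>i\<in>UNIV. (if \<xi> $ i = 0 then complex_of_real (2 * pi * N) else 0)) = 0"
      by (intro prod_zero) auto
    then show ?thesis using False by simp
  qed simp
  finally show ?thesis .
qed

lemma norm_wave_sum_squared:
  "complex_of_real ((cmod (\<Sum>\<xi>\<in>F. d \<xi> * wave \<xi> x))\<^sup>2) = (\<Sum>\<xi>\<in>F. \<Sum>\<eta>\<in>F. d \<xi> * cnj (d \<eta>) * wave (\<xi> - \<eta>) x)"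
  unfolding complex_norm_square cnj_sum sum_product
  by (intro sum.cong refl) (simp add: wave_diff_freq mult_ac)

text \<open>
  The type argument carries the dimension of \<open>period_box N\<close>.
\<close>
definition cell_volume :: "real \<Rightarrow> 'n::finite itself \<Rightarrow> real" where
  "cell_volume N _ = (2 * pi * N) ^ CARD('n)"

lemma set_integral_wave_sum_squared:
  fixes F :: "(real^'n::finite) set"
  assumes "N > 0" "finite F" "F \<subseteq> dual_lattice N"
  shows "(LINT x:period_box N|lebesgue. (cmod (\<Sum>\<xi>\<in>F. d \<xi> * wave \<xi> x))\<^sup>2)
    = cell_volume N TYPE('n) * (\<Sum>\<xi>\<in>F. (cmod (d \<xi>))\<^sup>2)"
proof -
  have int: "set_integrable lebesgue (period_box N) (\<lambda>x. c * wave \<xi> x)" for c and \<xi> :: "real^'n"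
    by (intro set_integrable_continuous_bounded continuous_intros) auto
  have int2: "integrable lebesgue (\<lambda>x. \<Sum>\<eta>\<in>F. indicator (period_box N) x *\<^sub>R (d \<xi> * cnj (d \<eta>) * wave (\<xi> - \<eta>) x))" for \<xi>
    by (intro Bochner_Integration.integrable_sum int[unfolded set_integrable_def])
  have "complex_of_real (LINT x:period_box N|lebesgue. (cmod (\<Sum>\<xi>\<in>F. d \<xi> * wave \<xi> x))\<^sup>2)
      = (LINT x:period_box N|lebesgue. complex_of_real ((cmod (\<Sum>\<xi>\<in>F. d \<xi> * wave \<xi> x))\<^sup>2))"
    by (rule set_integral_complex_of_real[symmetric])
  also have "\<dots> = (\<Sum>\<xi>\<in>F. \<Sum>\<eta>\<in>F. (LINT x:period_box N|lebesgue. d \<xi> * cnj (d \<eta>) * wave (\<xi> - \<eta>) x))"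
    unfolding norm_wave_sum_squared set_lebesgue_integral_def scaleR_sum_right
      Bochner_Integration.integral_sum[OF int2] Bochner_Integration.integral_sum[OF int[unfolded set_integrable_def]] ..
  also have "\<dots> = (\<Sum>\<xi>\<in>F. \<Sum>\<eta>\<in>F. if \<eta> = \<xi> then d \<xi> * cnj (d \<eta>) * cell_volume N TYPE('n) else 0)"
  proof (intro sum.cong refl)
    fix \<xi> \<eta> assume "\<xi> \<in> F" "\<eta> \<in> F"
    then have "\<xi> - \<eta> \<in> dual_lattice N" using assms dual_lattice_diff by blast
    from integral_wave_period_box[OF assms(1) this]
    show "(LINT x:period_box N|lebesgue. d \<xi> * cnj (d \<eta>) * wave (\<xi> - \<eta>) x)
      = (if \<eta> = \<xi> then d \<xi> * cnj (d \<eta>) * cell_volume N TYPE('n) else 0)"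
      by (simp add: cell_volume_def)
  qed
  also have "\<dots> = (\<Sum>\<xi>\<in>F. d \<xi> * cnj (d \<xi>) * cell_volume N TYPE('n))"
    using assms(2) by simp
  also have "\<dots> = complex_of_real (cell_volume N TYPE('n) * (\<Sum>\<xi>\<in>F. (cmod (d \<xi>))\<^sup>2))"
    by (simp only: complex_norm_square[symmetric] sum_distrib_left of_real_sum of_real_mult mult.commute)
  finally show ?thesis unfolding of_real_eq_iff .
qed

definition fourier_coeff :: "('a::euclidean_space \<Rightarrow> complex) \<Rightarrow> 'a \<Rightarrow> complex" where
  "fourier_coeff w \<xi> = (LINT x|lebesgue. w x * cnj (wave \<xi> x))"

text \<open>
  On a bounded set \<open>\<bar>w\<bar> \<le> 1 + \<bar>w\<bar>\<^sup>2\<close> has a finite integral.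
\<close>
lemma integrable_if_square_integrable:
  fixes w :: "'a::euclidean_space \<Rightarrow> complex"
  assumes "square_integrable lebesgue w" "bounded B" "B \<in> sets lebesgue" "\<And>x. x \<notin> B \<Longrightarrow> w x = 0"
  shows "integrable lebesgue w"
proof (rule Bochner_Integration.integrable_bound)
  have "set_integrable lebesgue B (\<lambda>_. 1::real)"
    by (intro set_integrable_continuous_bounded assms continuous_intros)
  then show "integrable lebesgue (\<lambda>x. indicator B x *\<^sub>R 1 + (cmod (w x))\<^sup>2)"
    using assms(1) unfolding square_integrable_def set_integrable_def
    by (intro Bochner_Integration.integrable_add) auto
  show "w \<in> borel_measurable lebesgue" using assms(1) by (simp add: square_integrable_def)
  have "cmod (w x) \<le> indicator B x * 1 + (cmod (w x))\<^sup>2" for x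
  proof (cases "x \<in> B")
    case True
    have "2 * cmod (w x) \<le> (cmod (w x))\<^sup>2 + 1" using sum_squares_bound[of "cmod (w x)" 1] by simp
    moreover have "cmod (w x) \<ge> 0" by simp
    ultimately have "cmod (w x) \<le> (cmod (w x))\<^sup>2 + 1" by linarith
    then show ?thesis using True by simp
  qed (simp add: assms)
  then show "AE x in lebesgue. norm (w x) \<le> norm (indicator B x *\<^sub>R 1 + (cmod (w x))\<^sup>2)"
    by (simp add: abs_of_nonneg)
qed

lemma integrable_mult_bounded_continuous:
  fixes w g :: "'a::euclidean_space \<Rightarrow> complex"
  assumes "integrable lebesgue w" "continuous_on UNIV g" "\<And>x. cmod (g x) \<le> M"
  shows "integrable lebesgue (\<lambda>x. w x * g x)"
proof (rule Bochner_Integration.integrable_bound)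
  show "integrable lebesgue (\<lambda>x. of_real M * w x)" using assms(1) by simp
  have "g \<in> borel_measurable lebesgue"
    using borel_measurable_continuous_onI[OF assms(2)] by (simp add: measurable_completion)
  then show "(\<lambda>x. w x * g x) \<in> borel_measurable lebesgue" using assms(1) by measurable
  have "norm (w x * g x) \<le> norm (of_real M * w x)" for x
    using assms(3)[of x] norm_ge_zero[of "g x"]
    by (simp add: norm_mult mult.commute mult_right_mono order_trans[OF assms(3) abs_ge_self])
  then show "AE x in lebesgue. norm (w x * g x) \<le> norm (of_real M * w x)" by simp
qed

lemma norm_diff_squared_expand:
  "(cmod (a - b))\<^sup>2 = (cmod a)\<^sup>2 - 2 * Re (a * cnj b) + (cmod b)\<^sup>2"
  unfolding cmod_power2 by (simp add: power2_eq_square algebra_simps)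

lemma pythagoras_period_box:
  fixes w :: "real^'n::finite \<Rightarrow> complex"
  assumes N: "N > 0" and F: "finite F" "F \<subseteq> dual_lattice N"
    and w: "square_integrable lebesgue w" "\<And>x. x \<notin> period_box N \<Longrightarrow> w x = 0"
  shows "set_integrable lebesgue (period_box N) (\<lambda>x. (cmod (w x - (\<Sum>\<xi>\<in>F. d \<xi> * wave \<xi> x)))\<^sup>2)"
    and "(LINT x:period_box N|lebesgue. (cmod (w x - (\<Sum>\<xi>\<in>F. d \<xi> * wave \<xi> x)))\<^sup>2)
      = energy w - 2 * Re (\<Sum>\<xi>\<in>F. cnj (d \<xi>) * fourier_coeff w \<xi>)
        + cell_volume N TYPE('n) * (\<Sum>\<xi>\<in>F. (cmod (d \<xi>))\<^sup>2)"
proof -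
  define p where "p x = (\<Sum>\<xi>\<in>F. d \<xi> * wave \<xi> x)" for x
  have cp: "continuous_on UNIV p" unfolding p_def by (intro continuous_intros)
  have wi: "integrable lebesgue w"
    by (rule integrable_if_square_integrable[OF w(1) _ _ w(2)]) auto
  have wxi: "integrable lebesgue (\<lambda>x. w x * cnj (wave \<xi> x))" for \<xi>
    by (rule integrable_mult_bounded_continuous[OF wi, of _ 1]) (auto intro!: continuous_intros)
  have wp_eq: "w x * cnj (p x) = (\<Sum>\<xi>\<in>F. cnj (d \<xi>) * (w x * cnj (wave \<xi> x)))" for x
    by (simp add: p_def sum_distrib_left mult_ac)
  have wp: "integrable lebesgue (\<lambda>x. w x * cnj (p x))"
    unfolding wp_eq by (intro Bochner_Integration.integrable_sum integrable_mult_right wxi)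
  have w2: "integrable lebesgue (\<lambda>x. (cmod (w x))\<^sup>2)" using w(1) by (simp add: square_integrable_def)
  have p2: "integrable lebesgue (\<lambda>x. indicator (period_box N) x *\<^sub>R (cmod (p x))\<^sup>2)"
    unfolding set_integrable_def[symmetric]
    by (intro set_integrable_continuous_bounded continuous_intros cp) auto
  have eq: "indicator (period_box N) x *\<^sub>R (cmod (w x - p x))\<^sup>2
      = (cmod (w x))\<^sup>2 - 2 * Re (w x * cnj (p x)) + indicator (period_box N) x *\<^sub>R (cmod (p x))\<^sup>2" for x
    using w(2)[of x] by (cases "x \<in> period_box N") (simp_all add: norm_diff_squared_expand)
  show "set_integrable lebesgue (period_box N) (\<lambda>x. (cmod (w x - (\<Sum>\<xi>\<in>F. d \<xi> * wave \<xi> x)))\<^sup>2)"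
    unfolding set_integrable_def p_def[symmetric] eq
    by (intro Bochner_Integration.integrable_add Bochner_Integration.integrable_diff integrable_mult_right
        w2 p2 integrable_Re wp)
  have "(LINT x:period_box N|lebesgue. (cmod (w x - p x))\<^sup>2)
    = energy w - 2 * (LINT x|lebesgue. Re (w x * cnj (p x)))
      + (LINT x:period_box N|lebesgue. (cmod (p x))\<^sup>2)"
    unfolding set_lebesgue_integral_def eq
    by (subst Bochner_Integration.integral_add[OF Bochner_Integration.integrable_diff[OF w2
          integrable_mult_right[OF integrable_Re[OF wp]]] p2],
        subst Bochner_Integration.integral_diff[OF w2 integrable_mult_right[OF integrable_Re[OF wp]]])
      (simp only: integral_mult_right_zero)
  also have "(LINT x|lebesgue. Re (w x * cnj (p x))) = Re (\<Sum>\<xi>\<in>F. cnj (d \<xi>) * fourier_coeff w \<xi>)"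
  proof -
    have "(LINT x|lebesgue. Re (w x * cnj (p x))) = Re (LINT x|lebesgue. w x * cnj (p x))"
      by (rule integral_Re[OF wp])
    also have "(LINT x|lebesgue. w x * cnj (p x)) = (\<Sum>\<xi>\<in>F. (LINT x|lebesgue. cnj (d \<xi>) * (w x * cnj (wave \<xi> x))))"
      unfolding wp_eq by (rule Bochner_Integration.integral_sum) (intro integrable_mult_right wxi)
    also have "\<dots> = (\<Sum>\<xi>\<in>F. cnj (d \<xi>) * fourier_coeff w \<xi>)"
      by (simp add: fourier_coeff_def)
    finally show ?thesis .
  qed
  also have "(LINT x:period_box N|lebesgue. (cmod (p x))\<^sup>2) = cell_volume N TYPE('n) * (\<Sum>\<xi>\<in>F. (cmod (d \<xi>))\<^sup>2)"
    unfolding p_def by (rule set_integral_wave_sum_squared[OF N F])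
  finally show "(LINT x:period_box N|lebesgue. (cmod (w x - (\<Sum>\<xi>\<in>F. d \<xi> * wave \<xi> x)))\<^sup>2)
      = energy w - 2 * Re (\<Sum>\<xi>\<in>F. cnj (d \<xi>) * fourier_coeff w \<xi>)
        + cell_volume N TYPE('n) * (\<Sum>\<xi>\<in>F. (cmod (d \<xi>))\<^sup>2)" unfolding p_def .
qed

text \<open>
  The Fourier coefficients give the best approximation among all combinations of the exponentials in
  \<open>F\<close>; the second claim reduces the identity of Parseval to the density of such combinations.
\<close>
lemma projection_error:
  fixes w :: "real^'n::finite \<Rightarrow> complex"
  assumes N: "N > 0" and F: "finite F" "F \<subseteq> dual_lattice N"
    and w: "square_integrable lebesgue w" "\<And>x. x \<notin> period_box N \<Longrightarrow> w x = 0"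
  shows "(LINT x:period_box N|lebesgue. (cmod (w x - (\<Sum>\<xi>\<in>F. fourier_coeff w \<xi> / cell_volume N TYPE('n) * wave \<xi> x)))\<^sup>2)
      = energy w - (\<Sum>\<xi>\<in>F. (cmod (fourier_coeff w \<xi>))\<^sup>2) / cell_volume N TYPE('n)"
    and "energy w - (\<Sum>\<xi>\<in>F. (cmod (fourier_coeff w \<xi>))\<^sup>2) / cell_volume N TYPE('n)
      \<le> (LINT x:period_box N|lebesgue. (cmod (w x - (\<Sum>\<xi>\<in>F. d \<xi> * wave \<xi> x)))\<^sup>2)"
proof -
  define X where "X = cell_volume N TYPE('n)"
  have X: "X > 0" using N by (simp add: X_def cell_volume_def)
  define c where "c \<xi> = fourier_coeff w \<xi>" for \<xi>
  have "Re (\<Sum>\<xi>\<in>F. cnj (c \<xi> / X) * c \<xi>) = (\<Sum>\<xi>\<in>F. (cmod (c \<xi>))\<^sup>2) / X"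
    unfolding Re_sum sum_divide_distrib
    unfolding cmod_power2
    by (intro sum.cong refl) (simp add: power2_eq_square add_divide_distrib)
  moreover have "X * (\<Sum>\<xi>\<in>F. (cmod (c \<xi> / X))\<^sup>2) = (\<Sum>\<xi>\<in>F. (cmod (c \<xi>))\<^sup>2) / X"
    using X by (simp add: sum_distrib_left sum_divide_distrib norm_divide power_divide power2_eq_square)
  ultimately show "(LINT x:period_box N|lebesgue. (cmod (w x - (\<Sum>\<xi>\<in>F. fourier_coeff w \<xi> / cell_volume N TYPE('n) * wave \<xi> x)))\<^sup>2)
      = energy w - (\<Sum>\<xi>\<in>F. (cmod (fourier_coeff w \<xi>))\<^sup>2) / cell_volume N TYPE('n)"
    using pythagoras_period_box(2)[OF N F w, of "\<lambda>\<xi>. c \<xi> / X"]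
    by (simp add: c_def X_def)
  have "2 * Re (\<Sum>\<xi>\<in>F. cnj (d \<xi>) * c \<xi>) - X * (\<Sum>\<xi>\<in>F. (cmod (d \<xi>))\<^sup>2) \<le> (\<Sum>\<xi>\<in>F. (cmod (c \<xi>))\<^sup>2) / X"
  proof -
    have "2 * Re (cnj (d \<xi>) * c \<xi>) - X * (cmod (d \<xi>))\<^sup>2 \<le> (cmod (c \<xi>))\<^sup>2 / X" for \<xi>
    proof -
      have "0 \<le> (cmod (c \<xi> - X * d \<xi>))\<^sup>2" by simp
      also have "\<dots> = (cmod (c \<xi>))\<^sup>2 - 2 * Re (c \<xi> * cnj (X * d \<xi>)) + (cmod (X * d \<xi>))\<^sup>2"
        by (rule norm_diff_squared_expand)
      also have "\<dots> = (cmod (c \<xi>))\<^sup>2 - X * (2 * Re (cnj (d \<xi>) * c \<xi>) - X * (cmod (d \<xi>))\<^sup>2)"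
        using X by (simp add: norm_mult algebra_simps power2_eq_square)
      finally show ?thesis using X by (simp add: field_simps)
    qed
    then show ?thesis
      unfolding Re_sum sum_distrib_left sum_divide_distrib sum_subtractf[symmetric] by (intro sum_mono)
  qed
  then show "energy w - (\<Sum>\<xi>\<in>F. (cmod (fourier_coeff w \<xi>))\<^sup>2) / cell_volume N TYPE('n)
      \<le> (LINT x:period_box N|lebesgue. (cmod (w x - (\<Sum>\<xi>\<in>F. d \<xi> * wave \<xi> x)))\<^sup>2)"
    using pythagoras_period_box(2)[OF N F w, of d] by (simp add: c_def X_def)
qed

lemma bessel_inequality:
  fixes w :: "real^'n::finite \<Rightarrow> complex"
  assumes "N > 0" "finite F" "F \<subseteq> dual_lattice N"
    and "square_integrable lebesgue w" "\<And>x. x \<notin> period_box N \<Longrightarrow> w x = 0"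
  shows "(\<Sum>\<xi>\<in>F. (cmod (fourier_coeff w \<xi>))\<^sup>2) / cell_volume N TYPE('n) \<le> energy w"
proof -
  have "0 \<le> (LINT x:period_box N|lebesgue. (cmod (w x - (\<Sum>\<xi>\<in>F. fourier_coeff w \<xi> / cell_volume N TYPE('n) * wave \<xi> x)))\<^sup>2)"
    unfolding set_lebesgue_integral_def by (intro Bochner_Integration.integral_nonneg) auto
  then show ?thesis using projection_error(1)[OF assms] by simp
qed

section \<open>Completeness of the exponentials\<close>

inductive trig_poly :: "real \<Rightarrow> (real^'n::finite \<Rightarrow> complex) \<Rightarrow> bool" for N where
  wave: "\<xi> \<in> dual_lattice N \<Longrightarrow> trig_poly N (\<lambda>x. c * wave \<xi> x)"
| add: "trig_poly N p \<Longrightarrow> trig_poly N q \<Longrightarrow> trig_poly N (\<lambda>x. p x + q x)"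

lemma trig_poly_finite_sum:
  "trig_poly N p \<Longrightarrow> \<exists>F d. finite F \<and> F \<subseteq> dual_lattice N \<and> p = (\<lambda>x. \<Sum>\<xi>\<in>F. d \<xi> * wave \<xi> x)"
proof (induction rule: trig_poly.induct)
  case (wave \<xi> c)
  then show ?case by (intro exI[of _ "{\<xi>}"] exI[of _ "\<lambda>_. c"]) auto
next
  case (add p q)
  then obtain F d G e where F: "finite F" "F \<subseteq> dual_lattice N" "p = (\<lambda>x. \<Sum>\<xi>\<in>F. d \<xi> * wave \<xi> x)"
    and G: "finite G" "G \<subseteq> dual_lattice N" "q = (\<lambda>x. \<Sum>\<xi>\<in>G. e \<xi> * wave \<xi> x)" by blast
  have "p x = (\<Sum>\<xi>\<in>F \<union> G. (if \<xi> \<in> F then d \<xi> else 0) * wave \<xi> x)" for x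
    unfolding F(3) by (rule sum.mono_neutral_cong_left) (use F G in auto)
  moreover have "q x = (\<Sum>\<xi>\<in>F \<union> G. (if \<xi> \<in> G then e \<xi> else 0) * wave \<xi> x)" for x
    unfolding G(3) by (rule sum.mono_neutral_cong_left) (use F G in auto)
  ultimately have "(\<lambda>x. p x + q x) = (\<lambda>x. \<Sum>\<xi>\<in>F \<union> G.
      ((if \<xi> \<in> F then d \<xi> else 0) + (if \<xi> \<in> G then e \<xi> else 0)) * wave \<xi> x)"
    by (simp add: fun_eq_iff distrib_right sum.distrib)
  then show ?case using F(1,2) G(1,2)
    by (intro exI[of _ "F \<union> G"] exI conjI) auto
qed

lemma trig_poly_mult_wave:
  "trig_poly N q \<Longrightarrow> \<xi> \<in> dual_lattice N \<Longrightarrow> trig_poly N (\<lambda>x. c * wave \<xi> x * q x)"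
proof (induction rule: trig_poly.induct)
  case (wave \<eta> d)
  have "trig_poly N (\<lambda>x. (c * d) * wave (\<xi> + \<eta>) x)"
    using wave dual_lattice_add by (intro trig_poly.wave) auto
  then show ?case by (simp add: wave_add_freq mult_ac)
next
  case (add p q)
  then show ?case using trig_poly.add[OF add.IH] by (simp add: distrib_left)
qed

lemma trig_poly_mult: "trig_poly N p \<Longrightarrow> trig_poly N q \<Longrightarrow> trig_poly N (\<lambda>x. p x * q x)"
proof (induction rule: trig_poly.induct)
  case (wave \<xi> c)
  then show ?case using trig_poly_mult_wave by blast
next
  case (add p q)
  then show ?case using trig_poly.add[OF add.IH] by (simp add: distrib_right)
qed

lemma trig_poly_const: "trig_poly N (\<lambda>_. c)"
  using trig_poly.wave[OF dual_lattice_zero, of N c] by simp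

lemma trig_poly_coordinate:
  fixes i :: "'n::finite"
  assumes "N > 0"
  shows "trig_poly N (\<lambda>x::real^'n. complex_of_real (Re (cis (x $ i / N))))"
    and "trig_poly N (\<lambda>x::real^'n. complex_of_real (Im (cis (x $ i / N))))"
proof -
  define e where "e = axis i (1 / N)"
  have e: "e \<in> dual_lattice N" "- e \<in> dual_lattice N"
    using assms by (auto simp: e_def dual_lattice_def int_vecs_def axis_def)
  have w: "wave e x = cis (x $ i / N)" "wave (- e) x = cis (- (x $ i / N))" for x
    by (simp_all add: wave_def e_def inner_axis')
  have "(\<lambda>x. complex_of_real (Re (cis (x $ i / N)))) = (\<lambda>x. (1/2) * wave e x + (1/2) * wave (- e) x)"
    by (simp add: w fun_eq_iff complex_eq_iff)
  then show "trig_poly N (\<lambda>x::real^'n. complex_of_real (Re (cis (x $ i / N))))"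
    by (simp only:) (intro trig_poly.intros e)
  have "(\<lambda>x. complex_of_real (Im (cis (x $ i / N)))) = (\<lambda>x. (- \<i>/2) * wave e x + (\<i>/2) * wave (- e) x)"
    by (simp add: w fun_eq_iff complex_eq_iff)
  then show "trig_poly N (\<lambda>x::real^'n. complex_of_real (Im (cis (x $ i / N))))"
    by (simp only:) (intro trig_poly.intros e)
qed

text \<open>
  Stone-Weierstrass on the product \<open>S\<close> of unit circles. A function that vanishes near the boundary of
  the period box descends to a continuous function \<open>G\<close> on \<open>S\<close>, with \<open>Arg\<close> as inverse of the map to
  the circle. The discontinuity of \<open>Arg\<close> at \<open>-1\<close> does no harm because \<open>G\<close> vanishes near it.
\<close>
lemma trig_poly_dense_real:
  fixes g :: "real^'n::finite \<Rightarrow> real"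
  assumes N: "N > 0" and g: "continuous_on UNIV g" "\<And>x i. \<bar>x $ i\<bar> > 2 * N \<Longrightarrow> g x = 0" and "\<delta> > 0"
  shows "\<exists>p. trig_poly N p \<and> (\<forall>x\<in>period_box N. cmod (complex_of_real (g x) - p x) < \<delta>)"
proof -
  define S :: "(complex^'n) set" where "S = {z. \<forall>i. cmod (z $ i) = 1}"
  define A :: "real^'n \<Rightarrow> complex^'n" where "A x = (\<chi> i. cis (x $ i / N))" for x
  define P where "P f \<longleftrightarrow> continuous_on S f \<and> trig_poly N (\<lambda>x. complex_of_real (f (A x)))" for f
  define G where "G z = g (\<chi> i. N * Arg (z $ i))" for z :: "complex^'n"
  have cos2: "cos 2 > (-1::real)"
    using cos_monotone_0_pi[of 2 pi] pi_gt3 by simp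
  \<comment> \<open>A coordinate with angle larger than 2 in modulus corresponds to \<open>\<bar>x $ i\<bar> > 2 * N\<close>.\<close>
  have G0: "G z = 0" if z: "z \<in> S" "Re (z $ i) < cos 2" for z i
  proof -
    have "z $ i = cis (Arg (z $ i))"
      using z(1) rcis_cmod_Arg[of "z $ i"] by (simp add: S_def rcis_def)
    then have "cos \<bar>Arg (z $ i)\<bar> < cos 2" using z(2) by (metis cis.simps(1) cos_abs_real)
    moreover have "\<bar>Arg (z $ i)\<bar> \<le> pi" using Arg_bounded[of "z $ i"] by auto
    ultimately have "\<bar>Arg (z $ i)\<bar> > 2"
      using cos_monotone_0_pi_le[of "\<bar>Arg (z $ i)\<bar>" 2] pi_gt3 by force
    then have "\<bar>N * Arg (z $ i)\<bar> > 2 * N" using N by (simp add: abs_mult)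
    then show ?thesis unfolding G_def by (intro g(2)[of _ i]) simp
  qed
  have "continuous_on S G"
    unfolding continuous_on_eq_continuous_within
  proof
    fix z assume z: "z \<in> S"
    show "continuous (at z within S) G"
    proof (cases "\<forall>i. z $ i \<notin> \<real>\<^sub>\<le>\<^sub>0")
      case True
      have "isCont (\<lambda>z. \<chi> i. N * Arg (z $ i)) z"
        unfolding continuous_at
      proof (rule vec_tendstoI)
        fix i
        have "isCont Arg (z $ i)" using True by (intro continuous_at_Arg) auto
        moreover have "isCont (\<lambda>z. z $ i) z" by (intro continuous_intros)
        ultimately have "isCont (\<lambda>z. Arg (z $ i)) z" using isCont_o2 by fast
        then show "((\<lambda>z. (\<chi> i. N * Arg (z $ i)) $ i) \<longlongrightarrow> (\<chi> i. N * Arg (z $ i)) $ i) (at z)"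
          by (simp add: continuous_at tendsto_mult_left)
      qed
      moreover have "isCont g (\<chi> i. N * Arg (z $ i))"
        using g(1) by (simp add: continuous_on_eq_continuous_at)
      ultimately have "isCont G z" unfolding G_def[abs_def] using isCont_o2 by fast
      then show ?thesis by (rule continuous_at_imp_continuous_within)
    next
      case False
      then obtain i where i: "z $ i \<in> \<real>\<^sub>\<le>\<^sub>0" by blast
      then obtain r where r: "z $ i = complex_of_real r" "r \<le> 0" by (auto elim!: nonpos_Reals_cases)
      have "cmod (z $ i) = 1" using z by (simp add: S_def)
      then have "Re (z $ i) = -1" using r by simp
      then have zi: "Re (z $ i) < cos 2" using cos2 by simp
      have "open {y::complex^'n. Re (y $ i) < cos 2}"
        by (intro open_Collect_less continuous_intros)
      then have "\<forall>\<^sub>F y in at z within S. G y = 0"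
        unfolding eventually_at_topological using zi G0 by blast
      then show ?thesis
        unfolding continuous_within G0[OF z zi] by (rule tendsto_eventually)
    qed
  qed
  moreover have "compact S"
  proof -
    have "closed S" unfolding S_def by (intro closed_Collect_all closed_Collect_eq continuous_intros)
    moreover have "bounded S"
      unfolding bounded_iff
    proof (intro exI ballI)
      fix z assume z: "z \<in> S"
      have "norm z \<le> (\<Sum>i\<in>UNIV. norm (z $ i))"
        by (simp add: norm_vec_def L2_set_le_sum)
      then show "norm z \<le> real CARD('n)" using z by (simp add: S_def)
    qed
    ultimately show ?thesis by (simp add: compact_eq_bounded_closed)
  qed
  ultimately have "\<exists>f. P f \<and> (\<forall>z\<in>S. \<bar>G z - f z\<bar> < \<delta>)"
  proof (intro Stone_Weierstrass_HOL[of S P G \<delta>])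
    show "P (\<lambda>x. c)" for c by (simp add: P_def trig_poly_const)
    show "P (\<lambda>x. f x + h x)" if "P f \<and> P h" for f h
      using that trig_poly.add[of N "\<lambda>x. complex_of_real (f (A x))" "\<lambda>x. complex_of_real (h (A x))"]
      by (auto simp: P_def intro: continuous_intros)
    show "P (\<lambda>x. f x * h x)" if "P f \<and> P h" for f h
      using that trig_poly_mult[of N "\<lambda>x. complex_of_real (f (A x))" "\<lambda>x. complex_of_real (h (A x))"]
      by (auto simp: P_def intro: continuous_intros)
    show "\<exists>f. P f \<and> f x \<noteq> f y" if xy: "x \<in> S \<and> y \<in> S \<and> x \<noteq> y" for x y
    proof -
      obtain i where "x $ i \<noteq> y $ i" using xy by (auto simp: vec_eq_iff)
      then have "Re (x $ i) \<noteq> Re (y $ i) \<or> Im (x $ i) \<noteq> Im (y $ i)" by (simp add: complex_eq_iff)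
      moreover have "P (\<lambda>z. Re (z $ i))" "P (\<lambda>z. Im (z $ i))"
        using trig_poly_coordinate[OF N, of i] by (auto simp: P_def A_def intro!: continuous_intros)
      ultimately show ?thesis by blast
    qed
  qed (use \<open>\<delta> > 0\<close> in \<open>auto simp: P_def\<close>)
  then obtain f where f: "P f" "\<And>z. z \<in> S \<Longrightarrow> \<bar>G z - f z\<bar> < \<delta>" by blast
  have GA: "G (A x) = g x" if x: "x \<in> period_box N" for x
  proof (cases "\<exists>i. \<bar>x $ i\<bar> > 2 * N")
    case True
    then obtain i where i: "\<bar>x $ i\<bar> > 2 * N" by blast
    have "\<bar>x $ i / N\<bar> \<le> pi" "\<bar>x $ i / N\<bar> > 2"
      using x i N by (auto simp: mem_period_box abs_mult divide_le_eq less_divide_eq)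
    then have "cos \<bar>x $ i / N\<bar> < cos 2" by (intro cos_monotone_0_pi) auto
    then have "Re (A x $ i) < cos 2" by (simp only: A_def vec_lambda_beta cis.simps cos_abs_real)
    then have "G (A x) = 0" by (intro G0) (auto simp: S_def A_def)
    then show ?thesis using g(2)[OF i] by simp
  next
    case False
    have "N * Arg (A x $ i) = x $ i" for i
    proof -
      have "\<bar>x $ i / N\<bar> \<le> 2" using False N by (auto simp: divide_le_eq not_less)
      then have "Arg (cis (x $ i / N)) = x $ i / N"
        using pi_gt3 by (intro Arg_cis) (simp_all only: greaterThanAtMost_iff, linarith)
      then show ?thesis using N by (simp add: A_def)
    qed
    then show ?thesis by (simp add: G_def)
  qed
  have "cmod (complex_of_real (g x) - complex_of_real (f (A x))) < \<delta>" if "x \<in> period_box N" for x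
  proof -
    have "A x \<in> S" by (simp add: S_def A_def)
    from f(2)[OF this] GA[OF that] show ?thesis by (metis norm_of_real of_real_diff real_norm_def)
  qed
  then show ?thesis using f(1) unfolding P_def by blast
qed

lemma trig_poly_dense:
  fixes g :: "real^'n::finite \<Rightarrow> complex"
  assumes N: "N > 0" and g: "continuous_on UNIV g" "\<And>x i. \<bar>x $ i\<bar> > 2 * N \<Longrightarrow> g x = 0" and "\<delta> > 0"
  shows "\<exists>p. trig_poly N p \<and> (\<forall>x\<in>period_box N. cmod (g x - p x) < \<delta>)"
proof -
  have c: "continuous_on UNIV (\<lambda>x. Re (g x))" "continuous_on UNIV (\<lambda>x. Im (g x))"
    using g(1) by (auto intro: continuous_intros)
  have \<delta>: "\<delta> / 2 > 0" using \<open>\<delta> > 0\<close> by simp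
  obtain p where p: "trig_poly N p" "\<And>x. x \<in> period_box N \<Longrightarrow> cmod (complex_of_real (Re (g x)) - p x) < \<delta> / 2"
    using trig_poly_dense_real[OF N c(1) _ \<delta>] g(2) by (metis zero_complex.simps(1))
  obtain q where q: "trig_poly N q" "\<And>x. x \<in> period_box N \<Longrightarrow> cmod (complex_of_real (Im (g x)) - q x) < \<delta> / 2"
    using trig_poly_dense_real[OF N c(2) _ \<delta>] g(2) by (metis zero_complex.simps(2))
  have "cmod (g x - (p x + \<i> * q x)) < \<delta>" if x: "x \<in> period_box N" for x
  proof -
    have "g x - (p x + \<i> * q x) = (complex_of_real (Re (g x)) - p x) + \<i> * (complex_of_real (Im (g x)) - q x)"
      by (simp add: algebra_simps complex_eq[of "g x", symmetric])
    then have "cmod (g x - (p x + \<i> * q x)) \<le> cmod (complex_of_real (Re (g x)) - p x) + cmod (complex_of_real (Im (g x)) - q x)"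
      by (metis norm_triangle_ineq norm_mult norm_ii mult_1)
    then show ?thesis using p(2)[OF x] q(2)[OF x] by linarith
  qed
  moreover have "trig_poly N (\<lambda>x. p x + \<i> * q x)"
    by (intro trig_poly.add trig_poly_mult trig_poly_const p q)
  ultimately show ?thesis by blast
qed

text \<open>
  Radial truncation to the disc of radius \<open>M\<close>; unlike a cut to 0, it is continuous.
\<close>
definition clip :: "real \<Rightarrow> complex \<Rightarrow> complex" where
  "clip M z = (M / max M (cmod z)) *\<^sub>R z"

lemma norm_clip_le: "M > 0 \<Longrightarrow> cmod (clip M z) \<le> M"
  by (auto simp: clip_def max_def field_simps)

lemma clip_eq: "M > 0 \<Longrightarrow> cmod z \<le> M \<Longrightarrow> clip M z = z"
  by (simp add: clip_def max_def)

lemma continuous_on_clip: "M > 0 \<Longrightarrow> continuous_on UNIV (clip M)"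
  unfolding clip_def[abs_def] by (intro continuous_intros) auto

lemma clip_factor: "M > 0 \<Longrightarrow> 0 \<le> M / max M (cmod z)" "M > 0 \<Longrightarrow> M / max M (cmod z) \<le> 1"
  by (simp_all add: divide_le_eq_1 less_max_iff_disj)

lemma norm_clip_le_norm: "M > 0 \<Longrightarrow> cmod (clip M z) \<le> cmod z"
  unfolding clip_def norm_scaleR using clip_factor[of M z]
  by (intro mult_left_le_one_le) (auto simp: abs_of_nonneg)

lemma norm_diff_clip_le: "M > 0 \<Longrightarrow> cmod (z - clip M z) \<le> cmod z"
proof -
  assume M: "M > 0"
  have "z - clip M z = (1 - M / max M (cmod z)) *\<^sub>R z" by (simp add: clip_def algebra_simps)
  moreover have "\<bar>1 - M / max M (cmod z)\<bar> \<le> 1" using clip_factor[OF M, of z] by linarith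
  ultimately show ?thesis by (simp add: mult_left_le_one_le)
qed

lemma L2_approx_bounded:
  fixes w :: "'a::euclidean_space \<Rightarrow> complex"
  assumes w: "square_integrable lebesgue w" and "\<epsilon> > 0"
  shows "\<exists>M>0. (LINT x|lebesgue. (cmod (w x - clip M (w x)))\<^sup>2) < \<epsilon>"
proof -
  have wm: "w \<in> borel_measurable lebesgue" and wi: "integrable lebesgue (\<lambda>x. (cmod (w x))\<^sup>2)"
    using w by (auto simp: square_integrable_def)
  have cm: "(\<lambda>x. clip (real (Suc n)) (w x)) \<in> borel_measurable lebesgue" for n
    using measurable_compose[OF wm borel_measurable_continuous_onI[OF continuous_on_clip]] by simp
  have "(\<lambda>n. LINT x|lebesgue. (cmod (w x - clip (real (Suc n)) (w x)))\<^sup>2) \<longlonglongrightarrow> (LINT x|(lebesgue::'a measure). 0)"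
  proof (rule integral_dominated_convergence[OF _ _ wi])
    show "(\<lambda>x. (cmod (w x - clip (real (Suc n)) (w x)))\<^sup>2) \<in> borel_measurable lebesgue" for n
      using wm cm by measurable
    show "AE x in lebesgue. (\<lambda>n. (cmod (w x - clip (real (Suc n)) (w x)))\<^sup>2) \<longlonglongrightarrow> 0"
    proof (rule AE_I2)
      fix x
      obtain m where m: "real m \<ge> cmod (w x)" using real_arch_simple by blast
      have "(cmod (w x - clip (real (Suc n)) (w x)))\<^sup>2 = 0" if "n \<ge> m" for n
      proof -
        have "cmod (w x) \<le> real (Suc n)" using m that by simp
        then show ?thesis by (simp add: clip_eq)
      qed
      then have "\<forall>\<^sub>F n in sequentially. (cmod (w x - clip (real (Suc n)) (w x)))\<^sup>2 = 0"
        unfolding eventually_sequentially by blast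
      then show "(\<lambda>n. (cmod (w x - clip (real (Suc n)) (w x)))\<^sup>2) \<longlonglongrightarrow> 0" by (rule tendsto_eventually)
    qed
    show "AE x in lebesgue. norm ((cmod (w x - clip (real (Suc n)) (w x)))\<^sup>2) \<le> (cmod (w x))\<^sup>2" for n
      using norm_diff_clip_le[of "real (Suc n)"] by (intro AE_I2) (simp add: power_mono)
  qed simp
  then have "\<forall>\<^sub>F n in sequentially. (LINT x|lebesgue. (cmod (w x - clip (real (Suc n)) (w x)))\<^sup>2) < \<epsilon>"
    using \<open>\<epsilon> > 0\<close> by (intro order_tendstoD(2)) auto
  then obtain n where "(LINT x|lebesgue. (cmod (w x - clip (real (Suc n)) (w x)))\<^sup>2) < \<epsilon>"
    by (auto simp: eventually_sequentially)
  then show ?thesis by (intro exI[of _ "real (Suc n)"]) simp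
qed

definition cube_cutoff :: "real \<Rightarrow> real^'n::finite \<Rightarrow> real" where
  "cube_cutoff N x = (\<Prod>i\<in>UNIV. max 0 (min 1 (2 - \<bar>x $ i\<bar> / N)))"

lemma cube_cutoff_bounds: "0 \<le> cube_cutoff N x" "cube_cutoff N x \<le> 1"
  unfolding cube_cutoff_def by (auto intro!: prod_nonneg prod_le_1)

lemma cube_cutoff_eq_1: "N > 0 \<Longrightarrow> (\<And>i. \<bar>x $ i\<bar> \<le> N) \<Longrightarrow> cube_cutoff N x = 1"
  unfolding cube_cutoff_def by (intro prod.neutral) (auto simp: divide_le_eq)

lemma cube_cutoff_eq_0: "N > 0 \<Longrightarrow> \<bar>x $ i\<bar> > 2 * N \<Longrightarrow> cube_cutoff N x = 0"
  unfolding cube_cutoff_def by (intro prod_zero) (auto intro!: exI[of _ i] simp: le_divide_eq)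

lemma continuous_on_cube_cutoff: "continuous_on UNIV (cube_cutoff N)"
proof (cases "N = 0")
  case True
  then show ?thesis by (simp add: cube_cutoff_def[abs_def])
qed (unfold cube_cutoff_def[abs_def], intro continuous_intros, auto)

text \<open>
  A measurable function is almost everywhere a limit of continuous functions. Clipping and cutting off
  preserve the limit and provide a bound, so dominated convergence applies.
\<close>
lemma bounded_L2_approx_continuous:
  fixes w :: "real^'n::finite \<Rightarrow> complex"
  assumes w: "w \<in> borel_measurable lebesgue" "\<And>x. cmod (w x) \<le> M" and M: "M > 0"
    and N: "N > 0" and supp: "\<And>x i. \<bar>x $ i\<bar> > N \<Longrightarrow> w x = 0" and "\<epsilon> > 0"
  shows "\<exists>g. continuous_on UNIV g \<and> (\<forall>x i. \<bar>x $ i\<bar> > 2 * N \<longrightarrow> g x = 0) \<and> (\<forall>x. cmod (g x) \<le> M) \<and>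
           (LINT x|lebesgue. (cmod (w x - g x))\<^sup>2) < \<epsilon>"
proof -
  have "w measurable_on UNIV"
    by (rule lebesgue_measurable_imp_measurable_on) (use w in auto)
  then obtain Z g where Z: "negligible Z" and g: "\<And>n. continuous_on UNIV (g n)"
    "\<And>x. x \<notin> Z \<Longrightarrow> (\<lambda>n. g n x) \<longlonglongrightarrow> w x"
    unfolding measurable_on_def by auto
  define h where "h n x = cube_cutoff N x *\<^sub>R clip M (g n x)" for n x
  have ch: "continuous_on UNIV (h n)" for n
    unfolding h_def
    by (intro continuous_intros continuous_on_cube_cutoff continuous_on_compose2[OF continuous_on_clip[OF M] g(1)]) auto
  have h0: "h n x = 0" if "\<bar>x $ i\<bar> > 2 * N" for n x i
    using cube_cutoff_eq_0[OF N that] by (simp add: h_def)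
  have hM: "cmod (h n x) \<le> M" for n x
  proof -
    have "cmod (h n x) \<le> 1 * M"
      unfolding h_def norm_scaleR using cube_cutoff_bounds[of N x] norm_clip_le[OF M]
      by (intro mult_mono) auto
    then show ?thesis by simp
  qed
  have w_eq: "cube_cutoff N x *\<^sub>R clip M (w x) = w x" for x
  proof (cases "\<forall>i. \<bar>x $ i\<bar> \<le> N")
    case True
    then have "cube_cutoff N x = 1" by (intro cube_cutoff_eq_1[OF N]) auto
    then show ?thesis using clip_eq[OF M w(2)] by simp
  next
    case False
    then have "w x = 0" using supp by (meson not_le)
    then show ?thesis by (simp add: clip_def)
  qed
  define B :: "(real^'n) set" where "B = cbox (\<chi> i. - (2 * N)) (\<chi> i. 2 * N)"
  have "(\<lambda>n. LINT x|lebesgue. (cmod (w x - h n x))\<^sup>2) \<longlonglongrightarrow> (LINT x|(lebesgue::(real^'n) measure). 0)"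
  proof (rule integral_dominated_convergence)
    have "set_integrable lebesgue B (\<lambda>_. (2 * M)\<^sup>2)"
      by (intro set_integrable_continuous_bounded) (auto simp: B_def)
    then show "integrable lebesgue (\<lambda>x. indicator B x *\<^sub>R (2 * M)\<^sup>2)" by (simp add: set_integrable_def)
    have "h n \<in> borel_measurable lebesgue" for n
      using borel_measurable_continuous_onI[OF ch] by (simp add: measurable_completion)
    then show "(\<lambda>x. (cmod (w x - h n x))\<^sup>2) \<in> borel_measurable lebesgue" for n
      using w(1) by measurable
    show "AE x in lebesgue. (\<lambda>n. (cmod (w x - h n x))\<^sup>2) \<longlonglongrightarrow> 0"
    proof (rule AE_I'[of Z])
      show "Z \<in> null_sets lebesgue" using Z by (simp add: negligible_iff_null_sets)
      have "(\<lambda>n. (cmod (w x - h n x))\<^sup>2) \<longlonglongrightarrow> 0" if "x \<notin> Z" for x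
      proof -
        have "isCont (clip M) (w x)"
          using continuous_on_clip[OF M] by (simp add: continuous_on_eq_continuous_at)
        then have "(\<lambda>n. clip M (g n x)) \<longlonglongrightarrow> clip M (w x)"
          using g(2)[OF that] isCont_tendsto_compose by blast
        then have "(\<lambda>n. h n x) \<longlonglongrightarrow> w x"
          using tendsto_scaleR[OF tendsto_const, of _ _ _ "cube_cutoff N x"] unfolding h_def
          by (metis w_eq)
        then have "(\<lambda>n. (cmod (w x - h n x))\<^sup>2) \<longlonglongrightarrow> (cmod (w x - w x))\<^sup>2"
          by (intro tendsto_intros)
        then show ?thesis by simp
      qed
      then show "{x \<in> space lebesgue. \<not> (\<lambda>n. (cmod (w x - h n x))\<^sup>2) \<longlonglongrightarrow> 0} \<subseteq> Z" by auto
    qed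
    show "AE x in lebesgue. norm ((cmod (w x - h n x))\<^sup>2) \<le> indicator B x *\<^sub>R (2 * M)\<^sup>2" for n
    proof (rule AE_I2)
      fix x
      show "norm ((cmod (w x - h n x))\<^sup>2) \<le> indicator B x *\<^sub>R (2 * M)\<^sup>2"
      proof (cases "x \<in> B")
        case True
        have "cmod (w x - h n x) \<le> 2 * M"
          using norm_triangle_ineq4[of "w x" "h n x"] w(2)[of x] hM[of n x] by linarith
        then have "(cmod (w x - h n x))\<^sup>2 \<le> (2 * M)\<^sup>2" by (intro power_mono) auto
        then show ?thesis using True by simp
      next
        case False
        have "\<exists>i. \<bar>x $ i\<bar> > 2 * N"
        proof (rule ccontr)
          assume "\<nexists>i. \<bar>x $ i\<bar> > 2 * N"
          then have "x \<in> B" by (auto simp: B_def mem_box_cart not_less abs_le_iff minus_le_iff)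
          then show False using False by simp
        qed
        then obtain i where i: "\<bar>x $ i\<bar> > 2 * N" by blast
        then have "\<bar>x $ i\<bar> > N" using N by linarith
        then show ?thesis using h0[OF i] supp False by simp
      qed
    qed
  qed simp
  then have "\<forall>\<^sub>F n in sequentially. (LINT x|lebesgue. (cmod (w x - h n x))\<^sup>2) < \<epsilon>"
    using \<open>\<epsilon> > 0\<close> by (intro order_tendstoD(2)) auto
  then obtain n where "(LINT x|lebesgue. (cmod (w x - h n x))\<^sup>2) < \<epsilon>"
    by (auto simp: eventually_sequentially)
  then show ?thesis using ch[of n] h0 hM by blast
qed

text \<open>
  Chain of approximations: \<open>w\<close> by a bounded function, this one by a continuous function that vanishes
  outside the cube of half-side \<open>2 * N\<close>, and the latter uniformly by a trigonometric polynomial. The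
  support in the cube of half-side \<open>N\<close>, well inside the period box, leaves room for the cutoffs.
\<close>
lemma parseval_approx:
  fixes w :: "real^'n::finite \<Rightarrow> complex"
  assumes N: "N > 0" and w: "square_integrable lebesgue w" "\<And>x i. \<bar>x $ i\<bar> > N \<Longrightarrow> w x = 0" and \<epsilon>: "\<epsilon> > 0"
  shows "\<exists>F. finite F \<and> F \<subseteq> dual_lattice N \<and>
    energy w - (\<Sum>\<xi>\<in>F. (cmod (fourier_coeff w \<xi>))\<^sup>2) / cell_volume N TYPE('n) < \<epsilon>"
proof -
  define X where "X = cell_volume N TYPE('n)"
  have X: "X > 0" using N by (simp add: X_def cell_volume_def)
  have wm: "w \<in> borel_measurable lebesgue" and w2: "integrable lebesgue (\<lambda>x. (cmod (w x))\<^sup>2)"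
    using w(1) by (auto simp: square_integrable_def)
  have wbox: "w x = 0" if x: "x \<notin> period_box N" for x
    using outside_period_box[OF N x] w(2) by metis
  obtain M where M: "M > 0" "(LINT x|lebesgue. (cmod (w x - clip M (w x)))\<^sup>2) < \<epsilon> / 16"
    using L2_approx_bounded[OF w(1), of "\<epsilon> / 16"] \<epsilon> by auto
  have cwm: "(\<lambda>x. clip M (w x)) \<in> borel_measurable lebesgue"
    using measurable_compose[OF wm borel_measurable_continuous_onI[OF continuous_on_clip[OF M(1)]]] by simp
  have "\<exists>g. continuous_on UNIV g \<and> (\<forall>x i. \<bar>x $ i\<bar> > 2 * N \<longrightarrow> g x = 0) \<and> (\<forall>x. cmod (g x) \<le> M) \<and>
           (LINT x|lebesgue. (cmod (clip M (w x) - g x))\<^sup>2) < \<epsilon> / 16"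
    by (rule bounded_L2_approx_continuous[OF cwm norm_clip_le[OF M(1)] M(1) N])
      (use \<epsilon> w(2) in \<open>auto simp: clip_def\<close>)
  then obtain g where g: "continuous_on UNIV g" "\<And>x i. \<bar>x $ i\<bar> > 2 * N \<Longrightarrow> g x = 0"
    "\<And>x. cmod (g x) \<le> M" "(LINT x|lebesgue. (cmod (clip M (w x) - g x))\<^sup>2) < \<epsilon> / 16" by blast
  define \<delta> where "\<delta> = sqrt (\<epsilon> / (4 * X))"
  have \<delta>: "\<delta> > 0" "\<delta>\<^sup>2 = \<epsilon> / (4 * X)" using \<epsilon> X by (simp_all add: \<delta>_def)
  obtain p where p: "trig_poly N p" "\<And>x. x \<in> period_box N \<Longrightarrow> cmod (g x - p x) < \<delta>"
    using trig_poly_dense[OF N g(1) _ \<delta>(1)] g(2) by blast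
  obtain F d where F: "finite F" "F \<subseteq> dual_lattice N" "p = (\<lambda>x. \<Sum>\<xi>\<in>F. d \<xi> * wave \<xi> x)"
    using trig_poly_finite_sum[OF p(1)] by blast
  define P where "P x = (\<Sum>\<xi>\<in>F. d \<xi> * wave \<xi> x)" for x
  have pP: "p = P" using F(3) by (simp add: P_def fun_eq_iff)
  have boxi: "set_integrable lebesgue (period_box N :: (real^'n) set) (\<lambda>_. c)" for c :: real
    by (intro set_integrable_continuous_bounded continuous_intros) auto
  have gbox: "g x = 0" if x: "x \<notin> period_box N" for x
    using outside_period_box[OF N x] g(2) by metis
  have ig: "integrable lebesgue (\<lambda>x. (cmod (clip M (w x) - g x))\<^sup>2)"
  proof (rule Bochner_Integration.integrable_bound)
    show "integrable lebesgue (\<lambda>x. 2 * (cmod (w x))\<^sup>2 + indicator (period_box N) x *\<^sub>R (2 * M\<^sup>2))"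
      using boxi unfolding set_integrable_def by (intro Bochner_Integration.integrable_add integrable_mult_right w2)
    show "(\<lambda>x. (cmod (clip M (w x) - g x))\<^sup>2) \<in> borel_measurable lebesgue"
    proof -
      have "g \<in> borel_measurable lebesgue"
        using borel_measurable_continuous_onI[OF g(1)] by (simp add: measurable_completion)
      then show ?thesis using cwm by measurable
    qed
    have "(cmod (clip M (w x) - g x))\<^sup>2 \<le> 2 * (cmod (w x))\<^sup>2 + indicator (period_box N) x *\<^sub>R (2 * M\<^sup>2)" for x
    proof -
      have "(cmod (clip M (w x)))\<^sup>2 \<le> (cmod (w x))\<^sup>2"
        by (intro power_mono norm_clip_le_norm M(1)) auto
      moreover have "(cmod (g x))\<^sup>2 \<le> indicator (period_box N) x * M\<^sup>2"
        using gbox[of x] g(3)[of x] by (cases "x \<in> period_box N") (auto intro: power_mono)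
      ultimately have "(cmod (clip M (w x) - g x))\<^sup>2 \<le> 2 * (cmod (w x))\<^sup>2 + 2 * (indicator (period_box N) x * M\<^sup>2)"
        using norm_diff_squared_le[of "clip M (w x)" "g x"] by linarith
      then show ?thesis by simp
    qed
    then show "AE x in lebesgue. norm ((cmod (clip M (w x) - g x))\<^sup>2)
        \<le> norm (2 * (cmod (w x))\<^sup>2 + indicator (period_box N) x *\<^sub>R (2 * M\<^sup>2))"
      unfolding real_norm_def abs_power2 by (intro AE_I2 order_trans[OF _ abs_ge_self])
  qed
  have ic: "integrable lebesgue (\<lambda>x. (cmod (w x - clip M (w x)))\<^sup>2)"
  proof (rule Bochner_Integration.integrable_bound[OF w2])
    show "(\<lambda>x. (cmod (w x - clip M (w x)))\<^sup>2) \<in> borel_measurable lebesgue" using wm cwm by measurable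
    show "AE x in lebesgue. norm ((cmod (w x - clip M (w x)))\<^sup>2) \<le> norm ((cmod (w x))\<^sup>2)"
      using norm_diff_clip_le[OF M(1)] by (intro AE_I2) (simp add: power_mono)
  qed
  have "(LINT x:period_box N|lebesgue. (cmod (w x - P x))\<^sup>2)
     \<le> (LINT x|lebesgue. 4 * (cmod (w x - clip M (w x)))\<^sup>2 + 4 * (cmod (clip M (w x) - g x))\<^sup>2
          + indicator (period_box N) x *\<^sub>R (2 * \<delta>\<^sup>2))"
    unfolding set_lebesgue_integral_def
  proof (rule integral_mono)
    show "integrable lebesgue (\<lambda>x. indicator (period_box N) x *\<^sub>R (cmod (w x - P x))\<^sup>2)"
      using pythagoras_period_box(1)[OF N F(1,2) w(1) wbox, of d] unfolding set_integrable_def P_def by simp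
    show "integrable lebesgue (\<lambda>x. 4 * (cmod (w x - clip M (w x)))\<^sup>2 + 4 * (cmod (clip M (w x) - g x))\<^sup>2
          + indicator (period_box N) x *\<^sub>R (2 * \<delta>\<^sup>2))"
      using boxi unfolding set_integrable_def
      by (intro Bochner_Integration.integrable_add integrable_mult_right ic ig)
    fix x :: "real^'n"
    show "indicator (period_box N) x *\<^sub>R (cmod (w x - P x))\<^sup>2
      \<le> 4 * (cmod (w x - clip M (w x)))\<^sup>2 + 4 * (cmod (clip M (w x) - g x))\<^sup>2
          + indicator (period_box N) x *\<^sub>R (2 * \<delta>\<^sup>2)"
    proof (cases "x \<in> period_box N")
      case True
      have "(cmod (g x - P x))\<^sup>2 \<le> \<delta>\<^sup>2" using p(2)[OF True] unfolding pP by (intro power_mono) auto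
      moreover have "(cmod (w x - P x))\<^sup>2 \<le> 2 * (cmod (w x - g x))\<^sup>2 + 2 * (cmod (g x - P x))\<^sup>2"
        using norm_add_squared_le[of "w x - g x" "g x - P x"] by simp
      moreover have "(cmod (w x - g x))\<^sup>2 \<le> 2 * (cmod (w x - clip M (w x)))\<^sup>2 + 2 * (cmod (clip M (w x) - g x))\<^sup>2"
        using norm_add_squared_le[of "w x - clip M (w x)" "clip M (w x) - g x"] by simp
      ultimately show ?thesis using True by simp
    qed simp
  qed
  also have "\<dots> = 4 * (LINT x|lebesgue. (cmod (w x - clip M (w x)))\<^sup>2)
      + 4 * (LINT x|lebesgue. (cmod (clip M (w x) - g x))\<^sup>2) + X * (2 * \<delta>\<^sup>2)"
  proof -
    have "(LINT x|lebesgue. indicator (period_box N) (x::real^'n) *\<^sub>R (2 * \<delta>\<^sup>2)) = X * (2 * \<delta>\<^sup>2)"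
    proof -
      have "(LINT x|lebesgue. indicator (period_box N) (x::real^'n) *\<^sub>R (1::real)) = X"
        using set_integral_wave_sum_squared[OF N, of "{0::real^'n}" "\<lambda>_. 1"]
        by (simp add: set_lebesgue_integral_def X_def dual_lattice_zero)
      then show ?thesis by simp
    qed
    then show ?thesis
      using boxi[of "2 * \<delta>\<^sup>2"] ic ig unfolding set_integrable_def by simp
  qed
  also have "\<dots> < \<epsilon>"
  proof -
    have "X * (2 * \<delta>\<^sup>2) = \<epsilon> / 2" using X by (simp add: \<delta>)
    then show ?thesis using M(2) g(4) by linarith
  qed
  finally have "(LINT x:period_box N|lebesgue. (cmod (w x - P x))\<^sup>2) < \<epsilon>" .
  then have "energy w - (\<Sum>\<xi>\<in>F. (cmod (fourier_coeff w \<xi>))\<^sup>2) / cell_volume N TYPE('n) < \<epsilon>"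
    using projection_error(2)[OF N F(1,2) w(1) wbox, of d] unfolding P_def by linarith
  then show ?thesis using F(1,2) by blast
qed

section \<open>The equation in terms of Fourier coefficients\<close>

lemma test_function_bounded_support:
  assumes "test_function (\<phi> :: real^'n::finite \<Rightarrow> complex)"
  obtains K M where "compact K" "\<And>x. x \<notin> K \<Longrightarrow> \<phi> x = 0" "\<And>x. cmod (\<phi> x) \<le> M" "continuous_on UNIV \<phi>"
proof -
  define K where "K = closure {x. \<phi> x \<noteq> 0}"
  have K: "compact K" "\<And>x. x \<notin> K \<Longrightarrow> \<phi> x = 0"
    using assms closure_subset[of "{x. \<phi> x \<noteq> 0}"] by (auto simp: test_function_def K_def)
  have c: "continuous_on UNIV \<phi>" using assms unfolding test_function_def by (metis Ck_fun.simps(1))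
  have "compact (\<phi> ` K)" by (intro compact_continuous_image continuous_on_subset[OF c] K) auto
  then have "bounded (\<phi> ` K)" by (rule compact_imp_bounded)
  then obtain M where M: "\<And>x. x \<in> K \<Longrightarrow> cmod (\<phi> x) \<le> M"
    unfolding bounded_iff by auto
  have "cmod (\<phi> x) \<le> max M 0" for x
    using M[of x] K(2)[of x] by (cases "x \<in> K") auto
  from that[OF K this c] show thesis .
qed

lemma locally_integrable_mult_test:
  assumes "locally_integrable v" "test_function (\<phi> :: real^'n::finite \<Rightarrow> complex)"
  shows "integrable lebesgue (\<lambda>x. v x * \<phi> x)"
proof -
  obtain K M where K: "compact K" "\<And>x. x \<notin> K \<Longrightarrow> \<phi> x = 0" "\<And>x. cmod (\<phi> x) \<le> M" "continuous_on UNIV \<phi>"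
    using test_function_bounded_support[OF assms(2)] by metis
  have "integrable lebesgue (\<lambda>x. indicator K x *\<^sub>R v x)"
    using assms(1) K(1) unfolding locally_integrable_def set_integrable_def by blast
  then have "integrable lebesgue (\<lambda>x. (indicator K x *\<^sub>R v x) * \<phi> x)"
    by (rule integrable_mult_bounded_continuous[OF _ K(4,3)])
  moreover have "(indicator K x *\<^sub>R v x) * \<phi> x = v x * \<phi> x" for x
    using K(2) by (cases "x \<in> K") auto
  ultimately show ?thesis by simp
qed

lemma test_function_partial:
  fixes \<phi> :: "real^'n::finite \<Rightarrow> complex"
  shows "test_function \<phi> \<Longrightarrow> test_function (partial_deriv i \<phi>)"
proof -
  assume t: "test_function (\<phi> :: real^'n \<Rightarrow> complex)"
  have ck: "Ck_fun k (partial_deriv i \<phi>)" for k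
    using t unfolding test_function_def by (metis Ck_fun.simps(2))
  have "partial_deriv i \<phi> x = 0" if x: "x \<notin> closure {x. \<phi> x \<noteq> 0}" for x
  proof -
    have "((\<lambda>_. 0) has_derivative (\<lambda>_. 0)) (at x)" by simp
    then have "(\<phi> has_derivative (\<lambda>_. 0)) (at x)"
    proof (rule has_derivative_transform_within_open)
      show "open (- closure {x. \<phi> x \<noteq> 0})" by auto
      show "x \<in> - closure {x. \<phi> x \<noteq> 0}" using x by simp
      show "0 = \<phi> y" if "y \<in> - closure {x. \<phi> x \<noteq> 0}" for y
        using that closure_subset[of "{x. \<phi> x \<noteq> 0}"] by auto
    qed
    from frechet_derivative_at[OF this] show ?thesis unfolding partial_deriv_def by metis
  qed
  then have sub: "closure {x. partial_deriv i \<phi> x \<noteq> 0} \<subseteq> closure {x. \<phi> x \<noteq> 0}"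
    by (intro closure_minimal) auto
  have bd: "bounded (closure {x. \<phi> x \<noteq> 0})"
    using t unfolding test_function_def by (simp add: compact_eq_bounded_closed)
  from ck bounded_subset[OF this sub] show ?thesis
    unfolding test_function_def compact_eq_bounded_closed by simp
qed

text \<open>
  The function \<open>weak_partial i u\<close> is an arbitrary representative and need not be equal to \<open>v\<close>. Both
  have the same integrals against test functions, and so have their weak derivatives, because partial
  derivatives of test functions are test functions. Hence the iterated weak derivative exists and
  permits two integrations by parts.
\<close>
lemma weak_partial_twice:
  fixes u v w \<phi> :: "real^'n::finite \<Rightarrow> complex"
  assumes v: "has_weak_partial i u v" and w: "has_weak_partial i v w"
  shows "locally_integrable (weak_partial i (weak_partial i u))"
    and "test_function \<phi> \<Longrightarrow> (LINT x|lebesgue. weak_partial i (weak_partial i u) x * \<phi> x)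
      = (LINT x|lebesgue. u x * partial_deriv i (partial_deriv i \<phi>) x)"
proof -
  define v' where "v' = weak_partial i u"
  have v': "has_weak_partial i u v'" unfolding v'_def weak_partial_def
    using v by (rule someI[of "has_weak_partial i u"])
  have same: "(LINT x|lebesgue. v x * \<psi> x) = (LINT x|lebesgue. v' x * \<psi> x)" if "test_function \<psi>" for \<psi>
    using v v' that unfolding has_weak_partial_def by (metis neg_equal_iff_equal)
  have "has_weak_partial i v' w"
    unfolding has_weak_partial_def
  proof (intro conjI allI impI)
    fix \<phi> :: "real^'n \<Rightarrow> complex" assume t: "test_function \<phi>"
    show "(LINT x|lebesgue. v' x * partial_deriv i \<phi> x) = - (LINT x|lebesgue. w x * \<phi> x)"
      unfolding same[OF test_function_partial[OF t], symmetric]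
      using w t unfolding has_weak_partial_def by blast
  qed (use w v' in \<open>simp_all add: has_weak_partial_def\<close>)
  then have w': "has_weak_partial i v' (weak_partial i v')" unfolding weak_partial_def
    by (rule someI[of "has_weak_partial i v'"])
  then show "locally_integrable (weak_partial i (weak_partial i u))"
    unfolding has_weak_partial_def v'_def by blast
  assume t: "test_function \<phi>"
  have "(LINT x|lebesgue. weak_partial i v' x * \<phi> x) = - (LINT x|lebesgue. v' x * partial_deriv i \<phi> x)"
    using w' t unfolding has_weak_partial_def by simp
  also have "\<dots> = (LINT x|lebesgue. u x * partial_deriv i (partial_deriv i \<phi>) x)"
    using v' test_function_partial[OF t] unfolding has_weak_partial_def by simp
  finally show "(LINT x|lebesgue. weak_partial i (weak_partial i u) x * \<phi> x)
      = (LINT x|lebesgue. u x * partial_deriv i (partial_deriv i \<phi>) x)" unfolding v'_def .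
qed

lemma square_integrable_imp_locally:
  fixes u :: "real^'n::finite \<Rightarrow> complex"
  assumes "square_integrable lebesgue u" shows "locally_integrable u"
  unfolding locally_integrable_def
proof (intro allI impI)
  fix K :: "(real^'n) set" assume K: "compact K"
  have Km: "K \<in> sets lebesgue" using K by (simp add: borel_compact)
  have "square_integrable lebesgue (\<lambda>x. indicator K x *\<^sub>R u x)"
    unfolding square_integrable_def
  proof
    show "(\<lambda>x. indicator K x *\<^sub>R u x) \<in> borel_measurable lebesgue"
      using assms Km unfolding square_integrable_def by (intro borel_measurable_scaleR) auto
    have "integrable lebesgue (\<lambda>x. indicator K x *\<^sub>R (cmod (u x))\<^sup>2)"
      using assms Km unfolding square_integrable_def by (intro integrable_mult_indicator) auto
    moreover have "indicator K x *\<^sub>R (cmod (u x))\<^sup>2 = (cmod (indicator K x *\<^sub>R u x))\<^sup>2" for x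
      by (cases "x \<in> K") auto
    ultimately show "integrable lebesgue (\<lambda>x. (cmod (indicator K x *\<^sub>R u x))\<^sup>2)" by simp
  qed
  then have "integrable lebesgue (\<lambda>x. indicator K x *\<^sub>R u x)"
    by (rule integrable_if_square_integrable[OF _ compact_imp_bounded[OF K] Km]) simp
  then show "set_integrable lebesgue K u" by (simp add: set_integrable_def)
qed

text \<open>
  The equation tested with \<open>\<phi>\<close>, with all derivatives moved to \<open>\<phi>\<close>.
\<close>
lemma weak_equation:
  fixes u f :: "real^'n::finite \<Rightarrow> complex"
  assumes u: "sobolev_H 2 u" and f: "square_integrable lebesgue f"
    and eq: "AE x in lebesgue. laplace_op u x - of_real lam * u x = f x"
    and t: "test_function \<phi>"
  shows "- (\<Sum>j\<in>UNIV. (LINT x|lebesgue. u x * partial_deriv j (partial_deriv j \<phi>) x)) - of_real lam * (LINT x|lebesgue. u x * \<phi> x)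
     = (LINT x|lebesgue. f x * \<phi> x)"
proof -
  have u2: "square_integrable lebesgue u" using u by (simp add: numeral_2_eq_2)
  have ex: "\<exists>v w. has_weak_partial j u v \<and> has_weak_partial j v w" for j
    using u unfolding numeral_2_eq_2 sobolev_H.simps by blast
  let ?w = "\<lambda>j. weak_partial j (weak_partial j u)"
  have w: "locally_integrable (?w j)" "(LINT x|lebesgue. ?w j x * \<phi> x) = (LINT x|lebesgue. u x * partial_deriv j (partial_deriv j \<phi>) x)" for j
  proof -
    obtain v w where vw: "has_weak_partial j u v" "has_weak_partial j v w" using ex by blast
    show "locally_integrable (?w j)" by (rule weak_partial_twice(1)[OF vw])
    show "(LINT x|lebesgue. ?w j x * \<phi> x) = (LINT x|lebesgue. u x * partial_deriv j (partial_deriv j \<phi>) x)"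
      by (rule weak_partial_twice(2)[OF vw t])
  qed
  have wi: "integrable lebesgue (\<lambda>x. ?w j x * \<phi> x)" for j by (rule locally_integrable_mult_test[OF w(1) t])
  have ui: "integrable lebesgue (\<lambda>x. u x * \<phi> x)" 
    by (rule locally_integrable_mult_test[OF square_integrable_imp_locally[OF u2] t])
  have fi: "integrable lebesgue (\<lambda>x. f x * \<phi> x)" 
    by (rule locally_integrable_mult_test[OF square_integrable_imp_locally[OF f] t])
  have "(LINT x|lebesgue. f x * \<phi> x) = (LINT x|lebesgue. - (\<Sum>j\<in>UNIV. ?w j x * \<phi> x) - of_real lam * (u x * \<phi> x))"
  proof (rule integral_cong_AE)
    show "(\<lambda>x. f x * \<phi> x) \<in> borel_measurable lebesgue" using fi by simp
    show "(\<lambda>x. - (\<Sum>j\<in>UNIV. ?w j x * \<phi> x) - of_real lam * (u x * \<phi> x)) \<in> borel_measurable lebesgue"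
      by (intro borel_measurable_diff borel_measurable_uminus borel_measurable_sum borel_measurable_times
            borel_measurable_const borel_measurable_integrable[OF wi] borel_measurable_integrable[OF ui])
    show "AE x in lebesgue. f x * \<phi> x = - (\<Sum>j\<in>UNIV. ?w j x * \<phi> x) - of_real lam * (u x * \<phi> x)"
      using eq
    proof (rule AE_mp, intro AE_I2 impI)
      fix x assume e: "laplace_op u x - of_real lam * u x = f x"
      show "f x * \<phi> x = - (\<Sum>j\<in>UNIV. ?w j x * \<phi> x) - of_real lam * (u x * \<phi> x)"
        unfolding e[symmetric] laplace_op_def by (simp add: left_diff_distrib sum_distrib_right mult.assoc)
    qed
  qed
  also have "\<dots> = - (\<Sum>j\<in>UNIV. (LINT x|lebesgue. ?w j x * \<phi> x)) - of_real lam * (LINT x|lebesgue. u x * \<phi> x)"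
    by (subst Bochner_Integration.integral_diff[OF integrable_minus[OF Bochner_Integration.integrable_sum[OF wi]]
          integrable_mult_right[OF ui]])
      (simp only: integral_minus Bochner_Integration.integral_sum[OF wi] integral_mult_right_zero)
  finally show ?thesis by (simp add: w(2))
qed

lemma cart_prod_upd:
  "cart_prod (\<beta>(j := g)) x = g (x $ j) * (\<Prod>k\<in>UNIV - {j}. \<beta> k (x $ k))"
  unfolding cart_prod_def by (subst prod.remove[of UNIV j]) auto

lemma modulated_derivative:
  fixes g :: "real \<Rightarrow> real"
  assumes "\<And>t. (g has_vector_derivative g' t) (at t)"
  shows "((\<lambda>t. of_real (g (t / N)) * cis (z * t)) has_vector_derivative
     of_real (g' (t / N) / N) * cis (z * t) + \<i> * of_real z * (of_real (g (t / N)) * cis (z * t))) (at t)"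
proof -
  have "((\<lambda>t. t / N) has_vector_derivative 1 / N) (at t)"
    unfolding has_real_derivative_iff_has_vector_derivative[symmetric] by (rule DERIV_cdivide[OF DERIV_ident])
  from vector_diff_chain_at[OF this assms] have "((\<lambda>t. g (t / N)) has_real_derivative g' (t / N) / N) (at t)"
    by (simp add: o_def has_real_derivative_iff_has_vector_derivative)
  then have "((\<lambda>t. complex_of_real (g (t / N))) has_vector_derivative of_real (g' (t / N) / N)) (at t)"
    by (rule has_vector_derivative_of_real)
  from has_vector_derivative_mult[OF this has_vector_derivative_cis[of z t]] show ?thesis
    by (simp add: mult_ac add.commute)
qed

lemma smooth_modulated:
  fixes g :: "real \<Rightarrow> real"
  assumes "smooth g"
  shows "smooth (\<lambda>t. of_real (g (t / N)) * cis (z * t))"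
proof -
  have "smooth (\<lambda>t. complex_of_real (g ((1 / N) * t + 0)))"
    by (rule smooth_of_real[OF smooth_affine_compose[OF assms]])
  from smooth_mult[OF this smooth_cis[of z]] show ?thesis by simp
qed

lemma smooth_scaled: 
  fixes g :: "real \<Rightarrow> real"
  assumes "smooth g" shows "smooth (\<lambda>t. g t / c)"
  using smooth_mult[OF smooth_const[of "1 / c"] assms] by simp

definition cube_bump :: "real \<Rightarrow> real^'n::finite \<Rightarrow> real" where
  "cube_bump N = cart_prod (\<lambda>_ t. bump (t / N))"

lemma cube_bump_bounds: "0 \<le> cube_bump N x" "cube_bump N x \<le> 1"
  unfolding cube_bump_def cart_prod_def
  by (auto intro!: prod_nonneg prod_le_1 bump_nonneg bump_le_1)

lemma cube_bump_zero: "N > 0 \<Longrightarrow> \<bar>x $ i\<bar> \<ge> N \<Longrightarrow> cube_bump N x = 0"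
  unfolding cube_bump_def cart_prod_def
  by (rule prod_zero) (auto intro!: bexI[of _ i] bump_zero)

text \<open>
  The equation tested with \<open>\<chi> cnj (wave \<xi>)\<close>, where \<open>\<chi>\<close> is the cutoff. In the second derivatives of the
  test function the mixed terms contain a factor \<open>\<xi>\<close>, which is not bounded. They are rewritten as
  derivatives, in one variable \<open>(\<chi> E)'' = \<chi> E'' + 2 (\<chi>' E)' - \<chi>'' E\<close> for an exponential \<open>E\<close>, and
  integrated by parts onto \<open>u\<close>. That is where the first weak derivatives \<open>v j\<close> come in.
\<close>
lemma localized_fourier_identity:
  fixes b1 b2 :: "real \<Rightarrow> real" and u f :: "real^'n::finite \<Rightarrow> complex"
  assumes sm: "smooth b1" "smooth b2"
    and d1: "\<And>t. (bump has_vector_derivative b1 t) (at t)"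
    and d2: "\<And>t. (b1 has_vector_derivative b2 t) (at t)"
    and z: "\<And>t. \<bar>t\<bar> > 1 \<Longrightarrow> b1 t = 0" "\<And>t. \<bar>t\<bar> > 1 \<Longrightarrow> b2 t = 0"
    and u: "sobolev_H 2 u" and f: "square_integrable lebesgue f"
    and eq: "AE x in lebesgue. laplace_op u x - of_real lam * u x = f x"
    and v: "\<And>j. has_weak_partial j u (v j)" and N: "N > 0"
  defines "\<chi>1 \<equiv> \<lambda>j. cart_prod ((\<lambda>_ t. bump (t / N))(j := \<lambda>t. b1 (t / N) / N))"
    and "\<chi>2 \<equiv> \<lambda>j. cart_prod ((\<lambda>_ t. bump (t / N))(j := \<lambda>t. b2 (t / N) / N\<^sup>2))"
  shows "of_real (\<xi> \<bullet> \<xi> - lam) * fourier_coeff (\<lambda>x. of_real (cube_bump N x) * u x) \<xi>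
    = fourier_coeff (\<lambda>x. of_real (cube_bump N x) * f x
        - (\<Sum>j\<in>UNIV. 2 * (of_real (\<chi>1 j x) * v j x) + of_real (\<chi>2 j x) * u x)) \<xi>"
proof -
  define E where "E i t = cis (- \<xi> $ i * t)" for i and t :: real
  define \<beta> where "\<beta> i t = complex_of_real (bump (t / N)) * E i t" for i t
  define \<beta>1 where "\<beta>1 i t = complex_of_real (b1 (t / N) / N) * E i t" for i t
  define \<beta>2 where "\<beta>2 i t = complex_of_real (b2 (t / N) / N\<^sup>2) * E i t" for i t
  define s where "s i = \<i> * complex_of_real (- \<xi> $ i)" for i
  define \<beta>' where "\<beta>' i t = \<beta>1 i t + s i * \<beta> i t" for i t
  define \<beta>1' where "\<beta>1' i t = \<beta>2 i t + s i * \<beta>1 i t" for i t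
  define \<beta>'' where "\<beta>'' i t = \<beta>1' i t + s i * \<beta>' i t" for i t
  have db: "(\<beta> i has_vector_derivative \<beta>' i t) (at t)" for i t
    using modulated_derivative[OF d1, of N "- \<xi> $ i" t] by (simp add: \<beta>_def[abs_def] \<beta>'_def \<beta>1_def E_def s_def)
  have d2': "((\<lambda>t. b1 t / N) has_vector_derivative b2 t / N) (at t)" for t
    using d2[of t] unfolding has_real_derivative_iff_has_vector_derivative[symmetric] by (rule DERIV_cdivide)
  have db1: "(\<beta>1 i has_vector_derivative \<beta>1' i t) (at t)" for i t
    using modulated_derivative[of "\<lambda>t. b1 t / N" "\<lambda>t. b2 t / N" N "- \<xi> $ i" t] d2'
    by (simp add: \<beta>1_def[abs_def] \<beta>1'_def \<beta>2_def E_def s_def power2_eq_square)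
  have db': "(\<beta>' i has_vector_derivative \<beta>'' i t) (at t)" for i t
  proof -
    have "((\<lambda>t. \<beta>1 i t + s i * \<beta> i t) has_vector_derivative \<beta>1' i t + s i * \<beta>' i t) (at t)"
      by (rule has_vector_derivative_add[OF db1 has_vector_derivative_mult_right[OF db]])
    then show ?thesis unfolding \<beta>'_def[symmetric] \<beta>''_def[symmetric] .
  qed
  have smb: "smooth (\<beta> i)" for i
    unfolding \<beta>_def[abs_def] E_def by (rule smooth_modulated[OF smooth_bump])
  have smb1: "smooth (\<beta>1 i)" for i
    unfolding \<beta>1_def[abs_def] E_def by (rule smooth_modulated[OF smooth_scaled[OF sm(1)]])
  have smb2: "smooth (\<beta>2 i)" for i
    unfolding \<beta>2_def[abs_def] E_def by (rule smooth_modulated[OF smooth_scaled[OF sm(2)]])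
  have big: "\<bar>t / N\<bar> > 1" if "\<bar>t\<bar> > N" for t using that N by simp
  have zb: "\<beta> i t = 0" "\<beta>1 i t = 0" "\<beta>2 i t = 0" if "\<bar>t\<bar> > N" for i t
    using z(1)[OF big[OF that]] z(2)[OF big[OF that]] bump_zero[OF less_imp_le[OF big[OF that]]]
    by (simp_all only: \<beta>_def \<beta>1_def \<beta>2_def) simp_all
  define \<phi> where "\<phi> = cart_prod \<beta>"
  define \<psi> where "\<psi> j = cart_prod (\<beta>(j := \<beta>1 j))" for j
  define \<omega> where "\<omega> j = cart_prod (\<beta>(j := \<beta>2 j))" for j
  have t\<phi>: "test_function \<phi>" unfolding \<phi>_def by (rule test_function_cart_prod[of _ N]) (simp_all add: smb zb)
  have t\<psi>: "test_function (\<psi> j)" for j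
    unfolding \<psi>_def by (rule test_function_cart_prod[of _ N]) (simp_all add: smb smb1 zb)
  have t\<omega>: "test_function (\<omega> j)" for j
    unfolding \<omega>_def by (rule test_function_cart_prod[of _ N]) (simp_all add: smb smb2 zb)
  have p\<phi>: "partial_deriv j \<phi> = cart_prod (\<beta>(j := \<beta>' j))" for j
    unfolding \<phi>_def using cart_prod_partial(2)[of \<beta> \<beta>', OF db] by blast
  have pp\<phi>: "partial_deriv j (partial_deriv j \<phi>) x = cart_prod (\<beta>(j := \<beta>'' j)) x" for j x
  proof -
    have "partial_deriv j (cart_prod (\<beta>(j := \<beta>' j))) x
        = cart_prod ((\<beta>(j := \<beta>' j))(j := (\<beta>'(j := \<beta>'' j)) j)) x"
      by (rule cart_prod_partial(2)) (use db db' in auto)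
    then show ?thesis by (simp add: p\<phi>)
  qed
  have p\<psi>: "partial_deriv j (\<psi> j) x = cart_prod (\<beta>(j := \<beta>1' j)) x" for j x
  proof -
    have "partial_deriv j (cart_prod (\<beta>(j := \<beta>1 j))) x
        = cart_prod ((\<beta>(j := \<beta>1 j))(j := (\<beta>'(j := \<beta>1' j)) j)) x"
      by (rule cart_prod_partial(2)) (use db db1 in auto)
    then show ?thesis by (simp add: \<psi>_def)
  qed
  \<comment> \<open>The mixed terms, which contain \<open>s j\<close>, are part of the derivative of \<open>\<psi> j\<close>.\<close>
  have key: "partial_deriv j (partial_deriv j \<phi>) x
      = 2 * partial_deriv j (\<psi> j) x - \<omega> j x - of_real ((\<xi> $ j)\<^sup>2) * \<phi> x" for j x
  proof -
    define P where "P = (\<Prod>k\<in>UNIV - {j}. \<beta> k (x $ k))"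
    have s2: "s j * s j = - of_real ((\<xi> $ j)\<^sup>2)"
      by (simp add: s_def power2_eq_square complex_eq_iff)
    have "\<phi> x = cart_prod (\<beta>(j := \<beta> j)) x" by (simp add: \<phi>_def)
    then have \<phi>P: "\<phi> x = \<beta> j (x $ j) * P" unfolding cart_prod_upd P_def .
    have "(\<beta>2 j (x $ j) + s j * \<beta>1 j (x $ j) + s j * (\<beta>1 j (x $ j) + s j * \<beta> j (x $ j))) * P
       = 2 * ((\<beta>2 j (x $ j) + s j * \<beta>1 j (x $ j)) * P) - \<beta>2 j (x $ j) * P + (s j * s j) * (\<beta> j (x $ j) * P)"
      by (simp only: ring_distribs mult.assoc) simp
    then show ?thesis
      unfolding pp\<phi> p\<psi> \<omega>_def cart_prod_upd \<beta>''_def \<beta>'_def \<beta>1'_def \<phi>P P_def[symmetric] s2 by simp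
  qed
  have ul: "locally_integrable u"
    using u by (simp add: numeral_2_eq_2 square_integrable_imp_locally)
  have vl: "locally_integrable (v j)" for j using v by (simp add: has_weak_partial_def)
  have fl: "locally_integrable f" by (rule square_integrable_imp_locally[OF f])
  have iu: "integrable lebesgue (\<lambda>x. u x * \<theta> x)" if "test_function \<theta>" for \<theta>
    by (rule locally_integrable_mult_test[OF ul that])
  have iv: "integrable lebesgue (\<lambda>x. v j x * \<theta> x)" if "test_function \<theta>" for \<theta> j
    by (rule locally_integrable_mult_test[OF vl that])
  have ifi: "integrable lebesgue (\<lambda>x. f x * \<theta> x)" if "test_function \<theta>" for \<theta>
    by (rule locally_integrable_mult_test[OF fl that])
  have lap_term: "(LINT x|lebesgue. u x * partial_deriv j (partial_deriv j \<phi>) x)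
     = - 2 * (LINT x|lebesgue. v j x * \<psi> j x) - (LINT x|lebesgue. u x * \<omega> j x)
       - of_real ((\<xi> $ j)\<^sup>2) * (LINT x|lebesgue. u x * \<phi> x)" for j
  proof -
    have i1: "integrable lebesgue (\<lambda>x. 2 * (u x * partial_deriv j (\<psi> j) x))"
      by (intro integrable_mult_right iu test_function_partial t\<psi>)
    have i3: "integrable lebesgue (\<lambda>x. of_real ((\<xi> $ j)\<^sup>2) * (u x * \<phi> x))"
      by (intro integrable_mult_right iu t\<phi>)
    have "(LINT x|lebesgue. u x * partial_deriv j (partial_deriv j \<phi>) x)
      = (LINT x|lebesgue. 2 * (u x * partial_deriv j (\<psi> j) x) - u x * \<omega> j x - of_real ((\<xi> $ j)\<^sup>2) * (u x * \<phi> x))"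
      unfolding key by (simp add: algebra_simps)
    also have "\<dots> = 2 * (LINT x|lebesgue. u x * partial_deriv j (\<psi> j) x) - (LINT x|lebesgue. u x * \<omega> j x)
       - of_real ((\<xi> $ j)\<^sup>2) * (LINT x|lebesgue. u x * \<phi> x)"
      unfolding Bochner_Integration.integral_diff[OF Bochner_Integration.integrable_diff[OF i1 iu[OF t\<omega>]] i3]
        Bochner_Integration.integral_diff[OF i1 iu[OF t\<omega>]] integral_mult_right_zero ..
    also have "(LINT x|lebesgue. u x * partial_deriv j (\<psi> j) x) = - (LINT x|lebesgue. v j x * \<psi> j x)"
      using v[of j] t\<psi>[of j] unfolding has_weak_partial_def by blast
    finally show ?thesis by simp
  qed
  define U where "U = (LINT x|lebesgue. u x * \<phi> x)"
  define V where "V j = (LINT x|lebesgue. v j x * \<psi> j x)" for j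
  define W where "W j = (LINT x|lebesgue. u x * \<omega> j x)" for j
  define Q where "Q = (LINT x|lebesgue. f x * \<phi> x)"
  have \<xi>2: "\<xi> \<bullet> \<xi> = (\<Sum>j\<in>UNIV. (\<xi> $ j)\<^sup>2)" by (simp add: inner_vec_def power2_eq_square)
  have sum_eq: "(\<Sum>j\<in>UNIV. - 2 * V j - W j - of_real ((\<xi> $ j)\<^sup>2) * U)
      = - (\<Sum>j\<in>UNIV. 2 * V j + W j) - of_real (\<xi> \<bullet> \<xi>) * U"
    unfolding \<xi>2 of_real_sum sum_distrib_right sum_negf[symmetric] sum_subtractf[symmetric]
    by (intro sum.cong refl) simp
  have "- (\<Sum>j\<in>UNIV. - 2 * V j - W j - of_real ((\<xi> $ j)\<^sup>2) * U) - of_real lam * U = Q"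
    using weak_equation[OF u f eq t\<phi>] unfolding lap_term U_def V_def W_def Q_def .
  then have main: "of_real (\<xi> \<bullet> \<xi> - lam) * U = Q - (\<Sum>j\<in>UNIV. 2 * V j + W j)"
    unfolding sum_eq of_real_diff left_diff_distrib by (auto simp: algebra_simps)
  have cw: "cnj (wave \<xi> x) = cart_prod E x" for x
    unfolding wave_def wave_cart cart_prod_def E_def by (simp add: cis_cnj)
  have ofr: "complex_of_real (cart_prod g x) = cart_prod (\<lambda>i t. complex_of_real (g i t)) x" for g :: "'n \<Rightarrow> real \<Rightarrow> real" and x
    by (simp add: cart_prod_def)
  have \<phi>_eq: "\<phi> x = of_real (cube_bump N x) * cnj (wave \<xi> x)" for x
    unfolding cw cube_bump_def ofr cart_prod_mult[symmetric] by (simp add: \<phi>_def \<beta>_def[abs_def])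
  have \<psi>_eq: "\<psi> j x = of_real (\<chi>1 j x) * cnj (wave \<xi> x)" for j x
    unfolding cw \<chi>1_def ofr cart_prod_mult[symmetric]
    by (auto simp: \<psi>_def cart_prod_def \<beta>_def \<beta>1_def intro!: prod.cong)
  have \<omega>_eq: "\<omega> j x = of_real (\<chi>2 j x) * cnj (wave \<xi> x)" for j x
    unfolding cw \<chi>2_def ofr cart_prod_mult[symmetric]
    by (auto simp: \<omega>_def cart_prod_def \<beta>_def \<beta>2_def intro!: prod.cong)
  have "fourier_coeff (\<lambda>x. of_real (cube_bump N x) * f x
        - (\<Sum>j\<in>UNIV. 2 * (of_real (\<chi>1 j x) * v j x) + of_real (\<chi>2 j x) * u x)) \<xi>
     = (LINT x|lebesgue. f x * \<phi> x - (\<Sum>j\<in>UNIV. 2 * (v j x * \<psi> j x) + u x * \<omega> j x))"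
    unfolding fourier_coeff_def \<phi>_eq \<psi>_eq \<omega>_eq
    by (intro Bochner_Integration.integral_cong refl)
      (simp only: left_diff_distrib sum_distrib_right distrib_right, simp add: mult_ac)
  also have "\<dots> = (LINT x|lebesgue. f x * \<phi> x) - (\<Sum>j\<in>UNIV. 2 * (LINT x|lebesgue. v j x * \<psi> j x) + (LINT x|lebesgue. u x * \<omega> j x))"
  proof -
    have i: "integrable lebesgue (\<lambda>x. 2 * (v j x * \<psi> j x))" for j
      by (intro integrable_mult_right iv t\<psi>)
    have i2: "integrable lebesgue (\<lambda>x. 2 * (v j x * \<psi> j x) + u x * \<omega> j x)" for j
      by (intro Bochner_Integration.integrable_add i iu t\<omega>)
    show ?thesis
      unfolding Bochner_Integration.integral_diff[OF ifi[OF t\<phi>] Bochner_Integration.integrable_sum[OF i2]]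
        Bochner_Integration.integral_sum[OF i2] Bochner_Integration.integral_add[OF i iu[OF t\<omega>]]
        integral_mult_right_zero ..
  qed
  also have "\<dots> = of_real (\<xi> \<bullet> \<xi> - lam) * U"
    unfolding main Q_def V_def W_def ..
  also have "U = fourier_coeff (\<lambda>x. of_real (cube_bump N x) * u x) \<xi>"
    unfolding U_def fourier_coeff_def \<phi>_eq by (simp add: mult_ac)
  finally show ?thesis ..
qed

lemma norm_cart_prod_upd_le:
  assumes "\<bar>g (x $ j)\<bar> \<le> c"
  shows "\<bar>cart_prod ((\<lambda>_ t. bump (t / N))(j := g)) x\<bar> \<le> (c::real)"
proof -
  define P where "P = (\<Prod>k\<in>UNIV - {j}. bump (x $ k / N))"
  have P: "0 \<le> P" "P \<le> 1"
    unfolding P_def by (auto intro!: prod_nonneg prod_le_1 bump_nonneg bump_le_1)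
  have "\<bar>g (x $ j)\<bar> * P \<le> c * 1" using assms P by (intro mult_mono) auto
  then show ?thesis using P(1) by (simp add: cart_prod_upd abs_mult P_def)
qed

lemma continuous_imp_lebesgue_measurable:
  fixes g :: "'a::euclidean_space \<Rightarrow> 'b::topological_space"
  assumes "continuous_on UNIV g" shows "g \<in> borel_measurable lebesgue"
proof -
  have "g \<in> borel_measurable lborel" using borel_measurable_continuous_onI[OF assms] by simp
  then show ?thesis by (rule measurable_completion)
qed

text \<open>
  The error terms in the coefficients carry first or second derivatives of the cutoff, which are of
  order \<open>1 / N\<close>. The constant \<open>K\<close> depends on \<open>u\<close>, but disappears for \<open>N \<rightarrow> \<infinity>\<close>.
\<close>
lemma localized_equation:
  fixes u f :: "real^'n::finite \<Rightarrow> complex"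
  assumes u: "sobolev_H 2 u" and f: "square_integrable lebesgue f"
    and eq: "AE x in lebesgue. laplace_op u x - of_real lam * u x = f x"
  shows "\<exists>K. \<forall>N\<ge>1. \<exists>F. square_integrable lebesgue F \<and> (\<forall>x i. \<bar>x $ i\<bar> > N \<longrightarrow> F x = 0) \<and>
    (\<forall>\<xi>. of_real (\<xi> \<bullet> \<xi> - lam) * fourier_coeff (\<lambda>x. of_real (cube_bump N x) * u x) \<xi> = fourier_coeff F \<xi>) \<and>
    energy F \<le> 2 * energy f + K / N\<^sup>2"
proof -
  obtain b1 b2 :: "real \<Rightarrow> real" and B where b:
    "smooth b1" "smooth b2" "\<And>t. (bump has_vector_derivative b1 t) (at t)"
    "\<And>t. (b1 has_vector_derivative b2 t) (at t)" "\<And>t. \<bar>t\<bar> > 1 \<Longrightarrow> b1 t = 0" "\<And>t. \<bar>t\<bar> > 1 \<Longrightarrow> b2 t = 0"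
    and B: "\<And>t. \<bar>b1 t\<bar> \<le> B" "\<And>t. \<bar>b2 t\<bar> \<le> B" "B > 0"
    using bump_derivatives by metis
  have u2: "square_integrable lebesgue u" using u by (simp add: numeral_2_eq_2)
  have "\<exists>v. has_weak_partial j u v \<and> square_integrable lebesgue v" for j
    using u unfolding numeral_2_eq_2 sobolev_H.simps by blast
  then obtain v where v: "\<And>j. has_weak_partial j u (v j)" "\<And>j. square_integrable lebesgue (v j)"
    by metis
  define n where "n = real CARD('n)"
  define S where "S = (\<Sum>j\<in>UNIV. 8 * (LINT x|lebesgue. (cmod (v j x))\<^sup>2) + 2 * energy u)"
  define K where "K = 2 * n * B\<^sup>2 * S"
  have um: "u \<in> borel_measurable lebesgue" and ui: "integrable lebesgue (\<lambda>x. (cmod (u x))\<^sup>2)"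
    and fm: "f \<in> borel_measurable lebesgue" and fi: "integrable lebesgue (\<lambda>x. (cmod (f x))\<^sup>2)"
    and vm: "v j \<in> borel_measurable lebesgue" and vi: "integrable lebesgue (\<lambda>x. (cmod (v j x))\<^sup>2)" for j
    using u2 f v(2) unfolding square_integrable_def by auto
  have main: "\<exists>F. square_integrable lebesgue F \<and> (\<forall>x i. \<bar>x $ i\<bar> > N \<longrightarrow> F x = 0) \<and>
    (\<forall>\<xi>. of_real (\<xi> \<bullet> \<xi> - lam) * fourier_coeff (\<lambda>x. of_real (cube_bump N x) * u x) \<xi> = fourier_coeff F \<xi>) \<and>
    energy F \<le> 2 * energy f + K / N\<^sup>2"
    if N1: "N \<ge> 1" for N
  proof -
    have N: "N > 0" using N1 by simp
    define \<chi>1 where "\<chi>1 j = cart_prod ((\<lambda>_ t. bump (t / N))(j := \<lambda>t. b1 (t / N) / N))" for j :: 'n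
    define \<chi>2 where "\<chi>2 j = cart_prod ((\<lambda>_ t. bump (t / N))(j := \<lambda>t. b2 (t / N) / N\<^sup>2))" for j :: 'n
    define F where "F x = of_real (cube_bump N x) * f x
        - (\<Sum>j\<in>UNIV. 2 * (of_real (\<chi>1 j x) * v j x) + of_real (\<chi>2 j x) * u x)" for x
    have c1: "\<bar>\<chi>1 j x\<bar> \<le> B / N" for j x
      unfolding \<chi>1_def by (rule norm_cart_prod_upd_le) (use B N in \<open>simp add: divide_right_mono\<close>)
    have c2: "\<bar>\<chi>2 j x\<bar> \<le> B / N" for j x
      unfolding \<chi>2_def
    proof (rule norm_cart_prod_upd_le)
      have "\<bar>b2 (x $ j / N) / N\<^sup>2\<bar> \<le> B / N\<^sup>2" using B by (simp add: divide_right_mono)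
      also have "\<dots> \<le> B / N" using B(3) N1 N by (intro divide_left_mono) (auto simp: power2_eq_square)
      finally show "\<bar>b2 (x $ j / N) / N\<^sup>2\<bar> \<le> B / N" .
    qed
    have cont: "continuous_on UNIV (\<lambda>t. bump (t / N))" "continuous_on UNIV (\<lambda>t. b1 (t / N) / N)"
      "continuous_on UNIV (\<lambda>t. b2 (t / N) / N\<^sup>2)"
      using N by (auto intro!: continuous_intros continuous_on_compose2[OF smooth_continuous[OF smooth_bump]]
         continuous_on_compose2[OF smooth_continuous[OF b(1)]] continuous_on_compose2[OF smooth_continuous[OF b(2)]])
    have m: "\<chi>1 j \<in> borel_measurable lebesgue" "\<chi>2 j \<in> borel_measurable lebesgue" for j
      unfolding \<chi>1_def \<chi>2_def
      by (intro continuous_imp_lebesgue_measurable continuous_on_cart_prod, simp add: cont)+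
    have m0: "cube_bump N \<in> borel_measurable lebesgue"
      unfolding cube_bump_def
      by (intro continuous_imp_lebesgue_measurable continuous_on_cart_prod) (rule cont)
    have Fm: "F \<in> borel_measurable lebesgue"
      unfolding F_def using m m0 fm vm um by measurable
    have sq: "a\<^sup>2 * c \<le> (B / N)\<^sup>2 * c" if "\<bar>a\<bar> \<le> B / N" "c \<ge> 0" for a c :: real
      using that power_mono[OF that(1), of 2] by (intro mult_right_mono) auto
    have Fle: "(cmod (F x))\<^sup>2 \<le> 2 * (cmod (f x))\<^sup>2
       + 2 * n * (B / N)\<^sup>2 * (\<Sum>j\<in>UNIV. 8 * (cmod (v j x))\<^sup>2 + 2 * (cmod (u x))\<^sup>2)" for x
    proof -
      let ?T = "\<lambda>j. 2 * (of_real (\<chi>1 j x) * v j x) + of_real (\<chi>2 j x) * u x"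
      have "(cmod (F x))\<^sup>2 \<le> 2 * (cmod (of_real (cube_bump N x) * f x))\<^sup>2 + 2 * (cmod (\<Sum>j\<in>UNIV. ?T j))\<^sup>2"
        unfolding F_def by (rule norm_diff_squared_le)
      also have "(cmod (of_real (cube_bump N x) * f x))\<^sup>2 \<le> (cmod (f x))\<^sup>2"
        using cube_bump_bounds[of N x] by (intro power_mono) (auto simp: norm_mult mult_left_le_one_le)
      also have "(cmod (\<Sum>j\<in>UNIV. ?T j))\<^sup>2 \<le> n * (\<Sum>j\<in>UNIV. (cmod (?T j))\<^sup>2)"
        unfolding n_def by (rule norm_sum_squared_le)
      also have "(\<Sum>j\<in>UNIV. (cmod (?T j))\<^sup>2) \<le> (\<Sum>j\<in>UNIV. (B / N)\<^sup>2 * (8 * (cmod (v j x))\<^sup>2 + 2 * (cmod (u x))\<^sup>2))"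
      proof (rule sum_mono)
        fix j
        have "(cmod (?T j))\<^sup>2 \<le> 2 * (cmod (2 * (of_real (\<chi>1 j x) * v j x)))\<^sup>2 + 2 * (cmod (of_real (\<chi>2 j x) * u x))\<^sup>2"
          by (rule norm_add_squared_le)
        also have "\<dots> = (\<chi>1 j x)\<^sup>2 * (8 * (cmod (v j x))\<^sup>2) + (\<chi>2 j x)\<^sup>2 * (2 * (cmod (u x))\<^sup>2)"
          by (simp add: norm_mult power_mult_distrib)
        also have "\<dots> \<le> (B / N)\<^sup>2 * (8 * (cmod (v j x))\<^sup>2) + (B / N)\<^sup>2 * (2 * (cmod (u x))\<^sup>2)"
          by (intro add_mono sq c1 c2) auto
        finally show "(cmod (?T j))\<^sup>2 \<le> (B / N)\<^sup>2 * (8 * (cmod (v j x))\<^sup>2 + 2 * (cmod (u x))\<^sup>2)"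
          by (simp add: distrib_left)
      qed
      finally show ?thesis by (simp add: sum_distrib_left[symmetric] n_def mult.assoc)
    qed
    have int: "integrable lebesgue (\<lambda>x. 8 * (cmod (v j x))\<^sup>2 + 2 * (cmod (u x))\<^sup>2)" for j
      by (intro Bochner_Integration.integrable_add integrable_mult_right vi ui)
    have bi: "integrable lebesgue (\<lambda>x. 2 * (cmod (f x))\<^sup>2
       + 2 * n * (B / N)\<^sup>2 * (\<Sum>j\<in>UNIV. 8 * (cmod (v j x))\<^sup>2 + 2 * (cmod (u x))\<^sup>2))"
      by (intro Bochner_Integration.integrable_add integrable_mult_right Bochner_Integration.integrable_sum int fi)
    have F2: "integrable lebesgue (\<lambda>x. (cmod (F x))\<^sup>2)"
    proof (rule Bochner_Integration.integrable_bound[OF bi])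
      show "(\<lambda>x. (cmod (F x))\<^sup>2) \<in> borel_measurable lebesgue" using Fm by measurable
      show "AE x in lebesgue. norm ((cmod (F x))\<^sup>2) \<le> norm (2 * (cmod (f x))\<^sup>2
       + 2 * n * (B / N)\<^sup>2 * (\<Sum>j\<in>UNIV. 8 * (cmod (v j x))\<^sup>2 + 2 * (cmod (u x))\<^sup>2))"
        unfolding real_norm_def abs_power2 by (intro AE_I2 order_trans[OF Fle abs_ge_self])
    qed
    have Fsq: "square_integrable lebesgue F" using Fm F2 by (simp add: square_integrable_def)
    have "F x = 0" if x: "\<bar>x $ i\<bar> > N" for x i
    proof -
      have b0: "bump (x $ i / N) = 0" "b1 (x $ i / N) = 0" "b2 (x $ i / N) = 0"
        using x N by (auto intro!: bump_zero b(5,6))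
      have "\<chi>1 j x = 0" "\<chi>2 j x = 0" for j
        unfolding \<chi>1_def \<chi>2_def cart_prod_def
        using b0 by (auto intro!: prod_zero exI[of _ i])
      moreover have "cube_bump N x = 0" using cube_bump_zero[OF N] x by (metis less_imp_le)
      ultimately show ?thesis by (simp add: F_def)
    qed
    moreover have "of_real (\<xi> \<bullet> \<xi> - lam) * fourier_coeff (\<lambda>x. of_real (cube_bump N x) * u x) \<xi> = fourier_coeff F \<xi>" for \<xi>
      unfolding F_def[abs_def] \<chi>1_def \<chi>2_def
      by (rule localized_fourier_identity[OF b u f eq v(1) N])
    moreover have "energy F \<le> 2 * energy f + K / N\<^sup>2"
    proof -
      have "energy F \<le> (LINT x|lebesgue. 2 * (cmod (f x))\<^sup>2
       + 2 * n * (B / N)\<^sup>2 * (\<Sum>j\<in>UNIV. 8 * (cmod (v j x))\<^sup>2 + 2 * (cmod (u x))\<^sup>2))"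
        by (rule integral_mono[OF F2 bi Fle])
      also have "\<dots> = 2 * energy f + 2 * n * (B / N)\<^sup>2 * S"
        unfolding Bochner_Integration.integral_add[OF integrable_mult_right[OF fi]
            integrable_mult_right[OF Bochner_Integration.integrable_sum[OF int]]]
          integral_mult_right_zero Bochner_Integration.integral_sum[OF int]
          Bochner_Integration.integral_add[OF integrable_mult_right[OF vi] integrable_mult_right[OF ui]]
          S_def ..
      also have "2 * n * (B / N)\<^sup>2 * S = K / N\<^sup>2" by (simp add: K_def power_divide)
      finally show ?thesis .
    qed
    ultimately show ?thesis using Fsq by (intro exI[of _ F] conjI allI impI)
  qed
  then show ?thesis by (intro exI[of _ K] allI impI)
qed

section \<open>Decay of Fourier transforms\<close>

text \<open>
  Two integrations by parts.
\<close>
lemma fourier_integral_decay: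
  fixes g g1 g2 :: "real \<Rightarrow> real"
  assumes d: "\<And>t. (g has_vector_derivative g1 t) (at t)" "\<And>t. (g1 has_vector_derivative g2 t) (at t)"
    and c: "continuous_on UNIV g2" and s: "s > 0"
    and z: "\<And>t. \<bar>t - a\<bar> \<ge> s \<Longrightarrow> g t = 0" "\<And>t. \<bar>t - a\<bar> \<ge> s \<Longrightarrow> g1 t = 0" "\<And>t. \<bar>t - a\<bar> \<ge> s \<Longrightarrow> g2 t = 0"
    and M: "\<And>t. \<bar>g t\<bar> \<le> M" "\<And>t. \<bar>g2 t\<bar> \<le> M"
  shows "integrable lborel (\<lambda>t. complex_of_real (g t) * cis (\<zeta> * t))"
    and "cmod (LINT t|lborel. complex_of_real (g t) * cis (\<zeta> * t)) \<le> 4 * s * M / (1 + \<zeta>\<^sup>2)"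
proof -
  define I where "I = {a - s..a + s}"
  have cont: "continuous_on UNIV g" "continuous_on UNIV g1"
    using d[THEN has_vector_derivative_continuous]
    by (simp_all add: continuous_on_eq_continuous_at)
  have int: "integrable lborel (\<lambda>t. complex_of_real (h t) * cis (\<zeta> * t))"
    if h: "continuous_on UNIV h" "\<And>t. \<bar>t - a\<bar> \<ge> s \<Longrightarrow> h t = 0" for h
  proof -
    have eq: "complex_of_real (h t) * cis (\<zeta> * t) = indicator I t *\<^sub>R (complex_of_real (h t) * cis (\<zeta> * t))" for t
      using h(2)[of t] by (cases "t \<in> I") (auto simp: I_def abs_le_iff not_le)
    have "integrable lborel (\<lambda>t. indicator I t *\<^sub>R (complex_of_real (h t) * cis (\<zeta> * t)))"
      unfolding I_def
      by (intro borel_integrable_compact compact_Icc continuous_intros continuous_on_subset[OF h(1) subset_UNIV])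
    then show "integrable lborel (\<lambda>t. complex_of_real (h t) * cis (\<zeta> * t))" by (simp only: eq[symmetric])
  qed
  have parts: "(LINT t|lborel. complex_of_real (h' t) * cis (\<zeta> * t)) = - (\<i> * \<zeta>) * (LINT t|lborel. complex_of_real (h t) * cis (\<zeta> * t))"
    if h: "\<And>t. (h has_vector_derivative h' t) (at t)" "continuous_on UNIV h" "continuous_on UNIV h'"
      "\<And>t. \<bar>t - a\<bar> \<ge> s \<Longrightarrow> h t = 0" "\<And>t. \<bar>t - a\<bar> \<ge> s \<Longrightarrow> h' t = 0" for h h' :: "real \<Rightarrow> real"
  proof -
    define H where "H t = complex_of_real (h t) * cis (\<zeta> * t)" for t
    define H' where "H' t = complex_of_real (h' t) * cis (\<zeta> * t) + \<i> * \<zeta> * (complex_of_real (h t) * cis (\<zeta> * t))" for t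
    have dH: "(H has_vector_derivative H' t) (at t within A)" for t A
      using has_vector_derivative_at_within[OF modulated_derivative[OF h(1), of 1 \<zeta> t]]
      unfolding H_def[abs_def] H'_def by simp
    have "has_bochner_integral lborel (\<lambda>t. indicator {a - s..a + s} t *\<^sub>R H' t) (H (a + s) - H (a - s))"
    proof (rule has_bochner_integral_FTC_Icc)
      show "a - s \<le> a + s" using s by simp
      show "(H has_vector_derivative H' t) (at t within {a - s..a + s})" for t by (rule dH)
      show "continuous_on {a - s..a + s} H'"
        unfolding H'_def
        by (intro continuous_intros continuous_on_subset[OF h(2) subset_UNIV] continuous_on_subset[OF h(3) subset_UNIV])
    qed
    moreover have "H (a + s) = 0" "H (a - s) = 0" using s h(4) by (simp_all add: H_def)
    ultimately have "(LINT t|lborel. indicator I t *\<^sub>R H' t) = 0"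
      by (simp add: has_bochner_integral_iff I_def)
    moreover have "indicator I t *\<^sub>R H' t = H' t" for t
      using h(4,5)[of t] by (cases "t \<in> I") (auto simp: I_def abs_le_iff not_le H'_def)
    ultimately have "(LINT t|lborel. H' t) = 0" by simp
    moreover have "(LINT t|lborel. H' t) = (LINT t|lborel. complex_of_real (h' t) * cis (\<zeta> * t))
        + \<i> * \<zeta> * (LINT t|lborel. complex_of_real (h t) * cis (\<zeta> * t))"
      unfolding H'_def
      by (subst Bochner_Integration.integral_add[OF int[OF h(3,5)] integrable_mult_right[OF int[OF h(2,4)]]])
        (simp_all only: integral_mult_right_zero)
    ultimately show ?thesis by (simp add: add_eq_0_iff)
  qed
  show "integrable lborel (\<lambda>t. complex_of_real (g t) * cis (\<zeta> * t))" by (rule int[OF cont(1) z(1)])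
  define J where "J = (LINT t|lborel. complex_of_real (g t) * cis (\<zeta> * t))"
  define J2 where "J2 = (LINT t|lborel. complex_of_real (g2 t) * cis (\<zeta> * t))"
  have M0: "M \<ge> 0" using M(1)[of 0] by linarith
  have bd: "cmod (LINT t|lborel. complex_of_real (h t) * cis (\<zeta> * t)) \<le> 2 * s * M"
    if h: "continuous_on UNIV h" "\<And>t. \<bar>t - a\<bar> \<ge> s \<Longrightarrow> h t = 0" "\<And>t. \<bar>h t\<bar> \<le> M" for h
  proof -
    have "cmod (LINT t|lborel. complex_of_real (h t) * cis (\<zeta> * t)) \<le> (LINT t|lborel. indicator I t * M)"
    proof (rule Bochner_Integration.integral_norm_bound_integral[OF int[OF h(1,2)]])
      have "integrable lborel (\<lambda>t. indicator I t *\<^sub>R M)"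
        unfolding I_def by (intro borel_integrable_compact continuous_intros) auto
      then show "integrable lborel (\<lambda>t. indicator I t * M)" by simp
      show "cmod (complex_of_real (h t) * cis (\<zeta> * t)) \<le> indicator I t * M" for t
        using h(2,3)[of t] by (cases "t \<in> I") (auto simp: I_def abs_le_iff not_le norm_mult)
    qed
    also have "\<dots> = 2 * s * M" using s by (simp add: I_def)
    finally show ?thesis .
  qed
  have "J2 = - (\<i> * \<zeta>) * (- (\<i> * \<zeta>) * J)"
    unfolding J2_def J_def
    by (subst parts[OF d(2) cont(2) c z(2,3)], simp, subst parts[OF d(1) cont z(1,2)]) simp_all
  then have "cmod J2 = (\<bar>\<zeta>\<bar> * \<bar>\<zeta>\<bar>) * cmod J"
    by (simp only: norm_mult norm_minus_cancel norm_ii norm_of_real mult.assoc mult_1)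
  then have "cmod J2 = \<zeta>\<^sup>2 * cmod J" by (simp only: abs_mult_self_eq power2_eq_square)
  moreover have "cmod J2 \<le> 2 * s * M" unfolding J2_def by (rule bd[OF c z(3) M(2)])
  moreover have "cmod J \<le> 2 * s * M" unfolding J_def by (rule bd[OF cont(1) z(1) M(1)])
  ultimately have "(1 + \<zeta>\<^sup>2) * cmod J \<le> 4 * s * M" by (simp add: distrib_right)
  moreover have "1 + \<zeta>\<^sup>2 > 0" by (simp add: add_pos_nonneg)
  ultimately show "cmod (LINT t|lborel. complex_of_real (g t) * cis (\<zeta> * t)) \<le> 4 * s * M / (1 + \<zeta>\<^sup>2)"
    unfolding J_def by (simp add: pos_le_divide_eq mult.commute)
qed

lemma sum_int_inverse_square_bounded:
  "\<exists>S. \<forall>m::nat. (\<Sum>j\<in>{- int m..int m}. 1 / (1 + (real_of_int j)\<^sup>2)) \<le> S"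
proof -
  let ?h = "\<lambda>j::nat. 1 / (1 + (real j)\<^sup>2)"
  have s: "summable ?h"
  proof (rule summable_comparison_test'[of "\<lambda>n. inverse (real n ^ 2)" 1])
    show "summable (\<lambda>n. inverse (real n ^ 2))" by (rule inverse_power_summable) simp
    show "norm (?h n) \<le> inverse (real n ^ 2)" if "n \<ge> 1" for n
      using that by (auto simp: inverse_eq_divide intro!: divide_left_mono mult_pos_pos add_pos_nonneg)
  qed
  have "(\<Sum>j\<in>{- int m..int m}. 1 / (1 + (real_of_int j)\<^sup>2)) \<le> 2 * suminf ?h" for m
  proof -
    have "{- int m..int m} \<subseteq> int ` {..m} \<union> (\<lambda>j. - int j) ` {..m}"
    proof
      fix j assume "j \<in> {- int m..int m}"
      then show "j \<in> int ` {..m} \<union> (\<lambda>j. - int j) ` {..m}"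
        by (cases "j \<ge> 0") (auto intro!: image_eqI[of _ _ "nat \<bar>j\<bar>"])
    qed
    then have "(\<Sum>j\<in>{- int m..int m}. 1 / (1 + (real_of_int j)\<^sup>2))
       \<le> (\<Sum>j\<in>int ` {..m} \<union> (\<lambda>j. - int j) ` {..m}. 1 / (1 + (real_of_int j)\<^sup>2))"
      by (intro sum_mono2) auto
    also have "\<dots> \<le> (\<Sum>j\<in>int ` {..m}. 1 / (1 + (real_of_int j)\<^sup>2)) + (\<Sum>j\<in>(\<lambda>j. - int j) ` {..m}. 1 / (1 + (real_of_int j)\<^sup>2))"
      by (subst sum.union_inter[symmetric]) (auto intro!: sum_nonneg)
    also have "\<dots> = 2 * (\<Sum>j\<le>m. ?h j)"
      by (subst (1 2) sum.reindex) (auto simp: inj_on_def)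
    also have "\<dots> \<le> 2 * suminf ?h"
      using sum_le_suminf[OF s, of "{..m}"] by simp
    finally show ?thesis .
  qed
  then show ?thesis by blast
qed

lemma int_vecs_product_sum_bounded:
  fixes C :: real
  assumes "C \<ge> 0"
  shows "\<exists>S. \<forall>F. finite F \<longrightarrow> F \<subseteq> (int_vecs :: (real^'n::finite) set) \<longrightarrow> (\<Sum>k\<in>F. \<Prod>i\<in>UNIV. C / (1 + (k $ i)\<^sup>2)) \<le> S"
proof -
  obtain S where S: "\<And>m::nat. (\<Sum>j\<in>{- int m..int m}. 1 / (1 + (real_of_int j)\<^sup>2)) \<le> S"
    using sum_int_inverse_square_bounded by blast
  let ?V = "\<lambda>g :: 'n \<Rightarrow> int. (\<chi> i. real_of_int (g i)) :: real^'n"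
  have "(\<Sum>k\<in>F. \<Prod>i\<in>UNIV. C / (1 + (k $ i)\<^sup>2)) \<le> (C * S) ^ CARD('n)"
    if F: "finite F" "F \<subseteq> (int_vecs :: (real^'n) set)" for F
  proof -
    have "bounded F" using F(1) by (rule finite_imp_bounded)
    then obtain r where r: "\<And>k. k \<in> F \<Longrightarrow> norm k \<le> r" unfolding bounded_iff by auto
    obtain m :: nat where m: "r \<le> real m" using real_arch_simple by blast
    let ?G = "PiE (UNIV::'n set) (\<lambda>_. {- int m..int m})"
    have sub: "F \<subseteq> ?V ` ?G"
    proof
      fix k assume k: "k \<in> F"
      then have "\<forall>i. \<exists>z. k $ i = real_of_int z"
        using F(2) by (auto simp: int_vecs_def Ints_def)
      then obtain g where g: "\<And>i. k $ i = real_of_int (g i)" by metis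
      have "\<bar>g i\<bar> \<le> int m" for i
      proof -
        have "\<bar>real_of_int (g i)\<bar> \<le> real m"
          using component_le_norm_cart[of k i] r[OF k] m by (simp add: g)
        then show ?thesis by linarith
      qed
      then have "g \<in> ?G" by (simp add: PiE_UNIV_domain abs_le_iff minus_le_iff)
      moreover have "k = ?V g" by (simp add: vec_eq_iff g)
      ultimately show "k \<in> ?V ` ?G" by blast
    qed
    have inj: "inj_on ?V ?G" by (auto simp: inj_on_def vec_eq_iff fun_eq_iff)
    have finG: "finite ?G" by (intro finite_PiE) auto
    have "(\<Sum>k\<in>F. \<Prod>i\<in>UNIV. C / (1 + (k $ i)\<^sup>2)) \<le> (\<Sum>k\<in>?V ` ?G. \<Prod>i\<in>UNIV. C / (1 + (k $ i)\<^sup>2))"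
      using sub finG assms by (intro sum_mono2) (auto intro!: prod_nonneg divide_nonneg_nonneg)
    also have "\<dots> = (\<Sum>g\<in>?G. \<Prod>i\<in>UNIV. C / (1 + (real_of_int (g i))\<^sup>2))"
      by (subst sum.reindex[OF inj]) simp
    also have "\<dots> = (\<Prod>i\<in>(UNIV::'n set). \<Sum>j\<in>{- int m..int m}. C / (1 + (real_of_int j)\<^sup>2))"
      by (rule prod_sum_PiE[symmetric]) auto
    also have "\<dots> = (C * (\<Sum>j\<in>{- int m..int m}. 1 / (1 + (real_of_int j)\<^sup>2))) ^ CARD('n)"
      by (simp add: sum_distrib_left)
    also have "\<dots> \<le> (C * S) ^ CARD('n)"
      using S[of m] assms by (intro power_mono mult_left_mono mult_nonneg_nonneg sum_nonneg) auto
    finally show ?thesis .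
  qed
  then show ?thesis by blast
qed

text \<open>
  A finite set whose sum almost attains the supremum leaves little for every finite set disjoint from
  it.
\<close>
lemma bounded_sums_tail:
  fixes h :: "'a::real_normed_vector \<Rightarrow> real"
  assumes S: "\<And>F. finite F \<Longrightarrow> F \<subseteq> Z \<Longrightarrow> sum h F \<le> S" and h: "\<And>k. h k \<ge> 0" and \<epsilon>: "\<epsilon> > 0"
  shows "\<exists>R. \<forall>F. finite F \<longrightarrow> F \<subseteq> Z \<longrightarrow> (\<forall>k\<in>F. norm k > R) \<longrightarrow> sum h F \<le> \<epsilon>"
proof -
  define \<S> where "\<S> = {sum h F | F. finite F \<and> F \<subseteq> Z}"
  have bdd: "bdd_above \<S>" using S by (auto simp: \<S>_def bdd_above_def)
  have "sum h {} \<in> \<S>" unfolding \<S>_def by blast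
  then have "\<S> \<noteq> {}" by blast
  then obtain y where "y \<in> \<S>" "Sup \<S> - \<epsilon> < y" using less_cSupD[of \<S> "Sup \<S> - \<epsilon>"] \<epsilon> by auto
  then obtain F0 where F0: "finite F0" "F0 \<subseteq> Z" "Sup \<S> - \<epsilon> < sum h F0" by (auto simp: \<S>_def)
  obtain R where R: "\<And>k. k \<in> F0 \<Longrightarrow> norm k \<le> R"
    using finite_imp_bounded[OF F0(1)] unfolding bounded_iff by auto
  have "sum h F \<le> \<epsilon>" if F: "finite F" "F \<subseteq> Z" "\<forall>k\<in>F. norm k > R" for F
  proof -
    have "F \<inter> F0 = {}" using F(3) R by (auto simp: not_le[symmetric])
    then have "sum h F + sum h F0 = sum h (F \<union> F0)" using F(1) F0(1) by (simp add: sum.union_disjoint)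
    moreover have "sum h (F \<union> F0) \<le> Sup \<S>"
    proof (rule cSup_upper[OF _ bdd])
      show "sum h (F \<union> F0) \<in> \<S>" unfolding \<S>_def using F F0 by blast
    qed
    ultimately show ?thesis using F0(3) by linarith
  qed
  then show ?thesis by blast
qed

section \<open>Observability of functions with spectrum in a shell\<close>

text \<open>
  A smooth bump on the cube with centre \<open>a\<close> and half-side \<open>s\<close>.
\<close>
definition cube_window :: "real^'n::finite \<Rightarrow> real \<Rightarrow> real^'n \<Rightarrow> real" where
  "cube_window a s = cart_prod (\<lambda>i t. bump ((t - a $ i) / s))"

lemma cube_window_bounds: "0 \<le> cube_window a s x" "cube_window a s x \<le> 1"
  unfolding cube_window_def cart_prod_def
  by (auto intro!: prod_nonneg prod_le_1 bump_nonneg bump_le_1)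

lemma cube_window_nonzero: "s > 0 \<Longrightarrow> cube_window a s x \<noteq> 0 \<Longrightarrow> \<bar>x $ i - a $ i\<bar> < s"
proof (rule ccontr)
  assume s: "s > 0" and nz: "cube_window a s x \<noteq> 0" and "\<not> \<bar>x $ i - a $ i\<bar> < s"
  then have "bump ((x $ i - a $ i) / s) = 0" by (intro bump_zero) (simp add: le_divide_eq)
  then have "cube_window a s x = 0" unfolding cube_window_def cart_prod_def
    by (intro prod_zero) auto
  then show False using nz by simp
qed

lemma continuous_on_cube_window: "s > 0 \<Longrightarrow> continuous_on UNIV (cube_window a s)"
  unfolding cube_window_def
  by (intro continuous_on_cart_prod continuous_on_compose2[OF smooth_continuous[OF smooth_bump]] continuous_intros) auto

lemma cube_window_lower_bound:
  assumes "s > 0"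
  shows "\<exists>\<beta>>0. \<forall>x\<in>ball a (s / 2). \<beta> \<le> cube_window a s x"
proof -
  have "\<exists>t\<in>{-(1/2)..1/2::real}. \<forall>r\<in>{-(1/2)..1/2}. bump t \<le> bump r"
    by (intro continuous_attains_inf continuous_on_subset[OF smooth_continuous[OF smooth_bump] subset_UNIV]) auto
  then obtain t where t: "t \<in> {-(1/2)..1/2::real}" "\<And>r. r \<in> {-(1/2)..1/2} \<Longrightarrow> bump t \<le> bump r" by blast
  have "\<bar>t\<bar> < 1" using t(1) by (auto simp: abs_less_iff)
  then have t0: "bump t > 0" by (rule bump_pos)
  have "bump t ^ CARD('n) \<le> cube_window a s x" if x: "x \<in> ball a (s / 2)" for x and a :: "real^'n"
  proof -
    have "bump t \<le> bump ((x $ i - a $ i) / s)" for i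
    proof (rule t(2))
      have "\<bar>(x - a) $ i\<bar> \<le> norm (x - a)" by (rule component_le_norm_cart)
      also have "\<dots> < s / 2" using x by (simp add: dist_norm norm_minus_commute)
      finally have "\<bar>(x $ i - a $ i) / s\<bar> \<le> 1 / 2" using assms by (simp add: divide_le_eq)
      then show "(x $ i - a $ i) / s \<in> {-(1/2)..1/2}" unfolding abs_le_iff atLeastAtMost_iff by linarith
    qed
    then have "(\<Prod>i\<in>(UNIV::'n set). bump t) \<le> cube_window a s x"
      unfolding cube_window_def cart_prod_def using t0 by (intro prod_mono) auto
    then show ?thesis by simp
  qed
  then show ?thesis using t0 by (intro exI[of _ "bump t ^ CARD('n)"]) auto
qed

text \<open>
  The interaction of two frequencies with difference \<open>\<zeta>\<close>, see \<open>window_quadratic_form\<close>.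
\<close>
definition window_transform :: "real^'n::finite \<Rightarrow> real \<Rightarrow> real^'n \<Rightarrow> complex" where
  "window_transform a s \<zeta> = (LINT x|lebesgue. of_real (cube_window a s x) * wave \<zeta> x)"

text \<open>
  The one-dimensional decay of order 2 in each coordinate makes the transform summable over the integer
  vectors.
\<close>
lemma window_transform_decay:
  fixes a \<zeta> :: "real^'n::finite"
  assumes s: "s > 0"
  shows "\<exists>C\<ge>0. \<forall>(a::real^'n) \<zeta>. cmod (window_transform a s \<zeta>) \<le> (\<Prod>i\<in>UNIV. C / (1 + (\<zeta> $ i)\<^sup>2))"
    and "integrable lebesgue (\<lambda>x. of_real (cube_window a s x) * wave \<zeta> x)"
proof -
  obtain b1 b2 :: "real \<Rightarrow> real" and B where b:
    "smooth b1" "smooth b2" "\<And>t. (bump has_vector_derivative b1 t) (at t)"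
    "\<And>t. (b1 has_vector_derivative b2 t) (at t)" "\<And>t. \<bar>t\<bar> > 1 \<Longrightarrow> b1 t = 0" "\<And>t. \<bar>t\<bar> > 1 \<Longrightarrow> b2 t = 0"
    and B: "\<And>t. \<bar>b1 t\<bar> \<le> B" "\<And>t. \<bar>b2 t\<bar> \<le> B" "B > 0"
    using bump_derivatives by metis
  define M where "M = max 1 (B / s\<^sup>2)"
  have M: "B / s\<^sup>2 \<le> M" "1 \<le> M" by (simp_all add: M_def)
  have chain: "((\<lambda>t. h ((t - c) / s)) has_vector_derivative h' ((t - c) / s) / s) (at t)"
    if "\<And>t. (h has_vector_derivative h' t) (at t)" for h h' :: "real \<Rightarrow> real" and c t
  proof -
    have "((\<lambda>t. (t - c) / s) has_vector_derivative 1 / s) (at t)"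
      unfolding has_real_derivative_iff_has_vector_derivative[symmetric]
      by (rule DERIV_cdivide) (auto intro!: derivative_eq_intros)
    from vector_diff_chain_at[OF this that] show ?thesis by (simp add: o_def)
  qed
  have one: "integrable lborel (\<lambda>t. complex_of_real (bump ((t - c) / s)) * cis (z * t))"
    "cmod (LINT t|lborel. complex_of_real (bump ((t - c) / s)) * cis (z * t)) \<le> 4 * (2 * s) * M / (1 + z\<^sup>2)" for c z
  proof -
    define g where "g t = bump ((t - c) / s)" for t
    define g1 where "g1 t = b1 ((t - c) / s) / s" for t
    define g2 where "g2 t = b2 ((t - c) / s) / s / s" for t
    have dg: "(g has_vector_derivative g1 t) (at t)" for t
      unfolding g_def[abs_def] g1_def by (rule chain[OF b(3)])
    have dg1: "(g1 has_vector_derivative g2 t) (at t)" for t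
      using chain[OF b(4), of c t] unfolding g1_def[abs_def] g2_def has_real_derivative_iff_has_vector_derivative[symmetric]
      by (rule DERIV_cdivide)
    have cg2: "continuous_on UNIV g2"
      unfolding g2_def
      by (intro continuous_intros continuous_on_compose2[OF smooth_continuous[OF b(2)]]) (use s in auto)
    have far: "\<bar>(t - c) / s\<bar> > 1" if "\<bar>t - c\<bar> \<ge> 2 * s" for t
      using that s by (simp add: less_divide_eq)
    have z0: "g t = 0" "g1 t = 0" "g2 t = 0" if "\<bar>t - c\<bar> \<ge> 2 * s" for t
      using bump_zero[OF less_imp_le[OF far[OF that]]] b(5)[OF far[OF that]] b(6)[OF far[OF that]]
      by (simp_all add: g_def g1_def g2_def)
    have gM: "\<bar>g t\<bar> \<le> M" for t
      unfolding g_def using bump_nonneg[of "(t - c) / s"] bump_le_1[of "(t - c) / s"] M(2) by linarith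
    have g2M: "\<bar>g2 t\<bar> \<le> M" for t
    proof -
      have "\<bar>g2 t\<bar> = \<bar>b2 ((t - c) / s)\<bar> / s\<^sup>2" using s by (simp add: g2_def power2_eq_square)
      also have "\<dots> \<le> B / s\<^sup>2" using B by (intro divide_right_mono) auto
      finally show ?thesis using M(1) by linarith
    qed
    \<comment> \<open>The interval of half-length \<open>2 * s\<close> is used since the derivatives are known to vanish only
      where \<open>\<bar>t - c\<bar> > s\<close>.\<close>
    have s2: "2 * s > 0" using s by simp
    show "integrable lborel (\<lambda>t. complex_of_real (bump ((t - c) / s)) * cis (z * t))"
      "cmod (LINT t|lborel. complex_of_real (bump ((t - c) / s)) * cis (z * t)) \<le> 4 * (2 * s) * M / (1 + z\<^sup>2)"
      using fourier_integral_decay[of g g1 g2 "2 * s" c M z, OF dg dg1 cg2 s2 z0 gM g2M]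
      unfolding g_def by blast+
  qed
  define \<beta> where "\<beta> a \<zeta> i t = complex_of_real (bump ((t - a $ i) / s)) * cis (\<zeta> $ i * t)" for a \<zeta> :: "real^'n" and i t
  have eq: "of_real (cube_window a s x) * wave \<zeta> x = cart_prod (\<beta> a \<zeta>) x" for a \<zeta> x
    unfolding wave_def wave_cart cube_window_def cart_prod_def \<beta>_def by (simp add: prod.distrib)
  have int: "integrable lborel (\<beta> a \<zeta> i)" for a \<zeta> i unfolding \<beta>_def by (rule one)
  show "integrable lebesgue (\<lambda>x. of_real (cube_window a s x) * wave \<zeta> x)"
    unfolding eq using integral_cart_prod(1)[of "\<beta> a \<zeta>", OF int]
    by (simp add: integrable_completion[OF borel_measurable_integrable])
  have "cmod (window_transform a s \<zeta>) \<le> (\<Prod>i\<in>UNIV. 4 * (2 * s) * M / (1 + (\<zeta> $ i)\<^sup>2))" for a \<zeta> :: "real^'n"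
  proof -
    have "window_transform a s \<zeta> = (LINT x|lborel. cart_prod (\<beta> a \<zeta>) x)"
      unfolding window_transform_def eq
      by (rule integral_completion[OF borel_measurable_integrable[OF integral_cart_prod(1)[of "\<beta> a \<zeta>", OF int]]])
    also have "\<dots> = (\<Prod>i\<in>UNIV. (LINT t|lborel. \<beta> a \<zeta> i t))"
      by (rule integral_cart_prod(2)[of "\<beta> a \<zeta>", OF int])
    finally have "cmod (window_transform a s \<zeta>) = (\<Prod>i\<in>UNIV. cmod (LINT t|lborel. \<beta> a \<zeta> i t))"
      by (simp add: prod_norm)
    also have "\<dots> \<le> (\<Prod>i\<in>UNIV. 4 * (2 * s) * M / (1 + (\<zeta> $ i)\<^sup>2))"
      unfolding \<beta>_def by (intro prod_mono conjI one norm_ge_zero)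
    finally show ?thesis .
  qed
  then show "\<exists>C\<ge>0. \<forall>(a::real^'n) \<zeta>. cmod (window_transform a s \<zeta>) \<le> (\<Prod>i\<in>UNIV. C / (1 + (\<zeta> $ i)\<^sup>2))"
    using s M(2) by (intro exI[of _ "4 * (2 * s) * M"]) auto
qed

lemma window_transform_minus: "window_transform a s (- \<zeta>) = cnj (window_transform a s \<zeta>)"
  unfolding window_transform_def Bochner_Integration.integral_cnj[symmetric]
  by (intro Bochner_Integration.integral_cong refl) (simp add: cnj_wave)

lemma window_transform_tail:
  fixes a :: "real^'n::finite"
  assumes s: "s > 0" and \<epsilon>: "\<epsilon> > 0"
  shows "\<exists>R. \<forall>F. finite F \<longrightarrow> F \<subseteq> int_vecs \<longrightarrow> (\<forall>k\<in>F. norm k > R) \<longrightarrow> (\<Sum>k\<in>F. cmod (window_transform a s k)) \<le> \<epsilon>"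
proof -
  obtain C where C: "C \<ge> 0" "\<And>\<zeta>. cmod (window_transform a s \<zeta>) \<le> (\<Prod>i\<in>UNIV. C / (1 + (\<zeta> $ i)\<^sup>2))"
    using window_transform_decay(1)[OF s, where 'n='n] by blast
  obtain S where S: "\<And>F. finite F \<Longrightarrow> F \<subseteq> (int_vecs :: (real^'n) set) \<Longrightarrow> (\<Sum>k\<in>F. \<Prod>i\<in>UNIV. C / (1 + (k $ i)\<^sup>2)) \<le> S"
    using int_vecs_product_sum_bounded[OF C(1), where 'n='n] by blast
  show ?thesis
  proof (rule bounded_sums_tail[OF _ _ \<epsilon>, of int_vecs "\<lambda>k. cmod (window_transform a s k)" S])
    show "(\<Sum>k\<in>F. cmod (window_transform a s k)) \<le> S" if "finite F" "F \<subseteq> int_vecs" for F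
      by (rule order_trans[OF sum_mono[OF C(2)] S[OF that]])
  qed simp
qed

lemma window_quadratic_form:
  fixes F :: "(real^'n::finite) set"
  assumes s: "s > 0"
  shows "integrable lebesgue (\<lambda>x. cube_window a s x * (cmod (\<Sum>\<xi>\<in>F. c \<xi> * wave \<xi> x))\<^sup>2)"
    and "complex_of_real (LINT x|lebesgue. cube_window a s x * (cmod (\<Sum>\<xi>\<in>F. c \<xi> * wave \<xi> x))\<^sup>2)
      = (\<Sum>\<xi>\<in>F. \<Sum>\<eta>\<in>F. c \<xi> * cnj (c \<eta>) * window_transform a s (\<xi> - \<eta>))"
proof -
  have eq: "complex_of_real (cube_window a s x * (cmod (\<Sum>\<xi>\<in>F. c \<xi> * wave \<xi> x))\<^sup>2)
     = (\<Sum>\<xi>\<in>F. \<Sum>\<eta>\<in>F. (c \<xi> * cnj (c \<eta>)) * (of_real (cube_window a s x) * wave (\<xi> - \<eta>) x))" for x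
    unfolding of_real_mult norm_wave_sum_squared sum_distrib_left by (intro sum.cong refl) (simp add: mult_ac)
  have i1: "integrable lebesgue (\<lambda>x. (c \<xi> * cnj (c \<eta>)) * (of_real (cube_window a s x) * wave (\<xi> - \<eta>) x))" for \<xi> \<eta>
    by (intro integrable_mult_right window_transform_decay(2)[OF s])
  have i2: "integrable lebesgue (\<lambda>x. \<Sum>\<eta>\<in>F. (c \<xi> * cnj (c \<eta>)) * (of_real (cube_window a s x) * wave (\<xi> - \<eta>) x))" for \<xi>
    by (intro Bochner_Integration.integrable_sum i1)
  have "integrable lebesgue (\<lambda>x. complex_of_real (cube_window a s x * (cmod (\<Sum>\<xi>\<in>F. c \<xi> * wave \<xi> x))\<^sup>2))"
    unfolding eq by (intro Bochner_Integration.integrable_sum i2)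
  then show "integrable lebesgue (\<lambda>x. cube_window a s x * (cmod (\<Sum>\<xi>\<in>F. c \<xi> * wave \<xi> x))\<^sup>2)"
    by (simp only: complex_of_real_integrable_eq)
  have "complex_of_real (LINT x|lebesgue. cube_window a s x * (cmod (\<Sum>\<xi>\<in>F. c \<xi> * wave \<xi> x))\<^sup>2)
    = (LINT x|lebesgue. complex_of_real (cube_window a s x * (cmod (\<Sum>\<xi>\<in>F. c \<xi> * wave \<xi> x))\<^sup>2))"
    by (rule integral_complex_of_real[symmetric])
  also have "\<dots> = (\<Sum>\<xi>\<in>F. \<Sum>\<eta>\<in>F. c \<xi> * cnj (c \<eta>) * window_transform a s (\<xi> - \<eta>))"
    unfolding eq Bochner_Integration.integral_sum[OF i2] Bochner_Integration.integral_sum[OF i1]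
      integral_mult_right_zero window_transform_def ..
  finally show "complex_of_real (LINT x|lebesgue. cube_window a s x * (cmod (\<Sum>\<xi>\<in>F. c \<xi> * wave \<xi> x))\<^sup>2)
      = (\<Sum>\<xi>\<in>F. \<Sum>\<eta>\<in>F. c \<xi> * cnj (c \<eta>) * window_transform a s (\<xi> - \<eta>))" .
qed

text \<open>
  All differences inside the cluster belong to the finite set of integer vectors of norm at most \<open>d\<close>.
  A modulation by one of its frequencies, which does not change \<open>\<bar>v\<bar>\<close>, moves the cluster into this
  finite set, so that one constant is valid for all clusters.
\<close>
lemma cluster_lower_bound:
  assumes s: "s > 0"
  shows "\<exists>\<kappa>>0. \<forall>C c. (\<forall>\<xi>\<in>C. \<forall>\<eta>\<in>C. \<eta> - \<xi> \<in> int_vecs \<inter> cball 0 d) \<longrightarrow>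
    \<kappa> * (\<Sum>\<xi>\<in>C. (cmod (c \<xi>))\<^sup>2) \<le> (LINT x|lebesgue. cube_window (a::real^'n::finite) s x * (cmod (\<Sum>\<xi>\<in>C. c \<xi> * wave \<xi> x))\<^sup>2)"
proof -
  define K where "K = int_vecs \<inter> cball (0::real^'n) d"
  have K: "finite K" unfolding K_def by (rule finite_int_vecs_cball)
  obtain \<kappa> where \<kappa>: "\<kappa> > 0"
    and low: "\<And>c. \<kappa> * (\<Sum>k\<in>K. (cmod (c k))\<^sup>2) \<le> (LINT x:ball a (s/2)|lebesgue. (cmod (\<Sum>k\<in>K. c k * wave k x))\<^sup>2)"
    using exponential_sum_lower_bound[OF K, of "s / 2" a] s by auto
  obtain \<beta> where \<beta>: "\<beta> > 0" "\<And>x. x \<in> ball a (s/2) \<Longrightarrow> \<beta> \<le> cube_window a s x"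
    using cube_window_lower_bound[OF s, of a] by blast
  have "\<beta> * \<kappa> * (\<Sum>\<xi>\<in>C. (cmod (c \<xi>))\<^sup>2) \<le> (LINT x|lebesgue. cube_window a s x * (cmod (\<Sum>\<xi>\<in>C. c \<xi> * wave \<xi> x))\<^sup>2)"
    if C: "\<forall>\<xi>\<in>C. \<forall>\<eta>\<in>C. \<eta> - \<xi> \<in> int_vecs \<inter> cball 0 d" for C c
  proof (cases "C = {}")
    case False
    then obtain \<xi>0 where \<xi>0: "\<xi>0 \<in> C" by blast
    define e where "e k = (if \<xi>0 + k \<in> C then c (\<xi>0 + k) else 0)" for k
    have sumK: "(\<Sum>\<xi>\<in>C. h \<xi>) = (\<Sum>k\<in>K. if \<xi>0 + k \<in> C then h (\<xi>0 + k) else 0)" for h :: "real^'n \<Rightarrow> 'z::comm_monoid_add"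
    proof -
      have "(\<Sum>k\<in>K. if \<xi>0 + k \<in> C then h (\<xi>0 + k) else 0) = (\<Sum>k\<in>{k\<in>K. \<xi>0 + k \<in> C}. h (\<xi>0 + k))"
        by (rule sum.inter_filter[OF K, symmetric])
      also have "\<dots> = (\<Sum>\<xi>\<in>C. h \<xi>)"
        by (rule sum.reindex_bij_witness[of _ "\<lambda>\<xi>. \<xi> - \<xi>0" "\<lambda>k. \<xi>0 + k"])
          (use C \<xi>0 in \<open>auto simp: K_def\<close>)
      finally show ?thesis ..
    qed
    have "(\<Sum>\<xi>\<in>C. (cmod (c \<xi>))\<^sup>2) = (\<Sum>k\<in>K. (cmod (e k))\<^sup>2)"
      unfolding sumK e_def by (intro sum.cong refl) simp
    moreover have "cmod (\<Sum>\<xi>\<in>C. c \<xi> * wave \<xi> x) = cmod (\<Sum>k\<in>K. e k * wave k x)" for x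
    proof -
      have "(\<Sum>\<xi>\<in>C. c \<xi> * wave \<xi> x) = wave \<xi>0 x * (\<Sum>k\<in>K. e k * wave k x)"
        unfolding sumK e_def sum_distrib_left by (intro sum.cong refl) (simp add: wave_add_freq mult_ac)
      then show ?thesis by (simp add: norm_mult)
    qed
    moreover have "\<beta> * (\<kappa> * (\<Sum>k\<in>K. (cmod (e k))\<^sup>2)) \<le> (LINT x|lebesgue. cube_window a s x * (cmod (\<Sum>k\<in>K. e k * wave k x))\<^sup>2)"
    proof -
      have int: "set_integrable lebesgue (ball a (s/2)) (\<lambda>x. (cmod (\<Sum>k\<in>K. e k * wave k x))\<^sup>2)"
        by (intro set_integrable_continuous_bounded continuous_intros) auto
      have "\<beta> * (\<kappa> * (\<Sum>k\<in>K. (cmod (e k))\<^sup>2)) \<le> \<beta> * (LINT x:ball a (s/2)|lebesgue. (cmod (\<Sum>k\<in>K. e k * wave k x))\<^sup>2)"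
        using low \<beta>(1) by (intro mult_left_mono) auto
      also have "\<dots> = (LINT x|lebesgue. \<beta> * (indicator (ball a (s/2)) x *\<^sub>R (cmod (\<Sum>k\<in>K. e k * wave k x))\<^sup>2))"
        unfolding set_lebesgue_integral_def by simp
      also have "\<dots> \<le> (LINT x|lebesgue. cube_window a s x * (cmod (\<Sum>k\<in>K. e k * wave k x))\<^sup>2)"
      proof (rule integral_mono)
        show "integrable lebesgue (\<lambda>x. \<beta> * (indicator (ball a (s/2)) x *\<^sub>R (cmod (\<Sum>k\<in>K. e k * wave k x))\<^sup>2))"
          using int unfolding set_integrable_def by (rule integrable_mult_right)
        show "integrable lebesgue (\<lambda>x. cube_window a s x * (cmod (\<Sum>k\<in>K. e k * wave k x))\<^sup>2)"
          by (rule window_quadratic_form(1)[OF s])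
        show "\<beta> * (indicator (ball a (s/2)) x *\<^sub>R (cmod (\<Sum>k\<in>K. e k * wave k x))\<^sup>2) \<le> cube_window a s x * (cmod (\<Sum>k\<in>K. e k * wave k x))\<^sup>2" for x
          using \<beta>(2)[of x] cube_window_bounds(1)[of a s x]
          by (cases "x \<in> ball a (s/2)") (auto intro: mult_right_mono)
      qed
      finally show ?thesis .
    qed
    ultimately show ?thesis by (simp add: mult.assoc)
  qed simp
  then show ?thesis using \<beta>(1) \<kappa> by (intro exI[of _ "\<beta> * \<kappa>"]) auto
qed

text \<open>
  First \<open>k d\<close> is chosen as half the lower bound for clusters of diameter \<open>d\<close>, then \<open>R d\<close> so large that the
  interactions beyond this distance sum to at most \<open>k d\<close>, and \<open>shell_partition\<close> is applied with this
  \<open>R\<close>. Interactions are present only between frequencies with integer difference.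
\<close>
lemma shell_lower_bound:
  fixes a :: "real^'n::finite"
  assumes s: "s > 0"
  shows "\<exists>\<kappa>>0. \<forall>lam \<Lambda> c. finite \<Lambda> \<longrightarrow> (\<forall>\<xi>\<in>\<Lambda>. in_shell lam \<xi>) \<longrightarrow>
    \<kappa> * (\<Sum>\<xi>\<in>\<Lambda>. (cmod (c \<xi>))\<^sup>2) \<le> Re (\<Sum>\<xi>\<in>\<Lambda>. \<Sum>\<eta>\<in>\<Lambda>. c \<xi> * cnj (c \<eta>) *
      (if \<xi> - \<eta> \<in> int_vecs then window_transform a s (\<xi> - \<eta>) else 0))"
proof -
  define low where "low d k \<longleftrightarrow> k > 0 \<and> (\<forall>C c. (\<forall>\<xi>\<in>C. \<forall>\<eta>\<in>C. \<eta> - \<xi> \<in> int_vecs \<inter> cball 0 d) \<longrightarrow>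
    2 * k * (\<Sum>\<xi>\<in>C. (cmod (c \<xi>))\<^sup>2) \<le> (LINT x|lebesgue. cube_window a s x * (cmod (\<Sum>\<xi>\<in>C. c \<xi> * wave \<xi> x))\<^sup>2))" for d k
  have "\<exists>k. low d k" for d
  proof -
    obtain \<kappa> where \<kappa>: "\<kappa> > 0 \<and> (\<forall>C c. (\<forall>\<xi>\<in>C. \<forall>\<eta>\<in>C. \<eta> - \<xi> \<in> int_vecs \<inter> cball 0 d) \<longrightarrow>
    \<kappa> * (\<Sum>\<xi>\<in>C. (cmod (c \<xi>))\<^sup>2) \<le> (LINT x|lebesgue. cube_window a s x * (cmod (\<Sum>\<xi>\<in>C. c \<xi> * wave \<xi> x))\<^sup>2))"
      using cluster_lower_bound[OF s, of d a] by (rule exE)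
    have eq: "2 * (\<kappa> / 2) = \<kappa>" by simp
    show ?thesis using \<kappa> unfolding low_def by (intro exI[of _ "\<kappa> / 2"]) (simp only: eq, simp)
  qed
  then obtain k where "\<And>d. low d (k d)" by metis
  then have k: "\<And>d. k d > 0"
    and k_low: "\<And>d C c. (\<forall>\<xi>\<in>C. \<forall>\<eta>\<in>C. \<eta> - \<xi> \<in> int_vecs \<inter> cball 0 d) \<Longrightarrow>
    2 * k d * (\<Sum>\<xi>\<in>C. (cmod (c \<xi>))\<^sup>2) \<le> (LINT x|lebesgue. cube_window a s x * (cmod (\<Sum>\<xi>\<in>C. c \<xi> * wave \<xi> x))\<^sup>2)"
    unfolding low_def by blast+
  define tail where "tail d R \<longleftrightarrow> R \<ge> d \<and> (\<forall>F. finite F \<longrightarrow> F \<subseteq> int_vecs \<longrightarrow> (\<forall>k\<in>F. norm k > R) \<longrightarrow>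
    (\<Sum>k\<in>F. cmod (window_transform a s k)) \<le> k d)" for d R
  have "\<exists>R. tail d R" for d
  proof -
    obtain R where R: "\<And>F. finite F \<Longrightarrow> F \<subseteq> int_vecs \<Longrightarrow> (\<forall>k\<in>F. norm k > R) \<Longrightarrow> (\<Sum>k\<in>F. cmod (window_transform a s k)) \<le> k d"
      using window_transform_tail[OF s k] by blast
    show ?thesis unfolding tail_def by (intro exI[of _ "max R d"] conjI allI impI R) auto
  qed
  then obtain R where "\<And>d. tail d (R d)" by metis
  then have R_ge: "\<And>d. R d \<ge> d"
    and R: "\<And>d F. finite F \<Longrightarrow> F \<subseteq> int_vecs \<Longrightarrow> (\<forall>k\<in>F. norm k > R d) \<Longrightarrow> (\<Sum>k\<in>F. cmod (window_transform a s k)) \<le> k d"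
    unfolding tail_def by blast+
  obtain \<D> where part: "finite \<D> \<and> \<D> \<noteq> {} \<and> (\<forall>lam \<Lambda>. finite \<Lambda> \<longrightarrow> (\<forall>\<eta>\<in>\<Lambda>. in_shell lam (\<eta>::real^'n)) \<longrightarrow>
     (\<exists>P. \<Union>P = \<Lambda> \<and> disjoint P \<and> (\<forall>C\<in>P. \<exists>d\<in>\<D>. (\<forall>\<xi>\<in>C. \<forall>\<eta>\<in>C. \<eta> - \<xi> \<in> int_vecs \<inter> cball 0 d) \<and>
       (\<forall>\<xi>\<in>C. \<forall>\<zeta>\<in>\<Lambda> - C. \<zeta> - \<xi> \<in> int_vecs \<longrightarrow> norm (\<zeta> - \<xi>) > R d))))"
    using shell_partition[of R, OF R_ge, where 'n='n] by (rule exE)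
  define \<kappa> where "\<kappa> = Min (k ` \<D>)"
  have \<kappa>: "\<kappa> > 0" "\<And>d. d \<in> \<D> \<Longrightarrow> \<kappa> \<le> k d" using part k by (auto simp: \<kappa>_def)
  define A where "A \<zeta> = (if \<zeta> \<in> int_vecs then window_transform a s \<zeta> else 0)" for \<zeta>
  have "\<kappa> * (\<Sum>\<xi>\<in>\<Lambda>. (cmod (c \<xi>))\<^sup>2) \<le> Re (\<Sum>\<xi>\<in>\<Lambda>. \<Sum>\<eta>\<in>\<Lambda>. c \<xi> * cnj (c \<eta>) * A (\<xi> - \<eta>))"
    if fin: "finite \<Lambda>" and shell: "\<forall>\<xi>\<in>\<Lambda>. in_shell lam \<xi>" for lam \<Lambda> c
  proof -
    define ok where "ok C d \<longleftrightarrow> d \<in> \<D> \<and> (\<forall>\<xi>\<in>C. \<forall>\<eta>\<in>C. \<eta> - \<xi> \<in> int_vecs \<inter> cball 0 d) \<and>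
       (\<forall>\<xi>\<in>C. \<forall>\<zeta>\<in>\<Lambda> - C. \<zeta> - \<xi> \<in> int_vecs \<longrightarrow> norm (\<zeta> - \<xi>) > R d)" for C d
    have "\<exists>P. \<Union>P = \<Lambda> \<and> disjoint P \<and> (\<forall>C\<in>P. \<exists>d. ok C d)"
      using part[THEN conjunct2, THEN conjunct2, rule_format, OF fin, of lam] shell
      unfolding ok_def Bex_def by simp
    then obtain P where P: "\<Union>P = \<Lambda>" "disjoint P" and "\<forall>C\<in>P. \<exists>d. ok C d" by blast
    then obtain d where "\<And>C. C \<in> P \<Longrightarrow> ok C (d C)" by metis
    then have dD: "\<And>C. C \<in> P \<Longrightarrow> d C \<in> \<D>"
      and near: "\<And>C. C \<in> P \<Longrightarrow> \<forall>\<xi>\<in>C. \<forall>\<eta>\<in>C. \<eta> - \<xi> \<in> int_vecs \<inter> cball 0 (d C)"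
      and far: "\<And>C \<xi> \<zeta>. C \<in> P \<Longrightarrow> \<xi> \<in> C \<Longrightarrow> \<zeta> \<in> \<Lambda> - C \<Longrightarrow> \<zeta> - \<xi> \<in> int_vecs \<Longrightarrow> norm (\<zeta> - \<xi>) > R (d C)"
      unfolding ok_def by blast+
    show ?thesis
    proof (rule quadratic_form_diagonally_dominant[OF fin P, of A "\<lambda>C. k (d C)"])
      show "cmod (A (- z)) = cmod (A z)" for z
        by (simp add: A_def int_vecs_minus_iff window_transform_minus)
      show "\<kappa> \<le> k (d C)" if "C \<in> P" for C using \<kappa>(2) dD that by blast
      show "2 * k (d C) * (\<Sum>\<xi>\<in>C. (cmod (c \<xi>))\<^sup>2) \<le> Re (\<Sum>\<xi>\<in>C. \<Sum>\<eta>\<in>C. c \<xi> * cnj (c \<eta>) * A (\<xi> - \<eta>))"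
        if C: "C \<in> P" for C
      proof -
        have "(\<Sum>\<xi>\<in>C. \<Sum>\<eta>\<in>C. c \<xi> * cnj (c \<eta>) * A (\<xi> - \<eta>))
          = (\<Sum>\<xi>\<in>C. \<Sum>\<eta>\<in>C. c \<xi> * cnj (c \<eta>) * window_transform a s (\<xi> - \<eta>))"
          by (intro sum.cong refl) (use near[OF C] in \<open>auto simp: A_def\<close>)
        also have "\<dots> = complex_of_real (LINT x|lebesgue. cube_window a s x * (cmod (\<Sum>\<xi>\<in>C. c \<xi> * wave \<xi> x))\<^sup>2)"
          by (rule window_quadratic_form(2)[OF s, symmetric])
        finally show ?thesis using k_low[OF near[OF C], of c] by simp
      qed
      show "(\<Sum>\<eta>\<in>\<Lambda> - C. cmod (A (\<xi> - \<eta>))) \<le> k (d C)" if C: "C \<in> P" "\<xi> \<in> C" for C \<xi>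
      proof -
        define E where "E = {\<eta> \<in> \<Lambda> - C. \<xi> - \<eta> \<in> int_vecs}"
        have "(\<Sum>\<eta>\<in>\<Lambda> - C. cmod (A (\<xi> - \<eta>))) = (\<Sum>\<eta>\<in>E. cmod (window_transform a s (\<xi> - \<eta>)))"
          using fin by (intro sum.mono_neutral_cong_right) (auto simp: E_def A_def)
        also have "\<dots> = (\<Sum>z\<in>(\<lambda>\<eta>. \<xi> - \<eta>) ` E. cmod (window_transform a s z))"
          by (subst sum.reindex) (auto simp: inj_on_def)
        also have "\<dots> \<le> k (d C)"
        proof (rule R)
          show "finite ((\<lambda>\<eta>. \<xi> - \<eta>) ` E)" using fin by (simp add: E_def)
          show "(\<lambda>\<eta>. \<xi> - \<eta>) ` E \<subseteq> int_vecs" by (auto simp: E_def)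
          show "\<forall>z\<in>(\<lambda>\<eta>. \<xi> - \<eta>) ` E. R (d C) < norm z"
          proof
            fix z assume "z \<in> (\<lambda>\<eta>. \<xi> - \<eta>) ` E"
            then obtain \<eta> where \<eta>: "z = \<xi> - \<eta>" "\<eta> \<in> \<Lambda> - C" "\<xi> - \<eta> \<in> int_vecs" by (auto simp: E_def)
            then have "\<eta> - \<xi> \<in> int_vecs" using int_vecs_minus[of "\<xi> - \<eta>"] by simp
            from far[OF C \<eta>(2) this] show "R (d C) < norm z" by (simp add: \<eta>(1) norm_minus_commute)
          qed
        qed
        finally show ?thesis .
      qed
    qed
  qed
  then show ?thesis using \<kappa>(1) unfolding A_def by (intro exI[of _ \<kappa>] conjI allI impI)
qed

text \<open>
  The summand has period \<open>N\<close> in \<open>j\<close>, so the sum over a full period is invariant under the shift of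
  \<open>j\<close>, which multiplies it by \<open>cis (2 * pi * \<zeta>)\<close>.
\<close>
lemma sum_cis_period:
  fixes M :: nat and \<zeta> :: real
  defines "N \<equiv> real (2 * M + 1)"
  assumes "N * \<zeta> \<in> \<int>"
  shows "(\<Sum>j\<in>{- int M..int M}. cis (2 * pi * of_int j * \<zeta>)) = (if \<zeta> \<in> \<int> then of_real N else 0)"
proof (cases "\<zeta> \<in> \<int>")
  case True
  have "cis (2 * pi * of_int j * \<zeta>) = 1" for j
  proof -
    have "2 * pi * of_int j * \<zeta> = 2 * pi * (of_int j * \<zeta>)" by simp
    then show ?thesis using True by (simp only: cis_multiple_2pi Ints_mult Ints_of_int)
  qed
  moreover have "card {- int M..int M} = 2 * M + 1" by simp
  ultimately show ?thesis using True by (simp add: N_def)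
next
  case False
  define f where "f j = cis (2 * pi * of_int j * \<zeta>)" for j :: int
  define w where "w = cis (2 * pi * \<zeta>)"
  define T where "T = (\<Sum>j\<in>{- int M..int M}. f j)"
  have "w \<noteq> 1"
  proof
    assume "w = 1"
    then obtain n where "2 * pi * \<zeta> = of_int (2 * n) * pi"
      unfolding w_def cis_conv_exp exp_eq_1 by auto
    then have "\<zeta> = of_int n" by simp
    then show False using False by simp
  qed
  have ends: "f (int M + 1) = f (- int M)"
  proof -
    have "f (int M + 1) = f (- int M) * cis (2 * pi * (N * \<zeta>))"
      unfolding f_def cis_mult by (simp add: N_def algebra_simps)
    also have "cis (2 * pi * (N * \<zeta>)) = 1" using assms(2) by (rule cis_multiple_2pi)
    finally show ?thesis by simp
  qed
  have "w * T = (\<Sum>j\<in>{- int M..int M}. f (j + 1))"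
    unfolding T_def sum_distrib_left
    by (intro sum.cong refl) (simp add: w_def f_def cis_mult algebra_simps)
  also have "\<dots> = (\<Sum>j\<in>{- int M + 1..int M + 1}. f j)"
    by (rule sum.reindex_bij_witness[of _ "\<lambda>j. j - 1" "\<lambda>j. j + 1"]) auto
  also have "{- int M + 1..int M + 1} = insert (int M + 1) {- int M + 1..int M}" by auto
  also have "(\<Sum>j\<in>insert (int M + 1) {- int M + 1..int M}. f j) = f (- int M) + (\<Sum>j\<in>{- int M + 1..int M}. f j)"
    by (simp add: ends)
  also have "\<dots> = (\<Sum>j\<in>insert (- int M) {- int M + 1..int M}. f j)" by simp
  also have "insert (- int M) {- int M + 1..int M} = {- int M..int M}" by auto
  finally have "(w - 1) * T = 0" by (simp add: T_def left_diff_distrib)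
  then have "T = 0" using \<open>w \<noteq> 1\<close> by simp
  then show ?thesis using False by (simp add: T_def f_def)
qed

definition grid :: "nat \<Rightarrow> ('n::finite \<Rightarrow> int) set" where
  "grid M = PiE UNIV (\<lambda>_. {- int M..int M})"

definition period_vec :: "('n::finite \<Rightarrow> int) \<Rightarrow> real^'n" where
  "period_vec g = (\<chi> i. 2 * pi * of_int (g i))"

lemma finite_grid: "finite (grid M)"
  unfolding grid_def by (intro finite_PiE) auto

lemma sum_wave_period_vec:
  fixes \<zeta> :: "real^'n::finite"
  assumes "\<zeta> \<in> dual_lattice (real (2 * M + 1))"
  shows "(\<Sum>g\<in>grid M. wave \<zeta> (period_vec g)) = (if \<zeta> \<in> int_vecs then of_real (real (2 * M + 1) ^ CARD('n)) else 0)"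
proof -
  have "(\<Sum>g\<in>grid M. wave \<zeta> (period_vec g)) = (\<Sum>g\<in>grid M. \<Prod>i\<in>UNIV. cis (2 * pi * of_int (g i) * \<zeta> $ i))"
    unfolding wave_def wave_cart cart_prod_def period_vec_def
    by (intro sum.cong prod.cong refl) (simp add: mult_ac)
  also have "\<dots> = (\<Prod>i\<in>(UNIV::'n set). \<Sum>j\<in>{- int M..int M}. cis (2 * pi * of_int j * \<zeta> $ i))"
    unfolding grid_def by (rule prod_sum_PiE[symmetric]) auto
  also have "\<dots> = (\<Prod>i\<in>UNIV. if \<zeta> $ i \<in> \<int> then complex_of_real (real (2 * M + 1)) else 0)"
    using assms by (intro prod.cong refl sum_cis_period) (simp add: dual_lattice_def int_vecs_def)
  also have "\<dots> = (if \<zeta> \<in> int_vecs then of_real (real (2 * M + 1) ^ CARD('n)) else 0)"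
  proof (cases "\<zeta> \<in> int_vecs")
    case True
    then show ?thesis by (simp add: int_vecs_def)
  next
    case False
    then obtain i where "\<zeta> $ i \<notin> \<int>" by (auto simp: int_vecs_def)
    then have "(\<Prod>i\<in>UNIV. if \<zeta> $ i \<in> \<int> then complex_of_real (real (2 * M + 1)) else 0) = 0"
      by (intro prod_zero) auto
    then show ?thesis using False by simp
  qed
  finally show ?thesis .
qed

text \<open>
  The sum over the translates of the window in one period box removes all interactions between
  frequencies in different cosets of the integer vectors.
\<close>
lemma sum_translated_windows:
  fixes F :: "(real^'n::finite) set"
  assumes s: "s > 0" and F: "F \<subseteq> dual_lattice (real (2 * M + 1))"
  shows "(\<Sum>g\<in>grid M. (LINT x|lebesgue. cube_window a s x * (cmod (\<Sum>\<xi>\<in>F. c \<xi> * wave \<xi> (x + period_vec g)))\<^sup>2))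
    = real (2 * M + 1) ^ CARD('n) * Re (\<Sum>\<xi>\<in>F. \<Sum>\<eta>\<in>F. c \<xi> * cnj (c \<eta>) *
      (if \<xi> - \<eta> \<in> int_vecs then window_transform a s (\<xi> - \<eta>) else 0))"
proof -
  define X where "X = complex_of_real (real (2 * M + 1) ^ CARD('n))"
  let ?I = "\<lambda>g. (LINT x|lebesgue. cube_window a s x * (cmod (\<Sum>\<xi>\<in>F. c \<xi> * wave \<xi> (x + period_vec g)))\<^sup>2)"
  have "complex_of_real (?I g) = (\<Sum>\<xi>\<in>F. \<Sum>\<eta>\<in>F. c \<xi> * cnj (c \<eta>) * window_transform a s (\<xi> - \<eta>) * wave (\<xi> - \<eta>) (period_vec g))" for g
  proof -
    have eq: "(\<Sum>\<xi>\<in>F. c \<xi> * wave \<xi> (x + period_vec g)) = (\<Sum>\<xi>\<in>F. (c \<xi> * wave \<xi> (period_vec g)) * wave \<xi> x)" for x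
      by (simp add: wave_add mult_ac)
    show ?thesis
      unfolding eq window_quadratic_form(2)[OF s] wave_diff_freq
      by (intro sum.cong refl) (simp add: mult_ac)
  qed
  then have "complex_of_real (\<Sum>g\<in>grid M. ?I g)
     = (\<Sum>g\<in>grid M. \<Sum>\<xi>\<in>F. \<Sum>\<eta>\<in>F. c \<xi> * cnj (c \<eta>) * window_transform a s (\<xi> - \<eta>) * wave (\<xi> - \<eta>) (period_vec g))"
    by simp
  also have "\<dots> = (\<Sum>\<xi>\<in>F. \<Sum>g\<in>grid M. \<Sum>\<eta>\<in>F. c \<xi> * cnj (c \<eta>) * window_transform a s (\<xi> - \<eta>) * wave (\<xi> - \<eta>) (period_vec g))"
    by (rule sum.swap)
  also have "\<dots> = (\<Sum>\<xi>\<in>F. \<Sum>\<eta>\<in>F. \<Sum>g\<in>grid M. c \<xi> * cnj (c \<eta>) * window_transform a s (\<xi> - \<eta>) * wave (\<xi> - \<eta>) (period_vec g))"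
    by (intro sum.cong refl sum.swap)
  also have "\<dots> = (\<Sum>\<xi>\<in>F. \<Sum>\<eta>\<in>F. X * (c \<xi> * cnj (c \<eta>) * (if \<xi> - \<eta> \<in> int_vecs then window_transform a s (\<xi> - \<eta>) else 0)))"
  proof (intro sum.cong refl)
    fix \<xi> \<eta> assume "\<xi> \<in> F" "\<eta> \<in> F"
    then have d: "\<xi> - \<eta> \<in> dual_lattice (real (2 * M + 1))" using F dual_lattice_diff by blast
    show "(\<Sum>g\<in>grid M. c \<xi> * cnj (c \<eta>) * window_transform a s (\<xi> - \<eta>) * wave (\<xi> - \<eta>) (period_vec g))
      = X * (c \<xi> * cnj (c \<eta>) * (if \<xi> - \<eta> \<in> int_vecs then window_transform a s (\<xi> - \<eta>) else 0))"
      unfolding sum_distrib_left[symmetric] sum_wave_period_vec[OF d] X_def by simp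
  qed
  also have "\<dots> = X * (\<Sum>\<xi>\<in>F. \<Sum>\<eta>\<in>F. c \<xi> * cnj (c \<eta>) * (if \<xi> - \<eta> \<in> int_vecs then window_transform a s (\<xi> - \<eta>) else 0))"
    by (simp only: sum_distrib_left)
  finally have "Re (complex_of_real (\<Sum>g\<in>grid M. ?I g)) = Re (X * (\<Sum>\<xi>\<in>F. \<Sum>\<eta>\<in>F. c \<xi> * cnj (c \<eta>) * (if \<xi> - \<eta> \<in> int_vecs then window_transform a s (\<xi> - \<eta>) else 0)))"
    by (rule arg_cong)
  then show ?thesis unfolding X_def Re_complex_of_real complex_scaleR[symmetric] scaleR_conv_of_real[symmetric] scaleR_complex.sel
    by simp
qed

text \<open>
  The translates of the window have disjoint supports, and these lie in \<open>\<Omega>\<close> and in the period box.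
\<close>
lemma sum_window_translates_le:
  fixes a :: "real^'n::finite"
  assumes s: "s > 0" "s \<le> 1" and a: "\<And>i. \<bar>a $ i\<bar> + s \<le> pi"
    and cube: "\<And>x. (\<And>i. \<bar>x $ i - a $ i\<bar> < s) \<Longrightarrow> x \<in> \<Omega>"
    and per: "\<And>k :: real^'n. (\<forall>i. k $ i \<in> \<int>) \<Longrightarrow> (\<lambda>x. x + (2 * pi) *\<^sub>R k) ` \<Omega> = \<Omega>"
  shows "(\<Sum>g\<in>grid M. cube_window a s (x - period_vec g)) \<le> indicator (\<Omega> \<inter> period_box (real (2 * M + 1))) x"
proof (cases "\<exists>g\<in>grid M. cube_window a s (x - period_vec g) \<noteq> 0")
  case False
  then have "(\<Sum>g\<in>grid M. cube_window a s (x - period_vec g)) = 0" by (intro sum.neutral) auto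
  then show ?thesis by simp
next
  case True
  then obtain g where g: "g \<in> grid M" "cube_window a s (x - period_vec g) \<noteq> 0" by blast
  have near: "\<bar>x $ i - 2 * pi * of_int (h i) - a $ i\<bar> < s" if "cube_window a s (x - period_vec h) \<noteq> 0" for h i
    using cube_window_nonzero[OF s(1) that, of i] by (simp add: period_vec_def)
  have uniq: "h = g" if "cube_window a s (x - period_vec h) \<noteq> 0" for h
  proof (rule ext)
    fix i
    have "\<bar>2 * pi * of_int (h i) - 2 * pi * of_int (g i)\<bar> < 2 * s"
      using near[OF that, of i] near[OF g(2), of i] by linarith
    then have "2 * pi * \<bar>of_int (h i - g i)\<bar> < 2"
      using s(2) by (simp add: right_diff_distrib[symmetric] abs_mult)
    moreover have "6 * y \<le> 2 * pi * y" if "y \<ge> 0" for y :: real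
      using pi_gt3 that by (intro mult_right_mono) auto
    from this[OF abs_ge_zero] have "6 * \<bar>real_of_int (h i - g i)\<bar> \<le> 2 * pi * \<bar>of_int (h i - g i)\<bar>" .
    ultimately have "6 * \<bar>real_of_int (h i - g i)\<bar> < 2" by (rule order.strict_trans1[rotated])
    then have "\<bar>real_of_int (h i - g i)\<bar> < 1" by argo
    then show "h i = g i" by linarith
  qed
  have "(\<Sum>h\<in>grid M. cube_window a s (x - period_vec h)) = (\<Sum>h\<in>{g}. cube_window a s (x - period_vec h))"
    by (rule sum.mono_neutral_right) (use g(1) uniq finite_grid in auto)
  then have le1: "(\<Sum>h\<in>grid M. cube_window a s (x - period_vec h)) \<le> 1"
    using cube_window_bounds(2) by simp
  have "x - period_vec g \<in> \<Omega>" by (rule cube) (use near[OF g(2)] in \<open>simp add: period_vec_def\<close>)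
  moreover have "x = (x - period_vec g) + (2 * pi) *\<^sub>R (\<chi> i. of_int (g i))"
    by (simp add: vec_eq_iff period_vec_def)
  ultimately have "x \<in> (\<lambda>x. x + (2 * pi) *\<^sub>R (\<chi> i. of_int (g i))) ` \<Omega>" by (rule rev_image_eqI)
  moreover have "(\<lambda>x. x + (2 * pi) *\<^sub>R (\<chi> i. of_int (g i))) ` \<Omega> = \<Omega>" by (rule per) simp
  ultimately have "x \<in> \<Omega>" by simp
  moreover have "\<bar>x $ i\<bar> \<le> pi * real (2 * M + 1)" for i
  proof -
    have "\<bar>g i\<bar> \<le> int M" using g(1) by (auto simp: grid_def PiE_UNIV_domain abs_le_iff minus_le_iff)
    then have "\<bar>real_of_int (g i)\<bar> \<le> real M" by linarith
    then have "\<bar>2 * pi * of_int (g i)\<bar> \<le> 2 * pi * real M" by (simp add: abs_mult)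
    then have "\<bar>x $ i\<bar> \<le> 2 * pi * real M + pi" using near[OF g(2), of i] a[of i] by linarith
    moreover have "pi * real (2 * M + 1) = 2 * pi * real M + pi" by (simp add: distrib_left)
    ultimately show ?thesis by simp
  qed
  ultimately show ?thesis using le1 by (simp add: mem_period_box)
qed

text \<open>
  The constant is independent of the size of the period box and of the shell, since that of
  \<open>shell_lower_bound\<close> is.
\<close>
lemma shell_observability:
  fixes a :: "real^'n::finite"
  assumes s: "s > 0" "s \<le> 1" and a: "\<And>i. \<bar>a $ i\<bar> + s \<le> pi"
    and cube: "\<And>x. (\<And>i. \<bar>x $ i - a $ i\<bar> < s) \<Longrightarrow> x \<in> \<Omega>"
    and per: "\<And>k :: real^'n. (\<forall>i. k $ i \<in> \<int>) \<Longrightarrow> (\<lambda>x. x + (2 * pi) *\<^sub>R k) ` \<Omega> = \<Omega>"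
    and \<Omega>: "\<Omega> \<in> sets lebesgue"
  shows "\<exists>C>0. \<forall>M lam \<Lambda> c. finite \<Lambda> \<longrightarrow> \<Lambda> \<subseteq> dual_lattice (real (2 * M + 1)) \<longrightarrow> (\<forall>\<xi>\<in>\<Lambda>. in_shell lam \<xi>) \<longrightarrow>
    cell_volume (real (2 * M + 1)) TYPE('n) * (\<Sum>\<xi>\<in>\<Lambda>. (cmod (c \<xi>))\<^sup>2)
      \<le> C * (LINT x:\<Omega> \<inter> period_box (real (2 * M + 1))|lebesgue. (cmod (\<Sum>\<xi>\<in>\<Lambda>. c \<xi> * wave \<xi> x))\<^sup>2)"
proof -
  obtain \<kappa> where \<kappa>: "\<kappa> > 0 \<and> (\<forall>lam \<Lambda> c. finite \<Lambda> \<longrightarrow> (\<forall>\<xi>\<in>\<Lambda>. in_shell lam \<xi>) \<longrightarrow>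
    \<kappa> * (\<Sum>\<xi>\<in>\<Lambda>. (cmod (c \<xi>))\<^sup>2) \<le> Re (\<Sum>\<xi>\<in>\<Lambda>. \<Sum>\<eta>\<in>\<Lambda>. c \<xi> * cnj (c \<eta>) *
      (if \<xi> - \<eta> \<in> int_vecs then window_transform a s (\<xi> - \<eta>) else 0)))"
    using shell_lower_bound[OF s(1), of a] by (rule exE)
  define C where "C = (2 * pi) ^ CARD('n) / \<kappa>"
  have "cell_volume (real (2 * M + 1)) TYPE('n) * (\<Sum>\<xi>\<in>\<Lambda>. (cmod (c \<xi>))\<^sup>2)
      \<le> C * (LINT x:\<Omega> \<inter> period_box (real (2 * M + 1))|lebesgue. (cmod (\<Sum>\<xi>\<in>\<Lambda>. c \<xi> * wave \<xi> x))\<^sup>2)"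
    if \<Lambda>: "finite \<Lambda>" "\<Lambda> \<subseteq> dual_lattice (real (2 * M + 1))" "\<forall>\<xi>\<in>\<Lambda>. in_shell lam \<xi>" for M lam \<Lambda> c
  proof -
    define N where "N = real (2 * M + 1)"
    define v where "v x = (\<Sum>\<xi>\<in>\<Lambda>. c \<xi> * wave \<xi> x)" for x
    define B where "B = \<Omega> \<inter> period_box N"
    have cv: "continuous_on UNIV v" unfolding v_def by (intro continuous_intros)
    have int_g: "integrable lebesgue (\<lambda>x. cube_window a s (x - period_vec g) * (cmod (v x))\<^sup>2)"
      and shift: "(LINT x|lebesgue. cube_window a s x * (cmod (v (x + period_vec g)))\<^sup>2)
        = (LINT x|lebesgue. cube_window a s (x - period_vec g) * (cmod (v x))\<^sup>2)" for g
    proof -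
      define f where "f x = cube_window a s (x - period_vec g) * (cmod (v x))\<^sup>2" for x
      have cf: "continuous_on UNIV f"
        unfolding f_def
        by (intro continuous_intros cv continuous_on_compose2[OF continuous_on_cube_window[OF s(1)]]) auto
      then have "f \<in> borel_measurable borel" by (rule borel_measurable_continuous_onI)
      from lebesgue_integral_translate[OF this, of "period_vec g"]
      show "(LINT x|lebesgue. cube_window a s x * (cmod (v (x + period_vec g)))\<^sup>2)
        = (LINT x|lebesgue. cube_window a s (x - period_vec g) * (cmod (v x))\<^sup>2)"
        by (simp add: f_def)
      define Q where "Q = cbox (a + period_vec g - (\<chi> i. s)) (a + period_vec g + (\<chi> i. s))"
      have "set_integrable lebesgue Q f"
        by (rule set_integrable_continuous_bounded[OF cf]) (simp_all add: Q_def)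
      moreover have "(\<lambda>x. indicator Q x *\<^sub>R f x) = f"
      proof
        fix x
        show "indicator Q x *\<^sub>R f x = f x"
        proof (cases "f x = 0")
          case False
          then have "cube_window a s (x - period_vec g) \<noteq> 0" by (simp add: f_def)
          from cube_window_nonzero[OF s(1) this]
          have "\<bar>x $ i - period_vec g $ i - a $ i\<bar> < s" for i by simp
          then have "a $ i + period_vec g $ i - s \<le> x $ i \<and> x $ i \<le> a $ i + period_vec g $ i + s" for i
            by (smt (verit))
          then have "x \<in> Q" unfolding Q_def mem_box_cart by simp
          then show ?thesis by simp
        qed simp
      qed
      ultimately have "integrable lebesgue f" unfolding set_integrable_def by simp
      then show "integrable lebesgue (\<lambda>x. cube_window a s (x - period_vec g) * (cmod (v x))\<^sup>2)"
        by (simp only: f_def[abs_def])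
    qed
    have "N ^ CARD('n) * (\<kappa> * (\<Sum>\<xi>\<in>\<Lambda>. (cmod (c \<xi>))\<^sup>2))
      \<le> N ^ CARD('n) * Re (\<Sum>\<xi>\<in>\<Lambda>. \<Sum>\<eta>\<in>\<Lambda>. c \<xi> * cnj (c \<eta>) *
      (if \<xi> - \<eta> \<in> int_vecs then window_transform a s (\<xi> - \<eta>) else 0))"
      using \<kappa>[THEN conjunct2, rule_format, OF \<Lambda>(1), of lam c] \<Lambda>(3)
      by (intro mult_left_mono) (auto simp: N_def)
    also have "\<dots> = (\<Sum>g\<in>grid M. (LINT x|lebesgue. cube_window a s x * (cmod (v (x + period_vec g)))\<^sup>2))"
      unfolding v_def N_def by (rule sum_translated_windows[OF s(1) \<Lambda>(2), symmetric])
    also have "\<dots> = (LINT x|lebesgue. (\<Sum>g\<in>grid M. cube_window a s (x - period_vec g) * (cmod (v x))\<^sup>2))"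
      unfolding shift by (rule Bochner_Integration.integral_sum[symmetric]) (rule int_g)
    also have "\<dots> \<le> (LINT x|lebesgue. indicator B x *\<^sub>R (cmod (v x))\<^sup>2)"
    proof (rule integral_mono)
      show "integrable lebesgue (\<lambda>x. \<Sum>g\<in>grid M. cube_window a s (x - period_vec g) * (cmod (v x))\<^sup>2)"
        by (intro Bochner_Integration.integrable_sum int_g)
      have "bounded B" unfolding B_def using period_box_measurable(2) bounded_Int by blast
      then have "set_integrable lebesgue B (\<lambda>x. (cmod (v x))\<^sup>2)"
        using \<Omega> by (intro set_integrable_continuous_bounded continuous_intros cv) (auto simp: B_def)
      then show "integrable lebesgue (\<lambda>x. indicator B x *\<^sub>R (cmod (v x))\<^sup>2)" by (simp add: set_integrable_def)
      show "(\<Sum>g\<in>grid M. cube_window a s (x - period_vec g) * (cmod (v x))\<^sup>2) \<le> indicator B x *\<^sub>R (cmod (v x))\<^sup>2" for x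
        unfolding sum_distrib_right[symmetric] real_scaleR_def B_def N_def
        by (intro mult_right_mono sum_window_translates_le[OF s a cube per]) auto
    qed
    finally have le: "N ^ CARD('n) * (\<kappa> * (\<Sum>\<xi>\<in>\<Lambda>. (cmod (c \<xi>))\<^sup>2)) \<le> (LINT x:B|lebesgue. (cmod (v x))\<^sup>2)"
      by (simp add: set_lebesgue_integral_def)
    have "cell_volume N TYPE('n) * (\<Sum>\<xi>\<in>\<Lambda>. (cmod (c \<xi>))\<^sup>2) = C * (N ^ CARD('n) * (\<kappa> * (\<Sum>\<xi>\<in>\<Lambda>. (cmod (c \<xi>))\<^sup>2)))"
      using \<kappa> by (simp add: cell_volume_def C_def power_mult_distrib)
    also have "\<dots> \<le> C * (LINT x:B|lebesgue. (cmod (v x))\<^sup>2)"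
      using le \<kappa> by (intro mult_left_mono) (auto simp: C_def)
    finally show ?thesis unfolding N_def B_def v_def .
  qed
  moreover have "C > 0" using \<kappa> by (simp add: C_def)
  ultimately show ?thesis by (intro exI[of _ C] conjI allI impI)
qed

section \<open>The resolvent estimate\<close>

lemma finite_shell_dual_lattice:
  assumes "N > 0" shows "finite {\<xi> :: real^'n::finite. \<xi> \<in> dual_lattice N \<and> in_shell lam \<xi>}"
proof -
  have "{\<xi> :: real^'n. \<xi> \<in> dual_lattice N \<and> in_shell lam \<xi>} \<subseteq> (\<lambda>k. (1 / N) *\<^sub>R k) ` (int_vecs \<inter> cball 0 (N * (\<bar>lam\<bar> + 1)))"
  proof
    fix \<xi> :: "real^'n" assume "\<xi> \<in> {\<xi>. \<xi> \<in> dual_lattice N \<and> in_shell lam \<xi>}"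
    then have \<xi>: "N *\<^sub>R \<xi> \<in> int_vecs" "\<bar>\<xi> \<bullet> \<xi> - lam\<bar> \<le> 1" by (auto simp: dual_lattice_def in_shell_def)
    have "(norm \<xi>)\<^sup>2 \<le> \<bar>lam\<bar> + 1" using \<xi>(2) unfolding power2_norm_eq_inner by linarith
    also have "\<dots> \<le> (\<bar>lam\<bar> + 1)\<^sup>2" by (simp add: power2_eq_square distrib_left)
    finally have "norm \<xi> \<le> \<bar>lam\<bar> + 1" by (rule power2_le_imp_le) simp
    then have "N *\<^sub>R \<xi> \<in> cball 0 (N * (\<bar>lam\<bar> + 1))" using assms by simp
    moreover have "\<xi> = (1 / N) *\<^sub>R (N *\<^sub>R \<xi>)" using assms by simp
    ultimately show "\<xi> \<in> (\<lambda>k. (1 / N) *\<^sub>R k) ` (int_vecs \<inter> cball 0 (N * (\<bar>lam\<bar> + 1)))" using \<xi>(1) by blast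
  qed
  then show ?thesis using finite_int_vecs_cball finite_subset by blast
qed

text \<open>
  Outside the shell the factor \<open>\<xi> \<bullet> \<xi> - lam\<close> exceeds 1 in modulus, so the coefficients of \<open>w\<close> are at
  most those of \<open>F\<close>; the identity of Parseval for \<open>w\<close> and the inequality of Bessel for \<open>F\<close> conclude.
\<close>
lemma off_shell_energy_le:
  fixes w F :: "real^'n::finite \<Rightarrow> complex"
  assumes N: "N > 0" and w: "square_integrable lebesgue w" "\<And>x i. \<bar>x $ i\<bar> > N \<Longrightarrow> w x = 0"
    and F: "square_integrable lebesgue F" "\<And>x i. \<bar>x $ i\<bar> > N \<Longrightarrow> F x = 0"
    and eq: "\<And>\<xi>. of_real (\<xi> \<bullet> \<xi> - lam) * fourier_coeff w \<xi> = fourier_coeff F \<xi>"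
    and S: "finite S" "S = {\<xi>. \<xi> \<in> dual_lattice N \<and> in_shell lam \<xi>}"
  shows "energy w - (\<Sum>\<xi>\<in>S. (cmod (fourier_coeff w \<xi>))\<^sup>2) / cell_volume N TYPE('n)
     \<le> energy F"
proof (rule field_le_epsilon)
  fix \<epsilon> :: real assume "\<epsilon> > 0"
  define X where "X = cell_volume N TYPE('n)"
  have X: "X > 0" using N by (simp add: X_def cell_volume_def)
  obtain E where "finite E \<and> E \<subseteq> dual_lattice N \<and>
    energy w - (\<Sum>\<xi>\<in>E. (cmod (fourier_coeff w \<xi>))\<^sup>2) / X < \<epsilon>"
    using parseval_approx[of N w, OF N w \<open>\<epsilon> > 0\<close>] unfolding X_def by (rule exE)
  then have E: "finite E" "E \<subseteq> dual_lattice N"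
    "energy w - (\<Sum>\<xi>\<in>E. (cmod (fourier_coeff w \<xi>))\<^sup>2) / X < \<epsilon>" by simp_all
  have Fbox: "F x = 0" if x: "x \<notin> period_box N" for x
    using outside_period_box[OF N x] F(2) by metis
  have "(\<Sum>\<xi>\<in>E. (cmod (fourier_coeff w \<xi>))\<^sup>2) \<le> (\<Sum>\<xi>\<in>S \<union> (E - S). (cmod (fourier_coeff w \<xi>))\<^sup>2)"
    using E(1) S(1) by (intro sum_mono2) auto
  also have "\<dots> = (\<Sum>\<xi>\<in>S. (cmod (fourier_coeff w \<xi>))\<^sup>2) + (\<Sum>\<xi>\<in>E - S. (cmod (fourier_coeff w \<xi>))\<^sup>2)"
    using E(1) S(1) by (intro sum.union_disjoint) auto
  also have "(\<Sum>\<xi>\<in>E - S. (cmod (fourier_coeff w \<xi>))\<^sup>2) \<le> (\<Sum>\<xi>\<in>E - S. (cmod (fourier_coeff F \<xi>))\<^sup>2)"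
  proof (intro sum_mono power_mono)
    fix \<xi> assume "\<xi> \<in> E - S"
    then have "\<bar>\<xi> \<bullet> \<xi> - lam\<bar> > 1" using E(2) S(2) by (auto simp: in_shell_def)
    then have "1 * cmod (fourier_coeff w \<xi>) \<le> \<bar>\<xi> \<bullet> \<xi> - lam\<bar> * cmod (fourier_coeff w \<xi>)"
      by (intro mult_right_mono) auto
    also have "\<dots> = cmod (fourier_coeff F \<xi>)" unfolding eq[symmetric] norm_mult norm_of_real ..
    finally show "cmod (fourier_coeff w \<xi>) \<le> cmod (fourier_coeff F \<xi>)" by simp
  qed simp
  finally have "(\<Sum>\<xi>\<in>E. (cmod (fourier_coeff w \<xi>))\<^sup>2) / X
     \<le> ((\<Sum>\<xi>\<in>S. (cmod (fourier_coeff w \<xi>))\<^sup>2) + (\<Sum>\<xi>\<in>E - S. (cmod (fourier_coeff F \<xi>))\<^sup>2)) / X"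
    using X by (intro divide_right_mono) auto
  moreover have "(\<Sum>\<xi>\<in>E - S. (cmod (fourier_coeff F \<xi>))\<^sup>2) / X \<le> energy F"
    unfolding X_def by (rule bessel_inequality[OF N _ _ F(1) Fbox]) (use E in auto)
  ultimately show "energy w - (\<Sum>\<xi>\<in>S. (cmod (fourier_coeff w \<xi>))\<^sup>2) / cell_volume N TYPE('n)
     \<le> energy F + \<epsilon>"
    using E(3) unfolding X_def[symmetric] add_divide_distrib by linarith
qed

text \<open>
  Split \<open>w\<close> into its part \<open>v\<close> in the shell and the rest. The rest is bounded by \<open>F\<close>, and the observability
  of \<open>v\<close> on \<open>\<Omega>\<close> carries over to \<open>w\<close> at the cost of the rest.
\<close>
lemma periodic_estimate:
  fixes w F :: "real^'n::finite \<Rightarrow> complex"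
  assumes N: "N > 0" and w: "square_integrable lebesgue w" "\<And>x i. \<bar>x $ i\<bar> > N \<Longrightarrow> w x = 0"
    and F: "square_integrable lebesgue F" "\<And>x i. \<bar>x $ i\<bar> > N \<Longrightarrow> F x = 0"
    and eq: "\<And>\<xi>. of_real (\<xi> \<bullet> \<xi> - lam) * fourier_coeff w \<xi> = fourier_coeff F \<xi>"
    and \<Omega>: "\<Omega> \<in> sets lebesgue" and C: "C > 0"
    and obs: "\<And>\<Lambda> c. finite \<Lambda> \<Longrightarrow> \<Lambda> \<subseteq> dual_lattice N \<Longrightarrow> (\<forall>\<xi>\<in>\<Lambda>. in_shell lam \<xi>) \<Longrightarrow>
      cell_volume N TYPE('n) * (\<Sum>\<xi>\<in>\<Lambda>. (cmod (c \<xi>))\<^sup>2)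
      \<le> C * (LINT x:\<Omega> \<inter> period_box N|lebesgue. (cmod (\<Sum>\<xi>\<in>\<Lambda>. c \<xi> * wave \<xi> x))\<^sup>2)"
  shows "energy w \<le> (1 + 2 * C) * energy F
    + 2 * C * (LINT x:\<Omega>|lebesgue. (cmod (w x))\<^sup>2)"
proof -
  define X where "X = cell_volume N TYPE('n)"
  have X: "X > 0" using N by (simp add: X_def cell_volume_def)
  define S where "S = {\<xi> :: real^'n. \<xi> \<in> dual_lattice N \<and> in_shell lam \<xi>}"
  have S: "finite S" "S \<subseteq> dual_lattice N" "\<forall>\<xi>\<in>S. in_shell lam \<xi>"
    using finite_shell_dual_lattice[OF N] by (auto simp: S_def)
  have wbox: "w x = 0" if x: "x \<notin> period_box N" for x
    using outside_period_box[OF N x] w(2) by metis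
  define v where "v x = (\<Sum>\<xi>\<in>S. fourier_coeff w \<xi> / X * wave \<xi> x)" for x
  define A where "A = energy w"
  define G where "G = energy F"
  define T where "T = (LINT x:period_box N|lebesgue. (cmod (w x - v x))\<^sup>2)"
  define P where "P = (\<Sum>\<xi>\<in>S. (cmod (fourier_coeff w \<xi>))\<^sup>2) / X"
  define W where "W = (LINT x:\<Omega>|lebesgue. (cmod (w x))\<^sup>2)"
  have TAP: "T = A - P"
    unfolding T_def v_def A_def P_def X_def by (rule projection_error(1)[OF N S(1,2) w(1) wbox])
  have TG: "T \<le> G"
    unfolding TAP A_def P_def G_def X_def
    by (rule off_shell_energy_le[OF N w F eq S(1) S_def])
  have w2: "integrable lebesgue (\<lambda>x. (cmod (w x))\<^sup>2)" using w(1) by (simp add: square_integrable_def)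
  have iw: "integrable lebesgue (\<lambda>x. indicator \<Omega> x *\<^sub>R (cmod (w x))\<^sup>2)"
    using \<Omega> w2 by (rule integrable_mult_indicator)
  have iwv: "integrable lebesgue (\<lambda>x. indicator (period_box N) x *\<^sub>R (cmod (w x - v x))\<^sup>2)"
    using pythagoras_period_box(1)[OF N S(1,2) w(1) wbox, of "\<lambda>\<xi>. fourier_coeff w \<xi> / X"]
    unfolding set_integrable_def v_def .
  have "P = X * (\<Sum>\<xi>\<in>S. (cmod (fourier_coeff w \<xi> / X))\<^sup>2)"
    using X by (simp add: P_def sum_distrib_left sum_divide_distrib norm_divide power_divide power2_eq_square)
  also have "\<dots> \<le> C * (LINT x:\<Omega> \<inter> period_box N|lebesgue. (cmod (v x))\<^sup>2)"
    unfolding X_def v_def by (rule obs[OF S])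
  also have "(LINT x:\<Omega> \<inter> period_box N|lebesgue. (cmod (v x))\<^sup>2)
     \<le> (LINT x|lebesgue. 2 * (indicator \<Omega> x *\<^sub>R (cmod (w x))\<^sup>2) + 2 * (indicator (period_box N) x *\<^sub>R (cmod (w x - v x))\<^sup>2))"
    unfolding set_lebesgue_integral_def
  proof (rule integral_mono)
    have "bounded (\<Omega> \<inter> period_box N)" using period_box_measurable(2) bounded_Int by blast
    then have "set_integrable lebesgue (\<Omega> \<inter> period_box N) (\<lambda>x. (cmod (v x))\<^sup>2)"
      using \<Omega> unfolding v_def by (intro set_integrable_continuous_bounded continuous_intros) auto
    then show "integrable lebesgue (\<lambda>x. indicator (\<Omega> \<inter> period_box N) x *\<^sub>R (cmod (v x))\<^sup>2)"
      by (simp add: set_integrable_def)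
    show "integrable lebesgue (\<lambda>x. 2 * (indicator \<Omega> x *\<^sub>R (cmod (w x))\<^sup>2) + 2 * (indicator (period_box N) x *\<^sub>R (cmod (w x - v x))\<^sup>2))"
      by (intro Bochner_Integration.integrable_add integrable_mult_right iw iwv)
    show "indicator (\<Omega> \<inter> period_box N) x *\<^sub>R (cmod (v x))\<^sup>2
      \<le> 2 * (indicator \<Omega> x *\<^sub>R (cmod (w x))\<^sup>2) + 2 * (indicator (period_box N) x *\<^sub>R (cmod (w x - v x))\<^sup>2)" for x
      using norm_diff_squared_le[of "w x" "w x - v x"] by (auto simp: indicator_def)
  qed
  also have "\<dots> = 2 * W + 2 * T"
    unfolding Bochner_Integration.integral_add[OF integrable_mult_right[OF iw] integrable_mult_right[OF iwv]]
      W_def T_def set_lebesgue_integral_def integral_mult_right_zero ..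
  finally have "P \<le> C * (2 * W + 2 * T)" using C by simp
  moreover have "C * T \<le> C * G" using TG C by simp
  ultimately have "A \<le> (1 + 2 * C) * G + 2 * C * W"
    using TAP TG by (simp add: algebra_simps)
  then show ?thesis unfolding A_def G_def W_def .
qed

text \<open>
  The estimate for the cut off function tends to the one for \<open>u\<close>, up to the value of the cutoff at the
  origin.
\<close>
lemma localized_estimate:
  fixes u f :: "real^'n::finite \<Rightarrow> complex"
  assumes u: "sobolev_H 2 u" and f: "square_integrable lebesgue f"
    and eq: "AE x in lebesgue. laplace_op u x - of_real lam * u x = f x"
    and \<Omega>: "\<Omega> \<in> sets lebesgue" and C: "C > 0"
    and obs: "\<And>M \<Lambda> c. finite \<Lambda> \<Longrightarrow> \<Lambda> \<subseteq> dual_lattice (real (2 * M + 1)) \<Longrightarrow> (\<forall>\<xi>\<in>\<Lambda>. in_shell lam \<xi>) \<Longrightarrow>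
      cell_volume (real (2 * M + 1)) TYPE('n) * (\<Sum>\<xi>\<in>\<Lambda>. (cmod (c \<xi>))\<^sup>2)
      \<le> C * (LINT x:\<Omega> \<inter> period_box (real (2 * M + 1))|lebesgue. (cmod (\<Sum>\<xi>\<in>\<Lambda>. c \<xi> * wave \<xi> x))\<^sup>2)"
  shows "bump 0 ^ (2 * CARD('n)) * energy u
    \<le> (2 + 4 * C) * energy f + 2 * C * (LINT x:\<Omega>|lebesgue. (cmod (u x))\<^sup>2)"
proof -
  have um: "u \<in> borel_measurable lebesgue" and u2: "integrable lebesgue (\<lambda>x. (cmod (u x))\<^sup>2)"
    using u by (simp_all add: numeral_2_eq_2 square_integrable_def)
  have iu: "integrable lebesgue (\<lambda>x. indicator \<Omega> x *\<^sub>R (cmod (u x))\<^sup>2)"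
    using \<Omega> u2 by (rule integrable_mult_indicator)
  obtain K where K: "\<forall>N\<ge>1. \<exists>F. square_integrable lebesgue F \<and> (\<forall>x i. \<bar>x $ i\<bar> > N \<longrightarrow> F x = 0) \<and>
    (\<forall>\<xi>. of_real (\<xi> \<bullet> \<xi> - lam) * fourier_coeff (\<lambda>x. of_real (cube_bump N x) * u x) \<xi> = fourier_coeff F \<xi>) \<and>
    energy F \<le> 2 * energy f + K / N\<^sup>2"
    using localized_equation[OF u f eq] by (rule exE)
  define N where "N M = real (2 * M + 1)" for M
  have N1: "N M \<ge> 1" for M by (simp add: N_def)
  define w where "w M x = complex_of_real (cube_bump (N M) x) * u x" for M x
  have bm: "cube_bump (N M) \<in> borel_measurable lebesgue" for M
    unfolding cube_bump_def
    by (intro continuous_imp_lebesgue_measurable continuous_on_cart_prod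
        continuous_on_compose2[OF smooth_continuous[OF smooth_bump]] continuous_intros) (simp_all add: N_def)
  have wm: "w M \<in> borel_measurable lebesgue" for M
    unfolding w_def using bm um by measurable
  have wle: "(cmod (w M x))\<^sup>2 \<le> (cmod (u x))\<^sup>2" for M x
    using cube_bump_bounds[of "N M" x] unfolding w_def
    by (intro power_mono) (auto simp: norm_mult mult_left_le_one_le)
  have wm2: "(\<lambda>x. (cmod (w M x))\<^sup>2) \<in> borel_measurable lebesgue" for M using wm by measurable
  have w2: "integrable lebesgue (\<lambda>x. (cmod (w M x))\<^sup>2)" for M
    by (rule Bochner_Integration.integrable_bound[OF u2 wm2]) (simp add: wle)
  have step: "energy (w M)
     \<le> (1 + 2 * C) * (2 * energy f + K / (N M)\<^sup>2) + 2 * C * (LINT x:\<Omega>|lebesgue. (cmod (u x))\<^sup>2)" for M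
  proof -
    have N0: "N M > 0" using N1[of M] by linarith
    obtain F where F: "square_integrable lebesgue F" "\<And>x i. \<bar>x $ i\<bar> > N M \<Longrightarrow> F x = 0"
      "\<And>\<xi>. of_real (\<xi> \<bullet> \<xi> - lam) * fourier_coeff (w M) \<xi> = fourier_coeff F \<xi>"
      "energy F \<le> 2 * energy f + K / (N M)\<^sup>2"
      using K[rule_format, OF N1[of M]] unfolding w_def[abs_def] by blast
    have wsq: "square_integrable lebesgue (w M)" using wm w2 by (simp add: square_integrable_def)
    have wz: "w M x = 0" if "\<bar>x $ i\<bar> > N M" for x i
      using cube_bump_zero[OF N0 less_imp_le[OF that]] by (simp add: w_def)
    have "energy (w M) \<le> (1 + 2 * C) * energy F
       + 2 * C * (LINT x:\<Omega>|lebesgue. (cmod (w M x))\<^sup>2)"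
    proof (rule periodic_estimate[OF N0 wsq _ F(1) _ F(3) \<Omega> C])
      show "w M x = 0" "F x = 0" if "\<bar>x $ i\<bar> > N M" for x i
        using wz[OF that] F(2)[OF that] .
    qed (unfold N_def, rule obs)
    also have "(LINT x:\<Omega>|lebesgue. (cmod (w M x))\<^sup>2) \<le> (LINT x:\<Omega>|lebesgue. (cmod (u x))\<^sup>2)"
      unfolding set_lebesgue_integral_def
      by (rule integral_mono[OF integrable_mult_indicator[OF \<Omega> w2] iu]) (simp add: wle mult_left_mono)
    also have "energy F \<le> 2 * energy f + K / (N M)\<^sup>2"
      by (rule F(4))
    finally show ?thesis using C by simp
  qed
  have Ninf: "filterlim N at_top sequentially"
    unfolding N_def
    by (rule filterlim_compose[OF filterlim_real_sequentially])
       (auto intro!: filterlim_subseq strict_monoI)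
  have "(\<lambda>M. LINT x|lebesgue. (cmod (w M x))\<^sup>2) \<longlonglongrightarrow> (LINT x|lebesgue. bump 0 ^ (2 * CARD('n)) * (cmod (u x))\<^sup>2)"
  proof (rule integral_dominated_convergence[OF _ wm2 u2])
    show "(\<lambda>x. bump 0 ^ (2 * CARD('n)) * (cmod (u x))\<^sup>2) \<in> borel_measurable lebesgue" using um by measurable
    show "AE x in lebesgue. norm ((cmod (w M x))\<^sup>2) \<le> (cmod (u x))\<^sup>2" for M by (simp add: wle)
    show "AE x in lebesgue. (\<lambda>M. (cmod (w M x))\<^sup>2) \<longlonglongrightarrow> bump 0 ^ (2 * CARD('n)) * (cmod (u x))\<^sup>2"
    proof (rule AE_I2)
      fix x :: "real^'n"
      have "(\<lambda>M. bump (x $ i / N M)) \<longlonglongrightarrow> bump 0" for i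
      proof -
        have "isCont bump 0"
          using smooth_continuous[OF smooth_bump] by (simp add: continuous_on_eq_continuous_at)
        moreover have "(\<lambda>M. x $ i / N M) \<longlonglongrightarrow> 0"
          by (rule tendsto_divide_0[OF tendsto_const filterlim_at_top_imp_at_infinity[OF Ninf]])
        ultimately show ?thesis using isCont_tendsto_compose by blast
      qed
      then have "(\<lambda>M. \<Prod>i\<in>(UNIV::'n set). bump (x $ i / N M)) \<longlonglongrightarrow> (\<Prod>i\<in>(UNIV::'n set). bump 0)"
        by (rule tendsto_prod)
      then have "(\<lambda>M. cube_bump (N M) x) \<longlonglongrightarrow> bump 0 ^ CARD('n)"
        by (simp add: cube_bump_def cart_prod_def)
      then have "(\<lambda>M. (cube_bump (N M) x)\<^sup>2 * (cmod (u x))\<^sup>2) \<longlonglongrightarrow> (bump 0 ^ CARD('n))\<^sup>2 * (cmod (u x))\<^sup>2"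
        by (intro tendsto_intros)
      then show "(\<lambda>M. (cmod (w M x))\<^sup>2) \<longlonglongrightarrow> bump 0 ^ (2 * CARD('n)) * (cmod (u x))\<^sup>2"
        by (simp add: w_def norm_mult power_mult_distrib power_mult[symmetric] mult.commute[of 2])
    qed
  qed
  then have lim: "(\<lambda>M. LINT x|lebesgue. (cmod (w M x))\<^sup>2) \<longlonglongrightarrow> bump 0 ^ (2 * CARD('n)) * energy u"
    by simp
  have "(\<lambda>M. K / (N M)\<^sup>2) \<longlonglongrightarrow> 0"
    by (rule tendsto_divide_0[OF tendsto_const filterlim_at_top_imp_at_infinity[OF filterlim_pow_at_top[OF _ Ninf]]]) simp
  then have "(\<lambda>M. (1 + 2 * C) * (2 * energy f + K / (N M)\<^sup>2) + 2 * C * (LINT x:\<Omega>|lebesgue. (cmod (u x))\<^sup>2))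
     \<longlonglongrightarrow> (1 + 2 * C) * (2 * energy f + 0) + 2 * C * (LINT x:\<Omega>|lebesgue. (cmod (u x))\<^sup>2)"
    by (intro tendsto_intros)
  from LIMSEQ_le[OF lim this] step
  have "bump 0 ^ (2 * CARD('n)) * energy u
    \<le> (1 + 2 * C) * (2 * energy f + 0) + 2 * C * (LINT x:\<Omega>|lebesgue. (cmod (u x))\<^sup>2)"
    by blast
  then show ?thesis by (simp add: algebra_simps)
qed

text \<open>
  A translation brings a point of \<open>\<Omega>\<close> into the closed basic cell; moving it slightly towards the origin
  brings it into the interior.
\<close>
lemma periodic_open_contains_cube:
  fixes \<Omega> :: "(real^'n::finite) set"
  assumes "open \<Omega>" "\<Omega> \<noteq> {}"
    and per: "\<And>k :: real^'n. (\<forall>i. k $ i \<in> \<int>) \<Longrightarrow> (\<lambda>x. x + (2 * pi) *\<^sub>R k) ` \<Omega> = \<Omega>"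
  shows "\<exists>a s. s > 0 \<and> s \<le> 1 \<and> (\<forall>i. \<bar>a $ i\<bar> + s \<le> pi) \<and> (\<forall>x. (\<forall>i. \<bar>x $ i - a $ i\<bar> < s) \<longrightarrow> x \<in> \<Omega>)"
proof -
  obtain x0 where x0: "x0 \<in> \<Omega>" using assms(2) by blast
  define k :: "real^'n" where "k = (\<chi> i. - of_int (round (x0 $ i / (2 * pi))))"
  define y where "y = x0 + (2 * pi) *\<^sub>R k"
  have "y \<in> (\<lambda>x. x + (2 * pi) *\<^sub>R k) ` \<Omega>" using x0 by (simp add: y_def)
  moreover have "(\<lambda>x. x + (2 * pi) *\<^sub>R k) ` \<Omega> = \<Omega>" by (rule per) (simp add: k_def)
  ultimately have y: "y \<in> \<Omega>" by simp
  have ypi: "\<bar>y $ i\<bar> \<le> pi" for i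
  proof -
    have "y $ i = (2 * pi) * (x0 $ i / (2 * pi) - of_int (round (x0 $ i / (2 * pi))))"
      by (simp add: y_def k_def algebra_simps)
    then have "\<bar>y $ i\<bar> = (2 * pi) * \<bar>x0 $ i / (2 * pi) - of_int (round (x0 $ i / (2 * pi)))\<bar>"
      by (simp add: abs_mult)
    also have "\<dots> \<le> (2 * pi) * (1 / 2)"
      using of_int_round_abs_le[of "x0 $ i / (2 * pi)"]
      by (intro mult_left_mono) (auto simp: abs_minus_commute)
    finally show ?thesis by simp
  qed
  obtain e where e: "e > 0" "ball y e \<subseteq> \<Omega>" using assms(1) y open_contains_ball by blast
  define t where "t = min (1/2) (e / (2 * (norm y + 1)))"
  have ny: "norm y + 1 > 0" by (simp add: add_nonneg_pos)
  have t: "t > 0" using e(1) ny by (simp add: t_def)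
  have t2: "t \<le> 1/2" unfolding t_def by (rule min.cobounded1)
  define a where "a = (1 - t) *\<^sub>R y"
  have "dist a y = t * norm y"
  proof -
    have "a - y = (- t) *\<^sub>R y" by (simp add: a_def algebra_simps)
    then show ?thesis using t t2 by (simp add: dist_norm)
  qed
  also have "\<dots> \<le> e / (2 * (norm y + 1)) * norm y"
    by (intro mult_right_mono) (simp_all add: t_def)
  also have "\<dots> \<le> e / 2" using e(1) ny by (simp add: field_simps)
  finally have ay: "dist a y \<le> e / 2" .
  define n where "n = real CARD('n)"
  have n: "n \<ge> 1" by (simp add: n_def Suc_le_eq)
  define s where "s = min 1 (min (t * pi) (e / (2 * n)))"
  have s: "s > 0" "s \<le> 1" "s \<le> t * pi" "s \<le> e / (2 * n)" using t e(1) n by (simp_all add: s_def)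
  have "\<bar>a $ i\<bar> + s \<le> pi" for i
  proof -
    have "\<bar>a $ i\<bar> = (1 - t) * \<bar>y $ i\<bar>" using t t2 by (simp add: a_def abs_mult)
    also have "\<dots> \<le> (1 - t) * pi" using t t2 ypi by (intro mult_left_mono) auto
    finally show ?thesis using s(3) by (simp add: left_diff_distrib)
  qed
  moreover have "x \<in> \<Omega>" if x: "\<forall>i. \<bar>x $ i - a $ i\<bar> < s" for x
  proof -
    have "dist x a \<le> (\<Sum>i\<in>UNIV. \<bar>(x - a) $ i\<bar>)" unfolding dist_norm by (rule norm_le_l1_cart)
    also have "\<dots> < (\<Sum>i\<in>(UNIV::'n set). s)" using x by (intro sum_strict_mono) auto
    also have "\<dots> = n * s" by (simp add: n_def)
    also have "\<dots> \<le> n * (e / (2 * n))" using s(4) n by (intro mult_left_mono) auto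
    also have "\<dots> = e / 2" using n by simp
    finally have "dist y x < e" using ay dist_triangle[of x y a] by (simp add: dist_commute)
    then show ?thesis using e(2) by (auto simp: mem_ball)
  qed
  ultimately show ?thesis using s by blast
qed

theorem theorem2:
  fixes \<Omega> :: "(real^'n::finite) set"
  assumes "open \<Omega>" and "\<Omega> \<noteq> {}"
    and "\<And>k :: real^'n. (\<forall>i. k $ i \<in> \<int>) \<Longrightarrow> (\<lambda>x. x + (2 * pi) *\<^sub>R k) ` \<Omega> = \<Omega>"
  shows "\<exists>C::real. C > 0 \<and>
    (\<forall>(lam::real) (u :: real^'n \<Rightarrow> complex) (f :: real^'n \<Rightarrow> complex).
       sobolev_H 2 u \<longrightarrow> square_integrable lebesgue f \<longrightarrow>
       (AE x in lebesgue. laplace_op u x - of_real lam * u x = f x) \<longrightarrow>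
       norm_L2 lebesgue u \<le> C * (norm_L2 lebesgue f + norm_L2 (lebesgue_on \<Omega>) u))"
proof -
  have \<Omega>: "\<Omega> \<in> sets lebesgue" using assms(1) by simp
  obtain a s where s: "s > 0" "s \<le> 1" and a: "\<And>i. \<bar>a $ i\<bar> + s \<le> pi"
    and cube: "\<And>x. (\<And>i. \<bar>x $ i - a $ i\<bar> < s) \<Longrightarrow> x \<in> \<Omega>"
    using periodic_open_contains_cube[OF assms] by blast
  obtain C where C: "C > 0 \<and> (\<forall>M lam \<Lambda> c. finite \<Lambda> \<longrightarrow> \<Lambda> \<subseteq> dual_lattice (real (2 * M + 1)) \<longrightarrow> (\<forall>\<xi>\<in>\<Lambda>. in_shell lam \<xi>) \<longrightarrow>
    cell_volume (real (2 * M + 1)) TYPE('n) * (\<Sum>\<xi>\<in>\<Lambda>. (cmod (c \<xi>))\<^sup>2)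
      \<le> C * (LINT x:\<Omega> \<inter> period_box (real (2 * M + 1))|lebesgue. (cmod (\<Sum>\<xi>\<in>\<Lambda>. c \<xi> * wave \<xi> x))\<^sup>2))"
    using shell_observability[OF s a cube assms(3) \<Omega>] by (rule exE)
  define b where "b = bump 0 ^ (2 * CARD('n))"
  have b: "b > 0" unfolding b_def by (intro zero_less_power bump_pos) simp
  define D where "D = (2 + 4 * C) / b"
  have D: "D > 0" using C b by (simp add: D_def)
  have "norm_L2 lebesgue u \<le> sqrt D * (norm_L2 lebesgue f + norm_L2 (lebesgue_on \<Omega>) u)"
    if u: "sobolev_H 2 u" and f: "square_integrable lebesgue f"
      and eq: "AE x in lebesgue. laplace_op u x - of_real lam * u x = f x" for lam u f
  proof -
    define A where "A = energy u"
    define B where "B = energy f"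
    define W where "W = (LINT x:\<Omega>|lebesgue. (cmod (u x))\<^sup>2)"
    have nonneg: "B \<ge> 0" "W \<ge> 0"
      unfolding B_def W_def set_lebesgue_integral_def by (intro Bochner_Integration.integral_nonneg, simp)+
    have "b * A \<le> (2 + 4 * C) * B + 2 * C * W"
      unfolding b_def A_def B_def W_def
      by (rule localized_estimate[OF u f eq \<Omega>]) (use C in auto)
    also have "\<dots> \<le> (2 + 4 * C) * B + (2 + 4 * C) * W"
      using C nonneg by (intro add_left_mono mult_right_mono) auto
    finally have "A \<le> D * (B + W)" using b by (simp add: D_def field_simps)
    then have "sqrt A \<le> sqrt D * sqrt (B + W)" by (simp add: real_sqrt_mult[symmetric])
    also have "\<dots> \<le> sqrt D * (sqrt B + sqrt W)"
      using D nonneg by (intro mult_left_mono sqrt_add_le_add_sqrt) auto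
    finally have "sqrt A \<le> sqrt D * (sqrt B + sqrt W)" .
    moreover have "W = (LINT x|lebesgue_on \<Omega>. (cmod (u x))\<^sup>2)"
      unfolding W_def set_lebesgue_integral_def by (rule integral_restrict_space[symmetric]) (use \<Omega> in simp)
    ultimately show ?thesis unfolding norm_L2_def A_def B_def by simp
  qed
  then show ?thesis using D by (intro exI[of _ "sqrt D"] conjI allI impI) auto
qed

end
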